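(* Let $I$ be a countable set and let $\{d_i\}_{i\in I}$ be a sequence in $[0,1]$ such that for some $\alpha\in(0,1)$ $$\sum_{d_i<\alpha}d_i+\sum_{d_i\ge\alpha}(1-d_i)<\infty,$$ and such that $$|\{i\in I:0<d_i<1/2\}|=|\{i\in I:1/2\le d_i<1\}|=\infty.$$ Let $N\in\mathbb{N}$. Then the set $\Lambda_N(\{d_i\})$ has exactly $N$ minimal elements with respect to the majorization order $\prec$, or exactly $N-1$ minimal elements if $\{d_i\}_{i\in I}$ is the diagonal of an orthogonal projection (sequences with the same decreasing rearrangement being identified). More precisely: If $\{d_i\}_{i\in I}$ is not the diagonal of an orthogonal projection, there exist $0\le\eta<1$ and $\boldsymbol\mu^k=(\mu^k_1,\dots,\mu^k_N)\in(0,1)^N$, $k=0,\dots,N-1$, such that $$\Lambda_N(\{d_i\})=\bigcup_{k=0}^{N-1}\{\boldsymbol\lambda\in(0,1)^N:\boldsymbol\mu^k\prec\boldsymbol\lambda\},\qquad\sum_{i=1}^N\mu_i^k=k+\eta .$$ If $\{d_i\}_{i\in I}$ is the diagonal of an orthogonal projection, the same holds with $\eta=0$ and with $k$ ranging only over $1,\dots,N-1$: there exist $\boldsymbol\mu^k\in(0,1)^N$, $k=1,\dots,N-1$, with $\sum_{i=1}^N\mu^k_i=k$ and $\Lambda_N(\{d_i\})=\bigcup_{k=1}^{N-1}\{\boldsymbol\lambda\in(0,1)^N:\boldsymbol\mu^k\prec\boldsymbol\lambda\}$.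
   Context: An operator $E$ on a Hilbert space has diagonal $\{d_i\}_{i\in I}$ if there is an orthonormal basis $\{e_i\}_{i\in I}$ with $\langle Ee_i,e_i\rangle=d_i$ for all $i\in I$. For a self-adjoint operator $E$ on $\mathcal{H}$ with $\sigma(E)\subset[0,1]$ put $\mathcal{H}_E=(\ker E\oplus\ker(\mathbf{I}-E))^\perp$. For a sequence $\{d_i\}_{i\in I}$ in $[0,1]$, $\Lambda_N(\{d_i\})$ is the set of all $(\lambda_1,\dots,\lambda_N)\in(0,1)^N$ for which there exists a positive operator $E$ (with $\sigma(E)\subset[0,1]$) with diagonal $\{d_i\}_{i\in I}$ such that $\dim\mathcal{H}_E=N$ and $E|_{\mathcal{H}_E}$ has eigenvalues $\lambda_1,\dots,\lambda_N$ listed with multiplicities. Majorization order: for $\boldsymbol\lambda,\boldsymbol\mu\in\mathbb{R}^N$ with decreasing rearrangements $\{\lambda_{[i]}\}$, $\{\mu_{[i]}\}$, $\boldsymbol\lambda\prec\boldsymbol\mu$ means $\sum_{i=1}^N\lambda_{[i]}=\sum_{i=1}^N\mu_{[i]}$ and $\sum_{i=1}^n\lambda_{[i]}\le\sum_{i=1}^n\mu_{[i]}$ for all $1\le n\le N$. It is a partial order after identifying sequences with the same decreasing rearrangement. An empty union is the empty set. *)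

theory Defs
  imports "HOL-Analysis.Analysis"
begin

section \<open>Complex Hilbert spaces\<close>

text \<open>
  A complex Hilbert space is presented as a complete real inner product space that carries in
  addition a complex scalar multiplication and a sesquilinear form (linear in the first argument)
  whose real part is the real inner product.  Norm, topology and completeness are thus those of the
  library classes, and \<open>norm x ^ 2 = Re (cinner x x)\<close>.
\<close>

class chilbert_space = real_inner + complete_space +
  fixes scaleC :: "complex \<Rightarrow> 'a \<Rightarrow> 'a" (infixr \<open>*\<^sub>C\<close> 75)
    and cinner :: "'a \<Rightarrow> 'a \<Rightarrow> complex"
  assumes scaleC_add_right: "c *\<^sub>C (x + y) = c *\<^sub>C x + c *\<^sub>C y"
    and scaleC_add_left: "(b + c) *\<^sub>C x = b *\<^sub>C x + c *\<^sub>C x"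
    and scaleC_scaleC: "b *\<^sub>C (c *\<^sub>C x) = (b * c) *\<^sub>C x"
    and scaleC_of_real: "complex_of_real r *\<^sub>C x = r *\<^sub>R x"
    and cinner_commute: "cinner x y = cnj (cinner y x)"
    and cinner_add_left: "cinner (x + y) z = cinner x z + cinner y z"
    and cinner_scaleC_left: "cinner (c *\<^sub>C x) y = c * cinner x y"
    and Re_cinner: "Re (cinner x y) = inner x y"

global_interpretation complex_vector:
  vector_space "scaleC :: complex \<Rightarrow> 'h \<Rightarrow> 'h::chilbert_space"
proof
  show "1 *\<^sub>C x = x" for x :: 'h
    using scaleC_of_real[of 1 x] by simp
qed (simp_all add: scaleC_add_right scaleC_add_left scaleC_scaleC)

text \<open>
  The relation form avoids the library's \<open>dim\<close>, which is \<open>0\<close> on infinite-dimensional subspaces.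
\<close>

definition has_cdim :: "'h::chilbert_space set \<Rightarrow> nat \<Rightarrow> bool" where
  "has_cdim V n \<longleftrightarrow>
     (\<exists>B. finite B \<and> card B = n \<and> \<not> complex_vector.dependent B \<and> complex_vector.span B = V)"

definition orth_complement :: "'h::chilbert_space set \<Rightarrow> 'h set" where
  "orth_complement V = {x. \<forall>v\<in>V. cinner x v = 0}"

definition is_onb :: "'i set \<Rightarrow> ('i \<Rightarrow> 'h::chilbert_space) \<Rightarrow> bool" where
  "is_onb I e \<longleftrightarrow>
     (\<forall>i\<in>I. \<forall>j\<in>I. cinner (e i) (e j) = (if i = j then 1 else 0)) \<and>
     closure (complex_vector.span (e ` I)) = UNIV"


section \<open>Operators\<close>

definition bounded_clinear :: "('h::chilbert_space \<Rightarrow> 'h) \<Rightarrow> bool" where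
  "bounded_clinear E \<longleftrightarrow> bounded_linear E \<and> (\<forall>c x. E (c *\<^sub>C x) = c *\<^sub>C E x)"

definition self_adjoint :: "('h::chilbert_space \<Rightarrow> 'h) \<Rightarrow> bool" where
  "self_adjoint E \<longleftrightarrow> bounded_clinear E \<and> (\<forall>x y. cinner (E x) y = cinner x (E y))"

definition positive_operator :: "('h::chilbert_space \<Rightarrow> 'h) \<Rightarrow> bool" where
  "positive_operator E \<longleftrightarrow> self_adjoint E \<and> (\<forall>x. 0 \<le> Re (cinner (E x) x))"

definition orthogonal_projection :: "('h::chilbert_space \<Rightarrow> 'h) \<Rightarrow> bool" where
  "orthogonal_projection P \<longleftrightarrow> self_adjoint P \<and> P \<circ> P = P"

definition spectrum :: "('h::chilbert_space \<Rightarrow> 'h) \<Rightarrow> complex set" where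
  "spectrum E =
     {z. \<not> (\<exists>T. bounded_clinear T \<and>
              (\<forall>x. T (E x - z *\<^sub>C x) = x) \<and> (\<forall>x. E (T x) - z *\<^sub>C T x = x))}"

definition has_diagonal :: "('h::chilbert_space \<Rightarrow> 'h) \<Rightarrow> 'i set \<Rightarrow> ('i \<Rightarrow> real) \<Rightarrow> bool" where
  "has_diagonal E I d \<longleftrightarrow>
     (\<exists>e. is_onb I e \<and> (\<forall>i\<in>I. cinner (E (e i)) (e i) = complex_of_real (d i)))"

definition H_part :: "('h::chilbert_space \<Rightarrow> 'h) \<Rightarrow> 'h set" where
  "H_part E = orth_complement {u + v |u v. E u = 0 \<and> v - E v = 0}"

text \<open>
  The eigenvalues of \<open>E\<close> restricted to \<open>H_part E\<close>, listed with multiplicities, are the entries of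
  the list \<open>l\<close>: the multiplicity of \<open>t\<close> is the dimension of its eigenspace, and it is \<open>0\<close> when \<open>t\<close>
  is not an eigenvalue.
\<close>

definition has_eigenvalue_list :: "('h::chilbert_space \<Rightarrow> 'h) \<Rightarrow> real list \<Rightarrow> bool" where
  "has_eigenvalue_list E l \<longleftrightarrow>
     (\<forall>t. has_cdim {v \<in> H_part E. E v = t *\<^sub>C v} (count_list (map complex_of_real l) t))"

text \<open>Points of \<open>(0,1)^N\<close> are lists of length \<open>N\<close>.\<close>

definition open_cube :: "nat \<Rightarrow> real list set" where
  "open_cube N = {l. length l = N \<and> set l \<subseteq> {0<..<1}}"

text \<open>
  The type argument is the Hilbert space on which the operators act.  If \<open>E\<close> has a diagonal indexed
  by \<open>I\<close>, its space has an orthonormal basis indexed by \<open>I\<close>; all such spaces are unitarily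
  equivalent, so that \<open>Lambda\<close> is the same set for each of them.
\<close>

definition Lambda :: "'h::chilbert_space itself \<Rightarrow> 'i set \<Rightarrow> ('i \<Rightarrow> real) \<Rightarrow> nat \<Rightarrow> real list set" where
  "Lambda _ I d N =
     {l \<in> open_cube N. \<exists>E :: 'h \<Rightarrow> 'h.
        positive_operator E \<and> spectrum E \<subseteq> complex_of_real ` {0..1} \<and> has_diagonal E I d \<and>
        has_cdim (H_part E) N \<and> has_eigenvalue_list E l}"


section \<open>Majorization\<close>

definition decreasing :: "real list \<Rightarrow> real list" where
  "decreasing l = rev (sort l)"

definition majorized :: "real list \<Rightarrow> real list \<Rightarrow> bool" (infix \<open>\<preceq>\<^sub>m\<close> 50) where
  "l \<preceq>\<^sub>m m \<longleftrightarrow> length l = length m \<and>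
     sum_list (decreasing l) = sum_list (decreasing m) \<and>
     (\<forall>n\<in>{1..length l}. sum_list (take n (decreasing l)) \<le> sum_list (take n (decreasing m)))"

text \<open>
  The minimal elements of \<open>A\<close>, where lists with the same decreasing rearrangement are identified and
  a class is represented by that rearrangement.
\<close>

definition minimal_classes :: "real list set \<Rightarrow> real list set" where
  "minimal_classes A =
     decreasing ` {l \<in> A. \<forall>m\<in>A. m \<preceq>\<^sub>m l \<longrightarrow> decreasing m = decreasing l}"

end

theory Submission
  imports "Jordan_Normal_Form.Schur_Decomposition" Defs
begin

text \<open>
  For a splitting of \<open>I\<close> into \<open>J\<close> and its complement, with \<open>d\<close> summable on \<open>J\<close> and \<open>1 - d\<close> summable
  off \<open>J\<close>, let the excess of \<open>J\<close> be \<open>(\<Sum>i\<in>J. d i) - (\<Sum>i\<in>I-J. 1 - d i)\<close>; modulo the integers it does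
  not depend on \<open>J\<close>.  A list \<open>l\<close> with sum \<open>s\<close> belongs to \<open>\<Lambda>\<^sub>N\<close> if and only if \<open>s\<close> is congruent to the
  excess modulo \<open>1\<close> and \<open>s - (\<Sum>i\<in>J. d i)\<close> is at most the sum of the \<open>n\<close> largest entries of \<open>l\<close>
  whenever \<open>J\<close> has excess \<open>s - n\<close>.

  Necessity: \<open>E\<close> is the sum of a projection, whose excess is an integer (Kadison), and a finite rank
  part; the inequalities are Jensen's inequality for the concave functions
  \<open>x \<mapsto> min ((1 - t) * x) (t * (1 - x))\<close>.  Sufficiency: both tails of \<open>d\<close> are collapsed to a
  single entry each, the resulting finite problem is solved by Horn's theorem, and the two entries are
  spread out again by reflections.

  For fixed \<open>s\<close> the inequalities are lower bounds for the partial sums of the decreasing rearrangement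
  of \<open>l\<close>.  The pointwise infimum of the concave sequences above these bounds is again such a sequence,
  so there is exactly one minimal element for each \<open>s\<close>.
\<close>

section \<open>Traces of Hermitian matrices\<close>

text \<open>Infinitely many entries in (0,1/2) and in [1/2,1) keep the lower bounds for the partial
  sums uniformly below both \<open>n\<close> and the total \<open>s\<close>. Hence every admissible
  \<open>s\<close> has a feasible list, and the infimum over all of them stays in the open cube
  instead of picking up entries 0 or 1. The same hypothesis makes both collapsed tails positive,
  however large the finite core is, and lets the core contain enough entries above a tail value for
  the exchange argument to succeed.

  Facts about the upper tail mostly come from facts about a lower tail, by passing to
  \<open>1 - d\<close> and to the operator \<open>1 - E\<close>.

  Kadison's integrality is obtained from finite compressions of the projection: their traces are
  close to integers, with an error bounded by a tail sum that can be made arbitrarily small, and the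
  integers form a closed set.

  Projection diagonals fall under the same realization theorem, applied with no eigenvalue strictly
  between 0 and 1. They are exactly the integral excesses, and an integral sum strictly between 0
  and \<open>N\<close> cannot have integer part 0; this is why one minimal element
  disappears.\<close>

lemma sum_diag_mult_commute:
  fixes A B :: "complex mat"
  assumes "A \<in> carrier_mat n n" "B \<in> carrier_mat n n"
  shows "(\<Sum>i<n. (A * B) $$ (i,i)) = (\<Sum>i<n. (B * A) $$ (i,i))"
proof -
  have "(\<Sum>i<n. (A * B) $$ (i,i)) = (\<Sum>i<n. \<Sum>j<n. A $$ (i,j) * B $$ (j,i))"
    using assms by (intro sum.cong) (auto simp: scalar_prod_def lessThan_atLeast0)
  also have "\<dots> = (\<Sum>j<n. \<Sum>i<n. B $$ (j,i) * A $$ (i,j))"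
    by (subst sum.swap) (simp add: mult.commute)
  also have "\<dots> = (\<Sum>j<n. (B * A) $$ (j,j))"
    using assms by (intro sum.cong) (auto simp: scalar_prod_def lessThan_atLeast0)
  finally show ?thesis .
qed

lemma sum_diag_similar:
  fixes A B :: "complex mat"
  assumes "A \<in> carrier_mat n n" "B \<in> carrier_mat n n" "P \<in> carrier_mat n n" "Q \<in> carrier_mat n n"
    "Q * P = 1\<^sub>m n" "A = P * B * Q"
  shows "(\<Sum>i<n. A $$ (i,i)) = (\<Sum>i<n. B $$ (i,i))"
proof -
  have "(\<Sum>i<n. A $$ (i,i)) = (\<Sum>i<n. (Q * (P * B)) $$ (i,i))"
    unfolding assms(6) using assms(2-4) by (intro sum_diag_mult_commute) auto
  also have "Q * (P * B) = B"
    using assms(2-5) assoc_mult_mat[OF assms(4,3,2)] by simp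
  finally show ?thesis .
qed

text \<open>An eigenvector makes each diagonal entry of \<open>B\<close> a value of the Rayleigh
  quotient of \<open>A\<close>, so that bounds on the quadratic form become bounds on the entry. It
  exists because similar matrices share their characteristic polynomial.\<close>

lemma diagonal_entry_eigenvalue:
  fixes A B :: "complex mat"
  assumes A: "A \<in> carrier_mat n n" and B: "B \<in> carrier_mat n n" "upper_triangular B" "similar_mat A B" and "i < n"
  shows "\<exists>v. v \<in> carrier_vec n \<and> v \<noteq> 0\<^sub>v n \<and> A *\<^sub>v v = B $$ (i,i) \<cdot>\<^sub>v v"
proof -
  have "char_poly A = (\<Prod>a \<leftarrow> diag_mat B. [:- a, 1:])"
    using char_poly_similar[OF B(3)] char_poly_upper_triangular[OF B(1,2)] by simp
  moreover have "B $$ (i,i) \<in> set (diag_mat B)" using \<open>i < n\<close> B(1) by (auto simp: diag_mat_def)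
  ultimately have "poly (char_poly A) (B $$ (i,i)) = 0"
    by (force simp: poly_prod_list o_def prod_list_zero_iff)
  then have "eigenvalue A (B $$ (i,i))" using eigenvalue_root_char_poly[OF A] by simp
  then show ?thesis using A by (auto simp: eigenvalue_def eigenvector_def)
qed

text \<open>
  Schur triangularization makes the trace of \<open>A\<close> the sum of the eigenvalues \<open>t\<close>, which lie in
  \<open>[0,1]\<close>, and the trace of \<open>A - A\<^sup>2\<close> the sum of the \<open>t (1 - t)\<close>, each of which controls the distance
  of \<open>t\<close> to \<open>{0,1}\<close>.
\<close>

lemma trace_near_integer:
  fixes c :: "nat \<Rightarrow> nat \<Rightarrow> complex"
  assumes herm: "\<And>i j. i < n \<Longrightarrow> j < n \<Longrightarrow> c j i = cnj (c i j)"
    and pos: "\<And>x. 0 \<le> Re (\<Sum>i<n. \<Sum>j<n. cnj (x i) * c i j * x j)"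
    and le: "\<And>x. Re (\<Sum>i<n. \<Sum>j<n. cnj (x i) * c i j * x j) \<le> (\<Sum>i<n. (cmod (x i))\<^sup>2)"
  shows "\<exists>k::int. \<bar>Re (\<Sum>i<n. c i i) - of_int k\<bar> \<le> 2 * (Re (\<Sum>i<n. c i i) - (\<Sum>i<n. \<Sum>j<n. (cmod (c i j))\<^sup>2))"
proof -
  define A where "A = Matrix.mat n n (\<lambda>(i,j). c i j)"
  have A: "A \<in> carrier_mat n n" by (simp add: A_def)
  obtain as where "char_poly A = (\<Prod>a\<leftarrow>as. [:- a, 1:])"
    using char_poly_factorized[OF A] by blast
  then obtain B where B: "B \<in> carrier_mat n n" "upper_triangular B" "similar_mat A B"
    using schur_decomposition_exists[OF A] by blast
  then obtain P Q where "similar_mat_wit A B P Q" by (auto simp: similar_mat_def)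
  from similar_mat_witD2[OF A this] have PQ: "P * Q = 1\<^sub>m n" "Q * P = 1\<^sub>m n" "A = P * B * Q"
      "P \<in> carrier_mat n n" "Q \<in> carrier_mat n n" by auto
  have real: "\<exists>t. 0 \<le> t \<and> t \<le> 1 \<and> B $$ (i,i) = complex_of_real t" if i: "i < n" for i
  proof -
    obtain v where v: "v \<in> carrier_vec n" "v \<noteq> 0\<^sub>v n" "A *\<^sub>v v = B $$ (i,i) \<cdot>\<^sub>v v"
      using diagonal_entry_eigenvalue[OF A B i] by blast
    let ?b = "B $$ (i,i)" and ?x = "\<lambda>i. v $ i"
    define S where "S = (\<Sum>i<n. \<Sum>j<n. cnj (?x i) * c i j * ?x j)"
    define M where "M = (\<Sum>i<n. (cmod (?x i))\<^sup>2)"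
    have "(\<Sum>j<n. c k j * ?x j) = ?b * ?x k" if "k < n" for k
      using arg_cong[OF v(3), of "\<lambda>w. w $ k"] that v(1)
      by (simp add: A_def scalar_prod_def lessThan_atLeast0)
    then have "S = (\<Sum>k<n. cnj (?x k) * (?b * ?x k))"
      unfolding S_def by (intro sum.cong refl) (simp add: sum_distrib_left[symmetric] mult.assoc)
    also have "\<dots> = ?b * complex_of_real M"
      unfolding M_def of_real_sum complex_norm_square sum_distrib_left by (intro sum.cong) (auto simp: ac_simps)
    finally have SM: "S = ?b * complex_of_real M" .
    obtain k where k: "k < n" "?x k \<noteq> 0"
      using v(1,2) by (metis eq_vecI carrier_vecD index_zero_vec)
    have M: "M > 0" unfolding M_def by (rule sum_pos2[of _ k]) (use k in auto)
    have "cnj S = S"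
    proof -
      have "cnj S = (\<Sum>i<n. \<Sum>j<n. cnj (?x j) * c j i * ?x i)"
        unfolding S_def cnj_sum complex_cnj_mult complex_cnj_cnj
      proof (intro sum.cong refl)
        fix i j assume "i \<in> {..<n}" "j \<in> {..<n}"
        then have "cnj (c i j) = c j i" using herm[of i j] by simp
        then show "?x i * cnj (c i j) * cnj (?x j) = cnj (?x j) * c j i * ?x i" by (simp only: ac_simps)
      qed
      also have "\<dots> = S" unfolding S_def by (rule sum.swap)
      finally show ?thesis .
    qed
    then have "Im S = 0" by (metis complex_is_Real_iff Reals_cnj_iff)
    then have Imb: "Im ?b = 0" using SM M by simp
    have "Re S = Re ?b * M" using SM by simp
    moreover have "0 \<le> Re S" "Re S \<le> M" using pos[of ?x] le[of ?x] by (auto simp: S_def M_def)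
    ultimately have "0 \<le> Re ?b" "Re ?b \<le> 1" using M by (auto simp: zero_le_mult_iff)
    then show ?thesis using Imb by (intro exI[of _ "Re ?b"]) (auto simp: complex_eq_iff)
  qed
  then obtain t where t: "\<And>i. i < n \<Longrightarrow> 0 \<le> t i \<and> t i \<le> 1 \<and> B $$ (i,i) = complex_of_real (t i)" by metis
  have tr1: "(\<Sum>i<n. c i i) = complex_of_real (\<Sum>i<n. t i)"
  proof -
    have "(\<Sum>i<n. c i i) = (\<Sum>i<n. A $$ (i,i))" by (simp add: A_def)
    also have "\<dots> = (\<Sum>i<n. B $$ (i,i))" by (rule sum_diag_similar[OF A B(1) PQ(4,5,2,3)])
    finally show ?thesis using t by simp
  qed
  have "A * A = P * B * Q * (P * B * Q)" using PQ(3) by simp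
  also have "\<dots> = P * (B * (Q * P) * B) * Q" using PQ(4,5) B(1) by (simp add: assoc_mult_mat[of _ n n _ n _ n])
  also have "\<dots> = P * (B * B) * Q" using PQ(2) B(1) by simp
  finally have AA: "A * A = P * (B * B) * Q" .
  have tr2: "complex_of_real (\<Sum>i<n. \<Sum>j<n. (cmod (c i j))\<^sup>2) = complex_of_real (\<Sum>i<n. (t i)\<^sup>2)"
  proof -
    have "complex_of_real (\<Sum>i<n. \<Sum>j<n. (cmod (c i j))\<^sup>2) = (\<Sum>i<n. \<Sum>j<n. c i j * c j i)"
      unfolding of_real_sum complex_norm_square
      by (intro sum.cong refl arg_cong2[where f="(*)"] herm[symmetric]) auto
    also have "\<dots> = (\<Sum>i<n. (A * A) $$ (i,i))"
      by (intro sum.cong) (auto simp: A_def scalar_prod_def lessThan_atLeast0)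
    also have "\<dots> = (\<Sum>i<n. (B * B) $$ (i,i))"
      by (rule sum_diag_similar[OF _ _ PQ(4,5,2) AA]) (use A B in auto)
    also have "\<dots> = (\<Sum>i<n. B $$ (i,i) * B $$ (i,i))"
    proof (intro sum.cong refl)
      fix i assume i: "i \<in> {..<n}"
      have "(B * B) $$ (i,i) = (\<Sum>j<n. B $$ (i,j) * B $$ (j,i))"
        using i B(1) by (auto simp: scalar_prod_def lessThan_atLeast0)
      also have "\<dots> = (\<Sum>j<n. if j = i then B $$ (i,i) * B $$ (i,i) else 0)"
      proof (intro sum.cong refl)
        fix j assume j: "j \<in> {..<n}"
        show "B $$ (i,j) * B $$ (j,i) = (if j = i then B $$ (i,i) * B $$ (i,i) else 0)"
          using upper_triangularD[OF B(2), of i j] upper_triangularD[OF B(2), of j i] i j B(1)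
          by (cases "i < j"; cases "j < i") auto
      qed
      also have "\<dots> = B $$ (i,i) * B $$ (i,i)" using i by simp
      finally show "(B * B) $$ (i,i) = B $$ (i,i) * B $$ (i,i)" .
    qed
    also have "\<dots> = complex_of_real (\<Sum>i<n. (t i)\<^sup>2)" using t by (simp add: power2_eq_square)
    finally show ?thesis .
  qed
  then have tr2': "(\<Sum>i<n. \<Sum>j<n. (cmod (c i j))\<^sup>2) = (\<Sum>i<n. (t i)\<^sup>2)" by (simp only: of_real_eq_iff)
  \<comment> \<open>Rounding to the nearer of 0 and 1. One of \<open>t\<close> and
    \<open>1 - t\<close> is at least 1/2, so the other is at most \<open>2 * t * (1 - t)\<close>;
    this is the origin of the factor 2 in the conclusion.\<close>
  define r where "r i = (if t i \<le> 1/2 then 0 else 1 :: int)" for i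
  have "\<bar>t i - of_int (r i)\<bar> \<le> 2 * (t i - (t i)\<^sup>2)" if "i < n" for i
  proof -
    have ti: "0 \<le> t i" "t i \<le> 1" using t[OF that] by auto
    show ?thesis
    proof (cases "t i \<le> 1/2")
      case True
      have "t i * t i \<le> t i * (1/2)" using True ti by (intro mult_left_mono) auto
      then show ?thesis using True ti by (simp add: r_def power2_eq_square)
    next
      case False
      have "0 \<le> (2 * t i - 1) * (1 - t i)" using False ti by (intro mult_nonneg_nonneg) auto
      then show ?thesis using False ti by (simp add: r_def power2_eq_square algebra_simps)
    qed
  qed
  then have "(\<Sum>i<n. \<bar>t i - of_int (r i)\<bar>) \<le> (\<Sum>i<n. 2 * (t i - (t i)\<^sup>2))" by (intro sum_mono) auto
  moreover have "\<bar>\<Sum>i<n. t i - of_int (r i)\<bar> \<le> (\<Sum>i<n. \<bar>t i - of_int (r i)\<bar>)" by (rule sum_abs)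
  ultimately have "\<bar>(\<Sum>i<n. t i) - of_int (\<Sum>i<n. r i)\<bar> \<le> 2 * ((\<Sum>i<n. t i) - (\<Sum>i<n. (t i)\<^sup>2))"
    by (simp add: sum_subtractf sum_distrib_left[symmetric])
  then show ?thesis unfolding tr2' tr1 by (intro exI[of _ "\<Sum>i<n. r i"]) simp
qed

section \<open>Orthonormal bases\<close>

lemma cinner_add_right: "cinner x (y + z) = cinner x y + cinner x (z::'h::chilbert_space)"
  by (metis cinner_add_left cinner_commute complex_cnj_add)

lemma cinner_scaleC_right: "cinner x (c *\<^sub>C y) = cnj c * cinner x (y::'h::chilbert_space)"
  by (metis cinner_scaleC_left cinner_commute complex_cnj_mult)

lemma scaleC_minus1: "(-1) *\<^sub>C x = - (x::'h::chilbert_space)"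
  using scaleC_of_real[of "-1" x] by simp

lemma cinner_minus_left: "cinner (- x) y = - cinner x (y::'h::chilbert_space)"
  using cinner_scaleC_left[of "-1" x y] by (simp add: scaleC_minus1)

lemma cinner_minus_right: "cinner x (- y) = - cinner x (y::'h::chilbert_space)"
  using cinner_scaleC_right[of x "-1" y] by (simp add: scaleC_minus1)

lemma cinner_diff_left: "cinner (x - y) z = cinner x z - cinner y (z::'h::chilbert_space)"
  using cinner_add_left[of x "-y" z] by (simp add: cinner_minus_left)

lemma cinner_diff_right: "cinner x (y - z) = cinner x y - cinner x (z::'h::chilbert_space)"
  using cinner_add_right[of x y "-z"] by (simp add: cinner_minus_right)

lemma cinner_zero_left [simp]: "cinner 0 (y::'h::chilbert_space) = 0"
  using cinner_diff_left[of 0 0 y] by simp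

lemma cinner_zero_right [simp]: "cinner (x::'h::chilbert_space) 0 = 0"
  using cinner_diff_right[of x 0 0] by simp

lemma cinner_sum_left: "cinner (sum f A) (y::'h::chilbert_space) = (\<Sum>a\<in>A. cinner (f a) y)"
  by (induction A rule: infinite_finite_induct) (auto simp: cinner_add_left)

lemma cinner_sum_right: "cinner (y::'h::chilbert_space) (sum f A) = (\<Sum>a\<in>A. cinner y (f a))"
  by (induction A rule: infinite_finite_induct) (auto simp: cinner_add_right)

lemmas cinner_simps = cinner_add_left cinner_add_right cinner_diff_left cinner_diff_right
  cinner_scaleC_left cinner_scaleC_right cinner_minus_left cinner_minus_right

lemma cinner_self: "cinner x x = complex_of_real ((norm (x::'h::chilbert_space))\<^sup>2)"
proof -
  have "Im (cinner x x) = 0"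
    using cinner_commute[of x x] by (metis complex_is_Real_iff Reals_cnj_iff)
  moreover have "Re (cinner x x) = (norm x)\<^sup>2"
    by (simp add: Re_cinner power2_norm_eq_inner)
  ultimately show ?thesis by (simp add: complex_eq_iff)
qed

lemma Re_cinner_self: "Re (cinner x x) = (norm (x::'h::chilbert_space))\<^sup>2"
  by (simp add: cinner_self)

lemma cinner_self_eq_0_iff [simp]: "cinner x x = 0 \<longleftrightarrow> (x::'h::chilbert_space) = 0"
  by (simp add: cinner_self)

lemma norm_scaleC: "norm (c *\<^sub>C x) = cmod c * norm (x::'h::chilbert_space)"
proof -
  have "complex_of_real ((norm (c *\<^sub>C x))\<^sup>2) = complex_of_real ((cmod c * norm x)\<^sup>2)"
    unfolding power_mult_distrib of_real_mult complex_norm_square cinner_self[symmetric]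
    by (simp add: cinner_simps)
  then have "(norm (c *\<^sub>C x))\<^sup>2 = (cmod c * norm x)\<^sup>2"
    by (simp only: of_real_eq_iff)
  then show ?thesis by (simp add: power2_eq_iff_nonneg)
qed

text \<open>Multiplying \<open>x\<close> by a unimodular number turns the inner product into its
  modulus, which reduces the claim to the real Cauchy-Schwarz inequality.\<close>

lemma norm_cinner_le: "cmod (cinner x y) \<le> norm x * norm (y::'h::chilbert_space)"
proof (cases "cinner x y = 0")
  case False
  define u where "u = cnj (sgn (cinner x y))"
  have "u * cinner x y = complex_of_real (cmod (cinner x y))"
  proof -
    have "u * cinner x y = cinner x y * cnj (cinner x y) / cmod (cinner x y)"
      by (simp add: u_def sgn_div_norm scaleR_conv_of_real field_simps)
    also have "\<dots> = complex_of_real ((cmod (cinner x y))\<^sup>2) / cmod (cinner x y)"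
      by (simp only: complex_norm_square)
    finally show ?thesis using False by (simp add: power2_eq_square)
  qed
  then have "cmod (cinner x y) = Re (cinner (u *\<^sub>C x) y)"
    by (simp add: cinner_simps)
  also have "\<dots> \<le> norm (u *\<^sub>C x) * norm y"
    by (simp add: Re_cinner norm_cauchy_schwarz)
  also have "norm (u *\<^sub>C x) = norm x"
    using False by (simp add: norm_scaleC u_def norm_sgn)
  finally show ?thesis .
qed simp

lemma bounded_linear_cinner_left: "bounded_linear (\<lambda>x. cinner x (y::'h::chilbert_space))"
proof (rule bounded_linear_intro[where K="norm y"])
  show "cinner (r *\<^sub>R x) y = r *\<^sub>R cinner x y" for r x
    by (simp add: scaleC_of_real[symmetric] cinner_simps scaleR_conv_of_real)
qed (auto simp: cinner_add_left norm_cinner_le)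

lemma pythagoras_cinner:
  fixes x y :: "'h::chilbert_space"
  assumes "cinner x y = 0"
  shows "(norm (x + y))\<^sup>2 = (norm x)\<^sup>2 + (norm y)\<^sup>2"
  using assms Re_cinner[of x y]
  by (simp add: power2_norm_eq_inner inner_add_left inner_add_right inner_commute)

lemma norm_diff_sq_cinner:
  fixes x y :: "'h::chilbert_space"
  shows "(norm (x - y))\<^sup>2 = (norm x)\<^sup>2 + (norm y)\<^sup>2 - 2 * Re (cinner x y)"
  by (simp add: power2_norm_eq_inner inner_diff_left inner_diff_right inner_commute Re_cinner)

definition orthonormal_on :: "'i set \<Rightarrow> ('i \<Rightarrow> 'h::chilbert_space) \<Rightarrow> bool" where
  "orthonormal_on A e \<longleftrightarrow> (\<forall>i\<in>A. \<forall>j\<in>A. cinner (e i) (e j) = (if i = j then 1 else 0))"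

lemma orthonormal_onD: "orthonormal_on A e \<Longrightarrow> i \<in> A \<Longrightarrow> j \<in> A \<Longrightarrow> cinner (e i) (e j) = (if i = j then 1 else 0)"
  by (simp add: orthonormal_on_def)

lemma orthonormal_on_subset: "orthonormal_on A e \<Longrightarrow> B \<subseteq> A \<Longrightarrow> orthonormal_on B e"
  unfolding orthonormal_on_def by blast

lemma is_onb_iff: "is_onb I e \<longleftrightarrow> orthonormal_on I e \<and> closure (complex_vector.span (e ` I)) = UNIV"
  by (simp add: is_onb_def orthonormal_on_def)

lemma orthonormal_on_norm: "orthonormal_on A e \<Longrightarrow> i \<in> A \<Longrightarrow> norm (e i) = 1"
  using orthonormal_onD[of A e i i] Re_cinner_self[of "e i"] by (simp add: power2_eq_1_iff)
    (smt (verit) norm_ge_zero)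

lemma norm_sq_sum_orthonormal:
  assumes "orthonormal_on A e" "finite A"
  shows "(norm (\<Sum>i\<in>A. c i *\<^sub>C e i))\<^sup>2 = (\<Sum>i\<in>A. (cmod (c i))\<^sup>2)"
proof -
  have "cinner (\<Sum>i\<in>A. c i *\<^sub>C e i) (\<Sum>i\<in>A. c i *\<^sub>C e i)
        = (\<Sum>i\<in>A. \<Sum>j\<in>A. c i * cnj (c j) * cinner (e i) (e j))"
    by (subst sum.swap) (simp add: cinner_sum_left cinner_sum_right cinner_simps sum_distrib_left ac_simps)
  also have "\<dots> = (\<Sum>i\<in>A. \<Sum>j\<in>A. if i = j then c i * cnj (c j) else 0)"
    using assms by (intro sum.cong) (auto simp: orthonormal_onD)
  also have "\<dots> = (\<Sum>i\<in>A. c i * cnj (c i))"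
    using assms by simp
  also have "\<dots> = complex_of_real (\<Sum>i\<in>A. (cmod (c i))\<^sup>2)"
    by (simp only: complex_norm_square of_real_sum)
  finally show ?thesis by (metis Re_cinner_self Re_complex_of_real)
qed

lemma cinner_sum_orthonormal:
  assumes "orthonormal_on A e" "finite F" "F \<subseteq> A" "i \<in> A"
  shows "cinner (\<Sum>j\<in>F. c j *\<^sub>C e j) (e i) = (if i \<in> F then c i else 0)"
proof -
  have "cinner (\<Sum>j\<in>F. c j *\<^sub>C e j) (e i) = (\<Sum>j\<in>F. if j = i then c j else 0)"
    using assms unfolding cinner_sum_left cinner_scaleC_left by (intro sum.cong) (auto simp: orthonormal_onD)
  then show ?thesis using assms by simp
qed

lemma norm_sq_proj_orthonormal:
  assumes "orthonormal_on A e" "finite A"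
  shows "(norm (x - (\<Sum>i\<in>A. cinner x (e i) *\<^sub>C e i)))\<^sup>2 = (norm x)\<^sup>2 - (\<Sum>i\<in>A. (cmod (cinner x (e i)))\<^sup>2)"
proof -
  let ?p = "\<Sum>i\<in>A. cinner x (e i) *\<^sub>C e i"
  have "cinner x ?p = (\<Sum>i\<in>A. complex_of_real ((cmod (cinner x (e i)))\<^sup>2))"
    by (simp only: cinner_sum_right cinner_scaleC_right complex_norm_square mult.commute)
  then have "Re (cinner x ?p) = (\<Sum>i\<in>A. (cmod (cinner x (e i)))\<^sup>2)"
    by simp
  then show ?thesis
    by (simp add: norm_diff_sq_cinner norm_sq_sum_orthonormal[OF assms])
qed

lemma bessel:
  assumes "orthonormal_on A e" "finite A"
  shows "(\<Sum>i\<in>A. (cmod (cinner x (e i)))\<^sup>2) \<le> (norm x)\<^sup>2"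
  using norm_sq_proj_orthonormal[OF assms, of x] by (smt (verit) zero_le_power2)

lemma best_approximation:
  assumes "orthonormal_on A e" "finite A"
  shows "norm (x - (\<Sum>i\<in>A. cinner x (e i) *\<^sub>C e i)) \<le> norm (x - (\<Sum>i\<in>A. c i *\<^sub>C e i))"
proof -
  let ?p = "\<Sum>i\<in>A. cinner x (e i) *\<^sub>C e i"
  let ?q = "\<Sum>i\<in>A. (cinner x (e i) - c i) *\<^sub>C e i"
  have "cinner (x - ?p) (e i) = 0" if "i \<in> A" for i
    using cinner_sum_orthonormal[OF assms(1,2) subset_refl that] that by (simp add: cinner_simps)
  then have "cinner (x - ?p) ?q = 0"
    by (simp add: cinner_sum_right cinner_scaleC_right)
  then have "(norm ((x - ?p) + ?q))\<^sup>2 = (norm (x - ?p))\<^sup>2 + (norm ?q)\<^sup>2"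
    by (rule pythagoras_cinner)
  moreover have "(x - ?p) + ?q = x - (\<Sum>i\<in>A. c i *\<^sub>C e i)"
    by (simp add: complex_vector.scale_left_diff_distrib sum_subtractf)
  ultimately have "(norm (x - ?p))\<^sup>2 \<le> (norm (x - (\<Sum>i\<in>A. c i *\<^sub>C e i)))\<^sup>2"
    by simp
  then show ?thesis by (rule power2_le_imp_le) simp
qed

text \<open>Density supplies a finite combination \<open>y\<close> close to \<open>x\<close>, with
  support \<open>F0\<close>. For every finite \<open>F'\<close> containing \<open>F0\<close>, the
  projection of \<open>x\<close> to the coordinates in \<open>F'\<close> is at least as close to
  \<open>x\<close> as \<open>y\<close> is, by best approximation.\<close>

theorem onb_expansion:
  assumes "is_onb I e"
  shows "((\<lambda>i. cinner x (e i) *\<^sub>C e i) has_sum x) I"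
  unfolding has_sum_def
proof (rule tendstoI)
  fix \<epsilon> :: real assume "\<epsilon> > 0"
  have on: "orthonormal_on I e" and "x \<in> closure (complex_vector.span (e ` I))"
    using assms by (auto simp: is_onb_iff)
  then obtain y where y: "y \<in> complex_vector.span (e ` I)" "dist y x < \<epsilon>"
    using \<open>\<epsilon> > 0\<close> by (auto simp: closure_approachable)
  then obtain T r where T: "finite T" "T \<subseteq> e ` I" "y = (\<Sum>a\<in>T. r a *\<^sub>C a)"
    by (auto simp: complex_vector.span_explicit)
  obtain F0 where F0: "F0 \<subseteq> I" "finite F0" "T = e ` F0"
    using finite_subset_image[OF T(1,2)] by auto
  have inj: "inj_on e I"
    using on by (intro inj_onI) (metis orthonormal_onD zero_neq_one)
  have y': "y = (\<Sum>i\<in>F0. r (e i) *\<^sub>C e i)"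
    using T F0 inj by (simp add: sum.reindex inj_on_subset)
  show "\<forall>\<^sub>F F' in finite_subsets_at_top I. dist (\<Sum>i\<in>F'. cinner x (e i) *\<^sub>C e i) x < \<epsilon>"
    unfolding eventually_finite_subsets_at_top
  proof (intro exI[of _ F0] conjI allI impI)
    fix F' assume F': "finite F' \<and> F0 \<subseteq> F' \<and> F' \<subseteq> I"
    have "y = (\<Sum>i\<in>F'. (if i \<in> F0 then r (e i) else 0) *\<^sub>C e i)"
      unfolding y' using F' by (intro sum.mono_neutral_cong_left) auto
    then have "norm (x - (\<Sum>i\<in>F'. cinner x (e i) *\<^sub>C e i)) \<le> norm (x - y)"
      using best_approximation[OF orthonormal_on_subset[OF on], of F' x] F' by auto
    then show "dist (\<Sum>i\<in>F'. cinner x (e i) *\<^sub>C e i) x < \<epsilon>"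
      using y(2) by (simp add: dist_norm norm_minus_commute)
  qed (use F0 in auto)
qed

lemma onb_cinner_expansion:
  assumes "is_onb I e"
  shows "((\<lambda>i. cinner x (e i) * cinner (e i) y) has_sum cinner x y) I"
  using has_sum_bounded_linear[OF bounded_linear_cinner_left onb_expansion[OF assms]]
  by (simp add: cinner_simps o_def)

lemma parseval:
  assumes "is_onb I e"
  shows "((\<lambda>i. (cmod (cinner x (e i)))\<^sup>2) has_sum (norm x)\<^sup>2) I"
proof -
  have "((\<lambda>i. complex_of_real ((cmod (cinner x (e i)))\<^sup>2)) has_sum complex_of_real ((norm x)\<^sup>2)) I"
  proof -
    have "complex_of_real ((cmod (cinner x (e i)))\<^sup>2) = cinner x (e i) * cinner (e i) x" for i
      using cinner_commute[of "e i" x] by (simp only: complex_norm_square)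
    then show ?thesis using onb_cinner_expansion[OF assms, of x x] by (simp only: cinner_self)
  qed
  then show ?thesis by (simp only: has_sum_of_real_iff)
qed

lemma onb_eqI:
  assumes "is_onb I e" "\<And>i. i \<in> I \<Longrightarrow> cinner x (e i) = cinner y (e i)"
  shows "x = y"
proof -
  have "((\<lambda>i. cinner x (e i) *\<^sub>C e i) has_sum y) I"
    using onb_expansion[OF assms(1), of y] assms(2) by (simp cong: has_sum_cong)
  then show ?thesis using onb_expansion[OF assms(1), of x] by (rule has_sum_unique[rotated])
qed

text \<open>The squared distance of two nested partial sums is a partial sum of the squared
  coefficients, so unordered convergence of the latter makes the partial sums a Cauchy filter;
  completeness gives the limit.\<close>

theorem riesz_fischer:
  fixes e :: "'i \<Rightarrow> 'h::chilbert_space"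
  assumes on: "orthonormal_on I e" and sm: "(\<lambda>i. (cmod (c i))\<^sup>2) summable_on I"
  obtains x where "((\<lambda>i. c i *\<^sub>C e i) has_sum x) I" 
proof -
  let ?f = "\<lambda>i. c i *\<^sub>C e i" and ?g = "\<lambda>i. (cmod (c i))\<^sup>2"
  have "\<exists>P. eventually P (finite_subsets_at_top I) \<and> (\<forall>F F'. P F \<and> P F' \<longrightarrow> dist (sum ?f F) (sum ?f F') < \<epsilon>)"
    if "\<epsilon> > 0" for \<epsilon>
  proof -
    have "(sum ?g \<longlongrightarrow> infsum ?g I) (finite_subsets_at_top I)"
      using infsum_tendsto[OF sm] .
    moreover have "\<epsilon>\<^sup>2/4 > 0" using that by simp
    ultimately have "\<forall>\<^sub>F F in finite_subsets_at_top I. dist (sum ?g F) (infsum ?g I) < \<epsilon>\<^sup>2/4"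
      by (rule tendstoD)
    then obtain F0 where F0: "finite F0" "F0 \<subseteq> I"
      "\<And>F. finite F \<Longrightarrow> F0 \<subseteq> F \<Longrightarrow> F \<subseteq> I \<Longrightarrow> dist (sum ?g F) (infsum ?g I) < \<epsilon>\<^sup>2/4"
      unfolding eventually_finite_subsets_at_top by metis
    have *: "dist (sum ?f F) (sum ?f F0) < \<epsilon>/2" if F: "finite F" "F0 \<subseteq> F" "F \<subseteq> I" for F
    proof -
      have "sum ?f F - sum ?f F0 = sum ?f (F - F0)"
        using F by (simp add: sum_diff)
      then have "(norm (sum ?f F - sum ?f F0))\<^sup>2 = sum ?g (F - F0)"
        using norm_sq_sum_orthonormal[OF orthonormal_on_subset[OF on], of "F - F0" c] F by auto
      also have "\<dots> = sum ?g F - sum ?g F0" using F by (simp add: sum_diff)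
      also have "\<dots> \<le> infsum ?g I - sum ?g F0"
        using finite_sum_le_infsum[OF sm, of F] F by auto
      also have "\<dots> < \<epsilon>\<^sup>2/4" using F0(3)[OF F0(1) subset_refl F0(2)] unfolding dist_real_def by linarith
      also have "\<dots> = (\<epsilon>/2)\<^sup>2" by (simp add: power2_eq_square)
      finally show ?thesis
        using \<open>\<epsilon> > 0\<close> power2_less_imp_less[of "norm (sum ?f F - sum ?f F0)" "\<epsilon>/2"] by (simp add: dist_norm)
    qed
    show ?thesis
    proof (intro exI[of _ "\<lambda>F. finite F \<and> F0 \<subseteq> F \<and> F \<subseteq> I"] conjI allI impI)
      show "\<forall>\<^sub>F F in finite_subsets_at_top I. finite F \<and> F0 \<subseteq> F \<and> F \<subseteq> I"
        unfolding eventually_finite_subsets_at_top using F0 by auto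
      show "dist (sum ?f F) (sum ?f F') < \<epsilon>"
        if "(finite F \<and> F0 \<subseteq> F \<and> F \<subseteq> I) \<and> (finite F' \<and> F0 \<subseteq> F' \<and> F' \<subseteq> I)" for F F'
        using dist_triangle_half_l[of "sum ?f F" "sum ?f F0" \<epsilon> "sum ?f F'"] *[of F] *[of F'] that
          by (simp add: dist_commute)
    qed
  qed
  then have "cauchy_filter (filtermap (sum ?f) (finite_subsets_at_top I))"
    unfolding cauchy_filter_metric_filtermap by blast
  moreover have "complete (UNIV :: 'h set)"
    by (meson Cauchy_convergent UNIV_I complete_def convergent_def)
  ultimately obtain x where "(sum ?f \<longlongrightarrow> x) (finite_subsets_at_top I)"
    using cauchy_filter_complete_converges[of "filtermap (sum ?f) (finite_subsets_at_top I)" UNIV]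
    by (auto simp: filterlim_def filtermap_bot_iff)
  then show thesis using that by (simp add: has_sum_def)
qed

lemma has_sum_coordinate:
  assumes on: "orthonormal_on I e" and hs: "((\<lambda>i. c i *\<^sub>C e i) has_sum x) I" and "j \<in> I"
  shows "cinner x (e j) = c j"
proof -
  have "((\<lambda>i. c i * cinner (e i) (e j)) has_sum cinner x (e j)) I"
    using has_sum_bounded_linear[OF bounded_linear_cinner_left hs] by (simp add: o_def cinner_simps)
  moreover have "((\<lambda>i. c i * cinner (e i) (e j)) has_sum c j) I \<longleftrightarrow> ((\<lambda>i. c j) has_sum c j) {j}"
    using assms by (intro has_sum_cong_neutral) (auto simp: orthonormal_onD)
  moreover have "((\<lambda>i. c j) has_sum c j) {j}"
    using has_sum_finite[of "{j}" "\<lambda>i. c j"] by simp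
  ultimately show ?thesis using has_sum_unique by blast
qed

lemma has_sum_norm_sq:
  assumes on: "orthonormal_on I e" and hs: "((\<lambda>i. c i *\<^sub>C e i) has_sum x) I"
  shows "((\<lambda>i. (cmod (c i))\<^sup>2) has_sum (norm x)\<^sup>2) I"
proof -
  have "((\<lambda>i. c i * cinner (e i) x) has_sum cinner x x) I"
    using has_sum_bounded_linear[OF bounded_linear_cinner_left hs] by (simp add: o_def cinner_simps)
  moreover have "cinner (e i) x = cnj (c i)" if "i \<in> I" for i
    by (metis has_sum_coordinate[OF on hs that] cinner_commute)
  ultimately have "((\<lambda>i. complex_of_real ((cmod (c i))\<^sup>2)) has_sum complex_of_real ((norm x)\<^sup>2)) I"
    unfolding complex_norm_square cinner_self[symmetric] by (simp cong: has_sum_cong)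
  then show ?thesis by (simp only: has_sum_of_real_iff)
qed

section \<open>Diagonal operators\<close>

text \<open>The multiplication operator by \<open>m\<close> in the coordinates of \<open>e\<close>.
  As \<open>infsum\<close> is total, the definition makes sense for every \<open>m\<close>;
  convergence of the series comes from the bound on \<open>m\<close> fixed in the context that
  follows.\<close>

definition diag_op :: "'i set \<Rightarrow> ('i \<Rightarrow> 'h::chilbert_space) \<Rightarrow> ('i \<Rightarrow> complex) \<Rightarrow> 'h \<Rightarrow> 'h" where
  "diag_op I e m x = infsum (\<lambda>i. (m i * cinner x (e i)) *\<^sub>C e i) I"

lemma bounded_clinearI:
  assumes "bounded_linear E" "\<And>c x. E (c *\<^sub>C x) = c *\<^sub>C E x"
  shows "bounded_clinear E"
  using assms by (simp add: bounded_clinear_def)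

context
  fixes I :: "'i set" and e :: "'i \<Rightarrow> 'h::chilbert_space" and m :: "'i \<Rightarrow> complex" and M :: real
  assumes onb: "is_onb I e" and bound: "\<forall>i\<in>I. cmod (m i) \<le> M"
begin

private lemma on: "orthonormal_on I e"
  using onb by (simp add: is_onb_iff)

private lemma sq_bound: "i \<in> I \<Longrightarrow> (cmod (m i * c))\<^sup>2 \<le> M\<^sup>2 * (cmod c)\<^sup>2"
  unfolding norm_mult power_mult_distrib using bound by (intro mult_right_mono power_mono) auto

lemma diag_op_has_sum: "((\<lambda>i. (m i * cinner x (e i)) *\<^sub>C e i) has_sum diag_op I e m x) I"
proof -
  have "(\<lambda>i. M\<^sup>2 * (cmod (cinner x (e i)))\<^sup>2) summable_on I"
    by (intro summable_on_cmult_right has_sum_imp_summable[OF parseval[OF onb]])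
  then have "(\<lambda>i. (cmod (m i * cinner x (e i)))\<^sup>2) summable_on I"
    by (rule summable_on_comparison_test) (auto simp: sq_bound)
  then obtain y where "((\<lambda>i. (m i * cinner x (e i)) *\<^sub>C e i) has_sum y) I"
    using riesz_fischer[OF on, of "\<lambda>i. m i * cinner x (e i)"] by blast
  moreover from this have "y = diag_op I e m x" unfolding diag_op_def by (rule infsumI[symmetric])
  ultimately show ?thesis by simp
qed

lemma cinner_diag_op: "i \<in> I \<Longrightarrow> cinner (diag_op I e m x) (e i) = m i * cinner x (e i)"
  using has_sum_coordinate[OF on diag_op_has_sum] by simp

lemma diag_op_basis: "i \<in> I \<Longrightarrow> diag_op I e m (e i) = m i *\<^sub>C e i"
  by (rule onb_eqI[OF onb]) (auto simp: cinner_diag_op cinner_simps orthonormal_onD[OF on])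

lemma norm_diag_op: "norm (diag_op I e m x) \<le> norm x * \<bar>M\<bar>"
proof -
  have "(norm (diag_op I e m x))\<^sup>2 \<le> M\<^sup>2 * (norm x)\<^sup>2"
    using has_sum_norm_sq[OF on diag_op_has_sum] has_sum_cmult_right[OF parseval[OF onb]]
    by (rule has_sum_mono) (auto simp: sq_bound)
  then show ?thesis
    using power2_le_imp_le[of "norm (diag_op I e m x)" "norm x * \<bar>M\<bar>"]
    by (simp add: power_mult_distrib mult.commute)
qed

lemma bounded_clinear_diag_op: "bounded_clinear (diag_op I e m)"
proof (intro bounded_clinearI bounded_linear_intro[where K="\<bar>M\<bar>"] norm_diag_op)
  show sc: "diag_op I e m (c *\<^sub>C x) = c *\<^sub>C diag_op I e m x" for c x
    by (rule onb_eqI[OF onb]) (auto simp: cinner_diag_op cinner_simps)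
  show "diag_op I e m (r *\<^sub>R x) = r *\<^sub>R diag_op I e m x" for r x
    using sc[of "complex_of_real r" x] by (simp add: scaleC_of_real)
  show "diag_op I e m (x + y) = diag_op I e m x + diag_op I e m y" for x y
    by (rule onb_eqI[OF onb]) (auto simp: cinner_diag_op cinner_simps algebra_simps)
qed

lemma self_adjoint_diag_op:
  assumes "\<And>i. i \<in> I \<Longrightarrow> m i \<in> \<real>"
  shows "self_adjoint (diag_op I e m)"
  unfolding self_adjoint_def
proof (intro conjI allI bounded_clinear_diag_op)
  fix x y
  have "cinner (diag_op I e m x) (e i) * cinner (e i) y = cinner x (e i) * cinner (e i) (diag_op I e m y)"
    if "i \<in> I" for i
    using that assms[OF that] cinner_commute[of "e i" "diag_op I e m y"] cinner_commute[of "e i" y]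
    by (simp add: cinner_diag_op Reals_cnj_iff)
  then have "((\<lambda>i. cinner x (e i) * cinner (e i) (diag_op I e m y)) has_sum cinner (diag_op I e m x) y) I"
    using onb_cinner_expansion[OF onb, of "diag_op I e m x" y] by (simp cong: has_sum_cong)
  then show "cinner (diag_op I e m x) y = cinner x (diag_op I e m y)"
    using onb_cinner_expansion[OF onb] has_sum_unique by blast
qed

end

section \<open>Orthonormal spans, and diagonal operators as members of \<open>Lambda\<close>\<close>

lemma cinner_span_eq_0:
  assumes "\<And>v. v \<in> S \<Longrightarrow> cinner x v = 0" "y \<in> complex_vector.span S"
  shows "cinner x (y::'h::chilbert_space) = 0"
  using assms(2)
proof (induction rule: complex_vector.span_induct)
  case base
  show ?case by (auto simp: complex_vector.subspace_def cinner_simps)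
qed (use assms(1) in auto)

lemma subspace_orth_complement: "complex_vector.subspace (orth_complement V)"
  by (auto simp: complex_vector.subspace_def orth_complement_def cinner_simps)

lemma orthonormal_on_inj: "orthonormal_on A e \<Longrightarrow> inj_on e A"
  by (intro inj_onI) (metis orthonormal_onD zero_neq_one)

lemma orthonormal_on_independent:
  assumes "orthonormal_on A e" "finite A"
  shows "complex_vector.independent (e ` A)"
proof
  assume "complex_vector.dependent (e ` A)"
  then obtain u v where u: "v \<in> e ` A" "u v \<noteq> 0" "(\<Sum>w\<in>e`A. u w *\<^sub>C w) = 0"
    using complex_vector.dependent_finite[of "e ` A"] assms(2) by auto
  then obtain i where i: "i \<in> A" "v = e i" by auto
  have "(\<Sum>j\<in>A. u (e j) *\<^sub>C e j) = 0"
    using u(3) orthonormal_on_inj[OF assms(1)] by (simp add: sum.reindex)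
  then have "u (e i) = 0"
    using cinner_sum_orthonormal[OF assms subset_refl i(1), of "\<lambda>j. u (e j)"] i(1) by simp
  then show False using u i by simp
qed

lemma has_cdim_span_orthonormal:
  assumes "orthonormal_on A e" "finite A"
  shows "has_cdim (complex_vector.span (e ` A)) (card A)"
  unfolding has_cdim_def
  using assms orthonormal_on_independent[OF assms] card_image[OF orthonormal_on_inj[OF assms(1)]]
  by (intro exI[of _ "e ` A"]) auto

lemma onb_in_span:
  assumes "is_onb I e" "finite A" "A \<subseteq> I" "\<And>i. i \<in> I - A \<Longrightarrow> cinner x (e i) = 0"
  shows "x \<in> complex_vector.span (e ` A)"
proof -
  have on: "orthonormal_on I e" using assms(1) by (simp add: is_onb_iff)
  have "x = (\<Sum>i\<in>A. cinner x (e i) *\<^sub>C e i)"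
    by (rule onb_eqI[OF assms(1)]) (use assms(4) in \<open>simp add: cinner_sum_orthonormal[OF on assms(2,3)]\<close>)
  moreover have "\<dots> \<in> complex_vector.span (e ` A)"
    by (intro complex_vector.span_sum complex_vector.span_scale complex_vector.span_base) auto
  ultimately show ?thesis by simp
qed

text \<open>Spectrum, \<open>H_part\<close> and eigenspaces of a diagonal operator are read off
  coordinate by coordinate. All that is left to supply is \<open>diag\<close>, a second basis in
  which the same operator has diagonal \<open>d\<close>, so membership in \<open>Lambda\<close>
  becomes a question about changing bases.\<close>

lemma diag_op_Lambda:
  fixes I :: "'i set" and e :: "'i \<Rightarrow> 'h::chilbert_space" and \<kappa> :: "'i \<Rightarrow> real"
  defines "E \<equiv> diag_op I e (\<lambda>i. complex_of_real (\<kappa> i))" and "C \<equiv> {i \<in> I. 0 < \<kappa> i \<and> \<kappa> i < 1}"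
  assumes onb: "is_onb I e" and \<kappa>: "\<And>i. i \<in> I \<Longrightarrow> 0 \<le> \<kappa> i \<and> \<kappa> i \<le> 1"
    and fin: "finite C" and ms: "image_mset \<kappa> (mset_set C) = mset l" and l: "l \<in> open_cube N"
    and diag: "has_diagonal E I d"
  shows "l \<in> Lambda TYPE('h) I d N"
proof -
  have on: "orthonormal_on I e" using onb by (simp add: is_onb_iff)
  have C: "C \<subseteq> I" by (auto simp: C_def)
  have bd: "\<forall>i\<in>I. cmod (complex_of_real (\<kappa> i)) \<le> 1" using \<kappa> by simp
  note cinner_E = cinner_diag_op[OF onb bd, folded E_def]
  note E_basis = diag_op_basis[OF onb bd, folded E_def]
  have sa: "self_adjoint E"
    unfolding E_def by (rule self_adjoint_diag_op[OF onb bd]) auto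
  have lin: "E (c *\<^sub>C x) = c *\<^sub>C E x" for c x
    using sa by (simp add: self_adjoint_def bounded_clinear_def)
  have "0 \<le> Re (cinner (E x) x)" for x
  proof -
    have "((\<lambda>i. cinner (E x) (e i) * cinner (e i) x) has_sum cinner (E x) x) I"
      by (rule onb_cinner_expansion[OF onb])
    then have hs: "((\<lambda>i. Re (cinner (E x) (e i) * cinner (e i) x)) has_sum Re (cinner (E x) x)) I"
      by (rule has_sum_Re)
    have "cinner (E x) (e i) * cinner (e i) x = complex_of_real (\<kappa> i * (cmod (cinner x (e i)))\<^sup>2)"
      if "i \<in> I" for i
      unfolding of_real_mult complex_norm_square cinner_E[OF that] cinner_commute[of "e i" x]
      by (simp only: mult.assoc)
    then have "0 \<le> Re (cinner (E x) (e i) * cinner (e i) x)" if "i \<in> I" for i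
      using that \<kappa>[OF that] by simp
    with hs show ?thesis by (rule has_sum_nonneg)
  qed
  then have pos: "positive_operator E" using sa by (simp add: positive_operator_def)
  have spec: "spectrum E \<subseteq> complex_of_real ` {0..1}"
  proof
    fix z assume z: "z \<in> spectrum E"
    show "z \<in> complex_of_real ` {0..1}"
    proof (rule ccontr)
      assume nz: "z \<notin> complex_of_real ` {0..1}"
      have "closed (complex_of_real ` {0..1})"
        by (intro compact_imp_closed compact_continuous_image continuous_intros) auto
      then obtain \<delta> where \<delta>: "\<delta> > 0" "\<And>w. w \<in> complex_of_real ` {0..1} \<Longrightarrow> \<delta> \<le> dist z w"
        using separate_point_closed[OF _ nz] by blast
      \<comment> \<open>The coordinatewise inverse is the resolvent at \<open>z\<close>. It is
        bounded because \<open>z\<close> has distance at least \<delta> from the compact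
        interval.\<close>
      define m where "m i = 1 / (complex_of_real (\<kappa> i) - z)" for i
      have d: "\<delta> \<le> cmod (complex_of_real (\<kappa> i) - z)" if "i \<in> I" for i
        using \<delta>(2)[of "complex_of_real (\<kappa> i)"] \<kappa>[OF that] by (auto simp: dist_norm norm_minus_commute)
      have bm: "\<forall>i\<in>I. cmod (m i) \<le> 1 / \<delta>"
        using d \<delta>(1) by (simp add: m_def norm_divide frac_le)
      have nz': "complex_of_real (\<kappa> i) - z \<noteq> 0" if "i \<in> I" for i
        using d[OF that] \<delta>(1) by auto
      note cT = cinner_diag_op[OF onb bm]
      have "diag_op I e m (E x - z *\<^sub>C x) = x" for x
        by (rule onb_eqI[OF onb])
           (use nz' in \<open>simp add: cT cinner_E cinner_simps m_def diff_divide_distrib[symmetric]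
              left_diff_distrib[symmetric]\<close>)
      moreover have "E (diag_op I e m x) - z *\<^sub>C diag_op I e m x = x" for x
        by (rule onb_eqI[OF onb])
           (use nz' in \<open>simp add: cT cinner_E cinner_simps m_def diff_divide_distrib[symmetric]
              left_diff_distrib[symmetric]\<close>)
      moreover have "bounded_clinear (diag_op I e m)"
        by (rule bounded_clinear_diag_op[OF onb bm])
      ultimately show False using z by (auto simp: spectrum_def)
    qed
  qed
  have H: "H_part E = complex_vector.span (e ` C)"
  proof
    show "H_part E \<subseteq> complex_vector.span (e ` C)"
    proof
      fix x assume x: "x \<in> H_part E"
      show "x \<in> complex_vector.span (e ` C)"
      proof (rule onb_in_span[OF onb fin C])
        fix i assume i: "i \<in> I - C"
        then have "\<kappa> i = 0 \<or> \<kappa> i = 1" using \<kappa>[of i] by (auto simp: C_def)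
        then have "(E (e i) = 0 \<and> (0::'h) - E 0 = 0) \<or> (E 0 = 0 \<and> e i - E (e i) = 0)"
          using E_basis[of i] i lin[of 0 0] by auto
        then have "\<exists>u v. e i = u + v \<and> E u = 0 \<and> v - E v = 0"
        proof
          assume "E (e i) = 0 \<and> (0::'h) - E 0 = 0"
          then show ?thesis by (intro exI[of _ "e i"] exI[of _ 0]) simp
        next
          assume "E 0 = 0 \<and> e i - E (e i) = 0"
          then show ?thesis by (intro exI[of _ 0] exI[of _ "e i"]) simp
        qed
        then have "e i \<in> {u + v |u v. E u = 0 \<and> v - E v = 0}" by blast
        then show "cinner x (e i) = 0"
          using x by (simp add: H_part_def orth_complement_def)
      qed
    qed
    show "complex_vector.span (e ` C) \<subseteq> H_part E"
      unfolding H_part_def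
    proof (rule complex_vector.span_minimal[OF _ subspace_orth_complement])
      show "e ` C \<subseteq> orth_complement {u + v |u v. E u = 0 \<and> v - E v = 0}"
      proof (clarsimp simp: orth_complement_def)
        fix i u v assume i: "i \<in> C" and u: "E u = 0" and v: "v = E v"
        have iI: "i \<in> I" and "\<kappa> i \<noteq> 0" "\<kappa> i \<noteq> 1" using i by (auto simp: C_def)
        then have "cinner u (e i) = 0" "cinner v (e i) = 0"
          using cinner_E[OF iI, of u] cinner_E[OF iI, of v] u v[symmetric] by auto
        then show "cinner (e i) (u + v) = 0"
          by (metis add.right_neutral cinner_add_right cinner_commute complex_cnj_zero)
      qed
    qed
  qed
  have dim: "has_cdim (H_part E) N"
  proof -
    have "card C = N"
      using arg_cong[OF ms, of size] l by (simp add: open_cube_def)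
    then show ?thesis
      unfolding H using has_cdim_span_orthonormal[OF orthonormal_on_subset[OF on C] fin] by simp
  qed
  have ev: "has_eigenvalue_list E l"
    unfolding has_eigenvalue_list_def
  proof
    fix t :: complex
    define D where "D = {i \<in> C. complex_of_real (\<kappa> i) = t}"
    have D: "D \<subseteq> I" "D \<subseteq> C" "finite D" using C fin by (auto simp: D_def)
    have "{v \<in> H_part E. E v = t *\<^sub>C v} = complex_vector.span (e ` D)"
    proof
      show "{v \<in> H_part E. E v = t *\<^sub>C v} \<subseteq> complex_vector.span (e ` D)"
      proof clarify
        fix v assume v: "v \<in> H_part E" "E v = t *\<^sub>C v"
        show "v \<in> complex_vector.span (e ` D)"
        proof (rule onb_in_span[OF onb D(3,1)])
          fix i assume i: "i \<in> I - D"
          show "cinner v (e i) = 0"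
          proof (cases "i \<in> C")
            case True
            then have "complex_of_real (\<kappa> i) \<noteq> t" using i by (auto simp: D_def)
            moreover have "complex_of_real (\<kappa> i) * cinner v (e i) = t * cinner v (e i)"
              using cinner_E[of i v] i v(2) by (auto simp: cinner_simps)
            ultimately show ?thesis by simp
          next
            case False
            have "cinner (e i) v = 0"
              by (rule cinner_span_eq_0[of "e ` C"])
                 (use False i C v(1) in \<open>auto simp: H orthonormal_onD[OF on]\<close>)
            then show ?thesis by (metis cinner_commute complex_cnj_zero)
          qed
        qed
      qed
      have "complex_vector.span (e ` D) \<subseteq> H_part E"
        unfolding H using D by (intro complex_vector.span_mono) auto
      moreover have "complex_vector.span (e ` D) \<subseteq> {v. E v = t *\<^sub>C v}"
      proof (rule complex_vector.span_minimal)
        show "e ` D \<subseteq> {v. E v = t *\<^sub>C v}"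
          using E_basis D(1) by (auto simp: D_def)
        have "E 0 = 0" using lin[of 0 0] by simp
        moreover have "E (x + y) = E x + E y" for x y
          using sa by (simp add: self_adjoint_def bounded_clinear_def linear_simps)
        ultimately show "complex_vector.subspace {v. E v = t *\<^sub>C v}"
          by (auto simp: complex_vector.subspace_def lin scaleC_add_right scaleC_scaleC mult.commute)
      qed
      ultimately show "complex_vector.span (e ` D) \<subseteq> {v \<in> H_part E. E v = t *\<^sub>C v}" by auto
    qed
    moreover have "count_list (map complex_of_real l) t = card D"
    proof -
      have "mset (map complex_of_real l) = image_mset (\<lambda>i. complex_of_real (\<kappa> i)) (mset_set C)"
        by (simp add: ms[symmetric] image_mset.compositionality o_def)
      then have "count_list (map complex_of_real l) t
          = count (image_mset (\<lambda>i. complex_of_real (\<kappa> i)) (mset_set C)) t"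
        by (metis count_mset)
      also have "\<dots> = card D"
        using fin by (simp add: count_image_mset D_def) (intro arg_cong[of _ _ card], auto)
      finally show ?thesis .
    qed
    ultimately show "has_cdim {v \<in> H_part E. E v = t *\<^sub>C v} (count_list (map complex_of_real l) t)"
      using has_cdim_span_orthonormal[OF orthonormal_on_subset[OF on D(1)] D(3)] by simp
  qed
  show ?thesis
    unfolding Lambda_def using l pos spec diag dim ev by blast
qed

lemma diag_op_projection:
  fixes I :: "'i set" and e :: "'i \<Rightarrow> 'h::chilbert_space" and \<kappa> :: "'i \<Rightarrow> real"
  assumes onb: "is_onb I e" and \<kappa>: "\<And>i. i \<in> I \<Longrightarrow> \<kappa> i = 0 \<or> \<kappa> i = 1"
  shows "orthogonal_projection (diag_op I e (\<lambda>i. complex_of_real (\<kappa> i)))"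
proof -
  have bd: "\<forall>i\<in>I. cmod (complex_of_real (\<kappa> i)) \<le> 1" using \<kappa> by fastforce
  have "self_adjoint (diag_op I e (\<lambda>i. complex_of_real (\<kappa> i)))"
    by (rule self_adjoint_diag_op[OF onb bd]) auto
  moreover have "diag_op I e (\<lambda>i. complex_of_real (\<kappa> i)) (diag_op I e (\<lambda>i. complex_of_real (\<kappa> i)) x)
      = diag_op I e (\<lambda>i. complex_of_real (\<kappa> i)) x" for x
    by (rule onb_eqI[OF onb]) (use \<kappa> in \<open>auto simp: cinner_diag_op[OF onb bd]\<close>)
  ultimately show ?thesis
    by (auto simp: orthogonal_projection_def fun_eq_iff)
qed

section \<open>Spreading a diagonal entry by a reflection\<close>

text \<open>The Householder reflection along \<open>q\<close>, a unitary that is its own inverse.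
  For \<open>q = 0\<close> the quotient is 0 and the reflection is the identity, which covers the
  case where the two vectors to be exchanged coincide.\<close>

definition hreflect :: "'h::chilbert_space \<Rightarrow> 'h \<Rightarrow> 'h" where
  "hreflect q h = h - (complex_of_real (2 / (norm q)\<^sup>2) * cinner h q) *\<^sub>C q"

lemma hreflect_add: "hreflect q (x + y) = hreflect q x + hreflect q y"
  by (simp add: hreflect_def cinner_simps complex_vector.scale_left_distrib ring_distribs)

lemma hreflect_scaleC: "hreflect q (c *\<^sub>C x) = c *\<^sub>C hreflect q x"
  by (simp add: hreflect_def cinner_simps complex_vector.scale_right_diff_distrib scaleC_scaleC ac_simps)

lemma hreflect_orth: "cinner h q = 0 \<Longrightarrow> hreflect q h = h"
  by (simp add: hreflect_def)

lemma hreflect_cinner: "cinner (hreflect q x) (hreflect q y) = cinner x y"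
proof (cases "q = 0")
  case False
  define t where "t = complex_of_real (2 / (norm q)\<^sup>2)"
  have hr: "hreflect q h = h - (t * cinner h q) *\<^sub>C q" for h
    by (simp only: hreflect_def t_def)
  have t: "t * cinner q q = 2" "cnj t = t"
    using False by (simp_all add: t_def cinner_self)
  have "cinner (hreflect q x) (hreflect q y)
      = cinner x y - t * cinner x q * cinner q y - cnj t * cnj (cinner y q) * cinner x q
        + t * cinner x q * cnj t * cnj (cinner y q) * cinner q q"
    by (simp add: hr cinner_simps algebra_simps)
  also have "\<dots> = cinner x y - 2 * (t * cinner x q * cinner q y) + (t * cinner q q) * (t * cinner x q * cinner q y)"
    using cinner_commute[of q y] t(2) by (simp add: algebra_simps)
  finally show ?thesis by (simp add: t)
qed (simp add: hreflect_def)

lemma hreflect_hreflect: "hreflect q (hreflect q x) = x"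
proof -
  have "(norm (hreflect q (hreflect q x) - x))\<^sup>2 = 0" if "q \<noteq> 0"
  proof -
    define t where "t = complex_of_real (2 / (norm q)\<^sup>2)"
    have hr: "hreflect q h = h - (t * cinner h q) *\<^sub>C q" for h
      by (simp only: hreflect_def t_def)
    have t: "t * cinner q q = 2"
      using that by (simp_all add: t_def cinner_self)
    have "cinner (hreflect q x) q = cinner x q - (t * cinner q q) * cinner x q"
      by (simp add: hr cinner_simps algebra_simps)
    then have "cinner (hreflect q x) q = - cinner x q" using t by simp
    then have "hreflect q (hreflect q x) = hreflect q x + (t * cinner x q) *\<^sub>C q"
      by (simp add: hr[of "hreflect q x"] complex_vector.scale_minus_left)
    then show ?thesis by (simp add: hr)
  qed
  then show ?thesis by (cases "q = 0") (auto simp: hreflect_def)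
qed

lemma hreflect_cinner_swap: "cinner (hreflect q x) y = cinner x (hreflect q y)"
  by (metis hreflect_cinner hreflect_hreflect)

text \<open>The inner product has to be real: a self-adjoint map taking \<open>g\<close> to
  \<open>p\<close> forces \<open>cinner p g\<close> to be real. In the application below the
  coefficients of \<open>p\<close> are real square roots.\<close>

lemma hreflect_unit_vectors:
  assumes "norm g = 1" "norm p = 1" "cinner g p = complex_of_real c"
  shows "hreflect (g - p) g = p"
proof (cases "g = p")
  case False
  have n: "(norm (g - p))\<^sup>2 = 2 - 2 * c"
    using assms by (simp add: norm_diff_sq_cinner)
  have "cinner g (g - p) = complex_of_real (1 - c)"
    using assms by (simp add: cinner_simps cinner_self)
  then have "complex_of_real (2 / (norm (g - p))\<^sup>2) * cinner g (g - p) = complex_of_real (2 / (2 - 2*c) * (1 - c))"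
    by (simp only: n of_real_mult)
  also have "2 / (2 - 2*c) * (1 - c) = 1"
  proof -
    have "2 - 2 * c \<noteq> 0" using n False by (metis norm_eq_zero power2_eq_iff right_minus_eq zero_eq_power2)
    then show ?thesis by (simp add: field_simps)
  qed
  finally have "complex_of_real (2 / (norm (g - p))\<^sup>2) * cinner g (g - p) = 1" by simp
  then have "hreflect (g - p) g = g - 1 *\<^sub>C (g - p)" unfolding hreflect_def by (simp only:)
  then show ?thesis by simp
qed (simp add: hreflect_def)

lemma bounded_linear_hreflect: "bounded_linear (hreflect q)"
proof (rule bounded_linear_intro[where K=1])
  show "hreflect q (r *\<^sub>R x) = r *\<^sub>R hreflect q x" for r x
    using hreflect_scaleC[of q "complex_of_real r" x] by (simp add: scaleC_of_real)
  have "norm (hreflect q x) = norm x" for x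
    using Re_cinner_self[of "hreflect q x"] Re_cinner_self[of x] hreflect_cinner[of q x x]
    by (simp add: power2_eq_iff_nonneg)
  then show "norm (hreflect q x) \<le> norm x * 1" for x by simp
qed (rule hreflect_add)

lemma is_onb_hreflect:
  assumes "is_onb I e"
  shows "is_onb I (\<lambda>i. hreflect q (e i))"
proof -
  let ?S = "complex_vector.span (e ` I)" and ?T = "complex_vector.span ((\<lambda>i. hreflect q (e i)) ` I)"
  have "orthonormal_on I (\<lambda>i. hreflect q (e i))"
    using assms by (simp add: is_onb_iff orthonormal_on_def hreflect_cinner)
  moreover have "?S \<subseteq> {x. hreflect q x \<in> ?T}"
  proof (rule complex_vector.span_minimal)
    show "e ` I \<subseteq> {x. hreflect q x \<in> ?T}"
      by (auto intro!: complex_vector.span_base)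
    show "complex_vector.subspace {x. hreflect q x \<in> ?T}"
      using hreflect_scaleC[of q 0 0]
      by (auto simp: complex_vector.subspace_def hreflect_add hreflect_scaleC
          intro: complex_vector.span_add complex_vector.span_scale complex_vector.span_zero)
  qed
  then have "hreflect q ` closure ?S \<subseteq> closure ?T"
    using closure_bounded_linear_image_subset[OF bounded_linear_hreflect, of q ?S]
      closure_mono[of "hreflect q ` ?S" ?T] by blast
  moreover have "hreflect q ` UNIV = UNIV"
    by (metis hreflect_hreflect surjI)
  ultimately show ?thesis
    using assms by (auto simp: is_onb_iff)
qed

lemma self_adjoint_cinner: "self_adjoint E \<Longrightarrow> cinner (E x) y = cinner x (E y)"
  by (simp add: self_adjoint_def)

lemma self_adjoint_bounded_linear: "self_adjoint E \<Longrightarrow> bounded_linear E"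
  by (simp add: self_adjoint_def bounded_clinear_def)

lemma self_adjoint_add: "self_adjoint E \<Longrightarrow> E (x + y) = E x + E y"
  using self_adjoint_bounded_linear linear_simps by blast

lemma self_adjoint_scaleC: "self_adjoint E \<Longrightarrow> E (c *\<^sub>C x) = c *\<^sub>C E x"
  by (simp add: self_adjoint_def bounded_clinear_def)

text \<open>
  The reflection exchanges the unit vector \<open>e j\<close> with \<open>p = (\<Sum>i\<in>L. sqrt (f i / x) *\<^sub>R e i)\<close>, so that
  the component of the new basis vector number \<open>i\<close> along \<open>e j\<close> is \<open>sqrt (f i / x)\<close>; its other
  components lie in the kernel.
\<close>

lemma spread_diagonal_entry:
  fixes E :: "'h::chilbert_space \<Rightarrow> 'h"
  assumes onb: "is_onb I e" and sa: "self_adjoint E" and L: "L \<subseteq> I" "j \<in> L"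
    and ker: "\<And>i. i \<in> L - {j} \<Longrightarrow> E (e i) = 0"
    and Ej: "cinner (E (e j)) (e j) = complex_of_real x" and x: "x > 0"
    and f: "(f has_sum x) L" "\<And>i. i \<in> L \<Longrightarrow> 0 \<le> f i"
  obtains g where "is_onb I g" "\<And>i. i \<in> I - L \<Longrightarrow> g i = e i"
    "\<And>i. i \<in> L \<Longrightarrow> cinner (E (g i)) (g i) = complex_of_real (f i)"
proof -
  have on: "orthonormal_on I e" using onb by (simp add: is_onb_iff)
  define c where "c i = (if i \<in> L then sqrt (f i / x) else 0)" for i
  have c_sq: "(cmod (complex_of_real (c i)))\<^sup>2 = (if i \<in> L then f i / x else 0)" for i
    using f(2) x by (simp add: c_def)
  have "((\<lambda>i. f i / x) has_sum 1) L"
    using has_sum_cmult_left[OF f(1), of "1/x"] x by simp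
  then have cs: "((\<lambda>i. (cmod (complex_of_real (c i)))\<^sup>2) has_sum 1) I"
    unfolding c_sq using L by (subst has_sum_cong_neutral[where T=L and g="\<lambda>i. f i / x"]) auto
  then obtain p where p: "((\<lambda>i. complex_of_real (c i) *\<^sub>C e i) has_sum p) I"
    using riesz_fischer[OF on has_sum_imp_summable[OF cs]] by blast
  have cp: "cinner p (e i) = complex_of_real (c i)" if "i \<in> I" for i
    using has_sum_coordinate[OF on p that] .
  have cp': "cinner (e i) p = complex_of_real (c i)" if "i \<in> I" for i
    using cp[OF that] cinner_commute[of "e i" p] by simp
  have np: "norm p = 1"
    using has_sum_unique[OF has_sum_norm_sq[OF on p] cs] norm_ge_zero[of p]
    by (metis one_power2 power2_eq_iff_nonneg zero_le_one)
  have jI: "j \<in> I" using L by auto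
  define q where "q = e j - p"
  define g where "g = (\<lambda>i. hreflect q (e i))"
  have gj: "hreflect q (e j) = p"
    unfolding q_def by (rule hreflect_unit_vectors[OF orthonormal_on_norm[OF on jI] np cp'[OF jI]])
  have fix_outside: "hreflect q (e i) = e i" if "i \<in> I - L" for i
    using that L by (intro hreflect_orth) (auto simp: q_def cinner_simps cp' c_def orthonormal_onD[OF on])
  have E0: "E 0 = 0" using self_adjoint_scaleC[OF sa, of 0 0] by simp
  \<comment> \<open>Such a \<open>k\<close> lies in the closed span of the \<open>e i\<close> with
    \<open>i\<close> in \<open>L - {j}\<close>, all of which \<open>E\<close> annihilates;
    continuity of \<open>E\<close> carries this through the infinite expansion of
    \<open>k\<close>.\<close>
  have Ek: "E k = 0" if k: "\<And>i. i \<in> I \<Longrightarrow> i \<notin> L - {j} \<Longrightarrow> cinner k (e i) = 0" for k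
  proof -
    have "((\<lambda>i. E (cinner k (e i) *\<^sub>C e i)) has_sum E k) I"
      using has_sum_bounded_linear[OF self_adjoint_bounded_linear[OF sa] onb_expansion[OF onb, of k]]
      by (simp add: o_def)
    moreover have "E (cinner k (e i) *\<^sub>C e i) = 0" if "i \<in> I" for i
      using ker[of i] k[OF that] by (cases "i \<in> L - {j}") (auto simp: self_adjoint_scaleC[OF sa] E0)
    ultimately have "((\<lambda>i. 0) has_sum E k) I" by (simp cong: has_sum_cong)
    then show ?thesis using has_sum_0_simp has_sum_unique by blast
  qed
  have diag: "cinner (E (g i)) (g i) = complex_of_real (f i)" if i: "i \<in> L" for i
  proof -
    have iI: "i \<in> I" using i L by auto
    define k where "k = g i - complex_of_real (c i) *\<^sub>C e j"
    have "cinner (g i) (e j) = complex_of_real (c i)"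
      unfolding g_def hreflect_cinner_swap gj by (rule cp'[OF iI])
    moreover have "cinner (g i) (e i') = 0" if "i' \<in> I - L" for i'
      using that i iI fix_outside[OF that]
      unfolding g_def hreflect_cinner_swap by (auto simp: orthonormal_onD[OF on])
    ultimately have k: "E k = 0"
      using jI i L by (intro Ek) (auto simp: k_def cinner_simps orthonormal_onD[OF on])
    have gi: "g i = complex_of_real (c i) *\<^sub>C e j + k" by (simp add: k_def)
    have "cinner (E (g i)) (g i)
        = complex_of_real (c i) * (complex_of_real (c i) * complex_of_real x + cinner (E (e j)) k)"
      unfolding gi by (simp add: self_adjoint_add[OF sa] self_adjoint_scaleC[OF sa] k cinner_simps Ej algebra_simps)
    also have "cinner (E (e j)) k = 0" by (simp add: self_adjoint_cinner[OF sa] k)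
    also have "complex_of_real (c i) * (complex_of_real (c i) * complex_of_real x + 0)
        = complex_of_real ((c i)\<^sup>2 * x)" by (simp add: power2_eq_square)
    also have "(c i)\<^sup>2 * x = f i" using i f(2)[OF i] x by (simp add: c_def)
    finally show ?thesis .
  qed
  show thesis
    by (rule that[of g]) (use is_onb_hreflect[OF onb] fix_outside diag in \<open>auto simp: g_def\<close>)
qed

section \<open>Horn's theorem\<close>

text \<open>The condition says that the compression of \<open>E\<close> to the span of the
  orthonormal list \<open>vs\<close> is diagonal with entries \<open>ts\<close>. True eigenvectors
  would be too much to ask: after one rotation the leftover vector \<open>y\<close> is in general no
  eigenvector of \<open>E\<close>, whereas this weaker property survives the induction.\<close>

definition eigen_system :: "('h::chilbert_space \<Rightarrow> 'h) \<Rightarrow> 'h list \<Rightarrow> real list \<Rightarrow> bool" where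
  "eigen_system E vs ts \<longleftrightarrow> (\<forall>v\<in>set vs. cinner v v = 1) \<and>
     sorted_wrt (\<lambda>u v. cinner u v = 0 \<and> cinner (E u) v = 0) vs \<and>
     list_all2 (\<lambda>v t. cinner (E v) v = complex_of_real t) vs ts"

text \<open>A discrete intermediate value argument: \<open>m\<close> is the least positive index
  whose entry is at least \<open>z\<close>.\<close>

lemma list_neighbours:
  fixes ts :: "real list"
  assumes "2 \<le> length ts" "ts ! 0 \<le> z" "z \<le> ts ! (length ts - 1)"
  obtains k where "Suc k < length ts" "ts ! k \<le> z" "z \<le> ts ! Suc k"
proof -
  define P where "P k \<longleftrightarrow> k < length ts \<and> z \<le> ts ! k \<and> 0 < k" for k
  have "P (length ts - 1)" using assms by (simp add: P_def)
  define m where "m = (LEAST k. P k)"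
  have m: "P m" unfolding m_def by (rule LeastI[of P, OF \<open>P (length ts - 1)\<close>])
  have "ts ! (m - 1) \<le> z"
  proof (cases "m = 1")
    case False
    have "m - 1 < m" using m by (simp add: P_def)
    then have "\<not> P (m - 1)" unfolding m_def by (rule not_less_Least)
    then show ?thesis using m False by (auto simp: P_def)
  qed (use assms in simp)
  then show thesis using that[of "m - 1"] m by (simp add: P_def)
qed

lemma split_consecutive:
  assumes "Suc k < length xs"
  shows "xs = take k xs @ [xs ! k, xs ! Suc k] @ drop (Suc (Suc k)) xs"
  using assms by (metis Cons_nth_drop_Suc Suc_lessD append_Cons append_Nil append_take_drop_id)

lemma rotation_coefficients:
  fixes p q z :: real
  assumes "p \<le> z" "z \<le> q"
  obtains c s where "c\<^sup>2 + s\<^sup>2 = 1" "c\<^sup>2 * p + s\<^sup>2 * q = z" "s\<^sup>2 * p + c\<^sup>2 * q = p + q - z"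
proof (cases "p = q")
  case True
  then show thesis using assms that[of 1 0] by simp
next
  case False
  then have pq: "p < q" using assms by simp
  define c s where "c = sqrt ((q - z) / (q - p))" and "s = sqrt ((z - p) / (q - p))"
  have "c\<^sup>2 = (q - z) / (q - p)" "s\<^sup>2 = (z - p) / (q - p)"
    using assms pq by (simp_all add: c_def s_def)
  then have 1: "c\<^sup>2 * (q - p) = q - z" "s\<^sup>2 * (q - p) = z - p"
    using pq by auto
  then have "(c\<^sup>2 + s\<^sup>2) * (q - p) = 1 * (q - p)"
    by (simp add: ring_distribs)
  then have 2: "c\<^sup>2 + s\<^sup>2 = 1" using pq by (metis mult_right_cancel right_minus_eq order_less_irrefl)
  have "c\<^sup>2 * p + s\<^sup>2 * q = (c\<^sup>2 + s\<^sup>2) * p + s\<^sup>2 * (q - p)"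
    by (simp add: algebra_simps)
  moreover have "s\<^sup>2 * p + c\<^sup>2 * q = (c\<^sup>2 + s\<^sup>2) * p + c\<^sup>2 * (q - p)"
    by (simp add: algebra_simps)
  ultimately show thesis using that[of c s] 1 2 by simp
qed

text \<open>
  One rotation of two consecutive eigenvectors realizes the diagonal entry \<open>z\<close>; the compression to
  the complement of the vector so obtained is again diagonal.
\<close>

lemma rotate_eigen_system:
  fixes E :: "'h::chilbert_space \<Rightarrow> 'h"
  assumes sa: "self_adjoint E"
    and es: "eigen_system E (as @ [u, w] @ bs) (A @ [p, q] @ B)" and len: "length as = length A"
    and z: "p \<le> z" "z \<le> q"
  obtains x y where "cinner (E x) x = complex_of_real z" "cinner x x = 1"
    "eigen_system E (as @ [y] @ bs) (A @ [p + q - z] @ B)"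
    "\<And>v. v \<in> set (as @ [y] @ bs) \<Longrightarrow> cinner x v = 0"
    "{x, y} \<subseteq> complex_vector.span {u, w}" "{u, w} \<subseteq> complex_vector.span {x, y}"
proof -
  obtain c s where cs: "c\<^sup>2 + s\<^sup>2 = 1" "c\<^sup>2 * p + s\<^sup>2 * q = z" "s\<^sup>2 * p + c\<^sup>2 * q = p + q - z"
    using rotation_coefficients[OF z] by blast
  let ?c = "complex_of_real c" and ?s = "complex_of_real s"
  define x y where "x = ?c *\<^sub>C u + ?s *\<^sub>C w" and "y = ?s *\<^sub>C u - ?c *\<^sub>C w"
  have unit: "cinner u u = 1" "cinner w w = 1" and uw: "cinner u w = 0" "cinner (E u) w = 0"
    and vals: "cinner (E u) u = complex_of_real p" "cinner (E w) w = complex_of_real q"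
    using es len by (auto simp: eigen_system_def sorted_wrt_append list_all2_append)
  have wu: "cinner w u = 0" "cinner (E w) u = 0"
    using uw cinner_commute[of w u] cinner_commute[of w "E u"]
    by (auto simp: self_adjoint_cinner[OF sa, of w u])
  have cs': "?c * ?c + ?s * ?s = 1"
    using arg_cong[OF cs(1), of complex_of_real] by (simp add: power2_eq_square)
  have Exx: "E x = ?c *\<^sub>C E u + ?s *\<^sub>C E w"
    by (simp add: x_def self_adjoint_add[OF sa] self_adjoint_scaleC[OF sa])
  have Ey: "E y = ?s *\<^sub>C E u + (- ?c) *\<^sub>C E w"
  proof -
    have "y = ?s *\<^sub>C u + (- ?c) *\<^sub>C w" by (simp add: y_def complex_vector.scale_minus_left)
    then show ?thesis by (simp only: self_adjoint_add[OF sa] self_adjoint_scaleC[OF sa])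
  qed
  have "cinner (E x) x = complex_of_real (c\<^sup>2 * p + s\<^sup>2 * q)"
    unfolding Exx unfolding x_def by (simp add: cinner_simps vals uw wu power2_eq_square)
  then have 1: "cinner (E x) x = complex_of_real z" by (simp only: cs)
  have "cinner (E y) y = complex_of_real (s\<^sup>2 * p + c\<^sup>2 * q)"
    unfolding Ey unfolding y_def by (simp add: cinner_simps vals uw wu power2_eq_square)
  then have Eyy: "cinner (E y) y = complex_of_real (p + q - z)" by (simp only: cs)
  have 2: "cinner x x = 1"
    unfolding x_def using cs' by (simp add: cinner_simps unit uw wu)
  have yy: "cinner y y = 1"
    unfolding y_def using cs' by (simp add: cinner_simps unit uw wu add.commute)
  have xy: "cinner x y = 0"
    unfolding x_def y_def by (simp add: cinner_simps unit uw wu mult.commute)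
  have as: "cinner a u = 0" "cinner a w = 0" "cinner (E a) u = 0" "cinner (E a) w = 0" if "a \<in> set as" for a
    using that es by (auto simp: eigen_system_def sorted_wrt_append)
  have bs: "cinner u b = 0" "cinner w b = 0" "cinner (E u) b = 0" "cinner (E w) b = 0" if "b \<in> set bs" for b
    using that es by (auto simp: eigen_system_def sorted_wrt_append)
  have 3: "eigen_system E (as @ [y] @ bs) (A @ [p + q - z] @ B)"
    using es len Eyy yy as bs Ey
    by (auto simp: eigen_system_def sorted_wrt_append list_all2_append y_def cinner_simps)
  have as': "cinner u a = 0" "cinner w a = 0" if "a \<in> set as" for a
    using as[OF that] by (metis cinner_commute complex_cnj_zero)+
  have 4: "cinner x v = 0" if "v \<in> set (as @ [y] @ bs)" for v
    using that xy bs as' by (auto simp: x_def cinner_simps)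
  have u: "u = ?c *\<^sub>C x + ?s *\<^sub>C y"
  proof -
    have "?c *\<^sub>C x + ?s *\<^sub>C y = (?c * ?c + ?s * ?s) *\<^sub>C u"
      by (simp add: x_def y_def scaleC_add_right scaleC_scaleC complex_vector.scale_right_diff_distrib
          scaleC_add_left mult.commute)
    then show ?thesis by (simp add: cs')
  qed
  have w: "w = ?s *\<^sub>C x - ?c *\<^sub>C y"
  proof -
    have "?s *\<^sub>C x - ?c *\<^sub>C y = (?c * ?c + ?s * ?s) *\<^sub>C w"
      by (simp add: x_def y_def scaleC_add_right scaleC_scaleC complex_vector.scale_right_diff_distrib
          scaleC_add_left mult.commute)
    then show ?thesis by (simp add: cs')
  qed
  have comb: "a *\<^sub>C f + b *\<^sub>C g \<in> complex_vector.span {f, g}" "a *\<^sub>C f - b *\<^sub>C g \<in> complex_vector.span {f, g}"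
    for a b and f g :: 'h
    by (intro complex_vector.span_add complex_vector.span_diff complex_vector.span_scale
        complex_vector.span_base; simp)+
  have 5: "{x, y} \<subseteq> complex_vector.span {u, w}"
    using comb by (simp add: x_def y_def)
  have 6: "{u, w} \<subseteq> complex_vector.span {x, y}"
    using comb[of ?c x ?s y] comb[of ?s x ?c y] u[symmetric] w[symmetric] by auto
  show thesis using that[OF 1 2 3 4 5 6] by blast
qed

text \<open>Induction on the number of eigenvalues. A value \<open>z \<kappa>\<close> is placed
  between neighbouring entries \<open>p\<close> and \<open>q\<close>, one rotation realizes it, and
  \<open>p + q - z \<kappa>\<close> takes their place, which keeps the list sorted. Majorization is
  stated over all subsets of \<open>K\<close>, so the prescribed diagonal never has to be sorted.
  The equality of spans allows the new vectors to be inserted into an orthonormal basis of the whole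
  space.\<close>

theorem schur_horn_existence:
  fixes E :: "'h::chilbert_space \<Rightarrow> 'h" and z :: "'i \<Rightarrow> real"
  assumes sa: "self_adjoint E"
  shows "\<lbrakk>finite K; card K = length ts; sorted ts; eigen_system E vs ts;
      \<And>S. S \<subseteq> K \<Longrightarrow> sum_list (take (card S) ts) \<le> sum z S; sum z K = sum_list ts\<rbrakk> \<Longrightarrow>
    \<exists>v. orthonormal_on K v \<and> complex_vector.span (v ` K) = complex_vector.span (set vs) \<and>
        (\<forall>i\<in>K. cinner (E (v i)) (v i) = complex_of_real (z i))"
proof (induction "length ts" arbitrary: K ts vs)
  case 0
  then have "K = {}" "vs = []" by (auto simp: eigen_system_def)
  then show ?case by (simp add: orthonormal_on_def)
next
  case (Suc n)
  note fin = Suc.prems(1) and card = Suc.prems(2) and sorted = Suc.prems(3) and es = Suc.prems(4)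
    and maj = Suc.prems(5) and tot = Suc.prems(6)
  have len: "length vs = length ts" using es by (auto simp: eigen_system_def list_all2_lengthD)
  obtain \<kappa> where \<kappa>: "\<kappa> \<in> K" using card Suc.hyps(2) fin by (metis all_not_in_conv card.empty nat.distinct(1))
  show ?case
  proof (cases "n = 0")
    case True
    then obtain t where t: "ts = [t]" using Suc.hyps(2) by (metis One_nat_def length_0_conv length_Suc_conv)
    obtain u where u: "vs = [u]" using len t by (metis One_nat_def length_0_conv length_Suc_conv list.size(3))
    have "K = {\<kappa>}" using card t \<kappa> by (metis card_1_singletonE length_0_conv length_Cons One_nat_def singletonD)
    then show ?thesis
      using es tot t u by (intro exI[of _ "\<lambda>_. u"]) (auto simp: orthonormal_on_def eigen_system_def)
  next
    case False
    then have len2: "2 \<le> length ts" using Suc.hyps(2) by simp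
    \<comment> \<open>The value lies between the extreme eigenvalues: the lower bound is the
      hypothesis for the singleton, the upper bound is the hypothesis for its complement combined
      with the equality of traces.\<close>
    have lo: "ts ! 0 \<le> z \<kappa>"
      using maj[of "{\<kappa>}"] \<kappa> len2 by (cases ts) auto
    have hi: "z \<kappa> \<le> ts ! (length ts - 1)"
    proof -
      have "sum_list (take (length ts - 1) ts) \<le> sum z (K - {\<kappa>})"
        using maj[of "K - {\<kappa>}"] \<kappa> card fin by simp
      moreover have "sum_list ts = sum_list (take (length ts - 1) ts) + ts ! (length ts - 1)"
        using arg_cong[OF take_Suc_conv_app_nth[of "length ts - 1" ts], of sum_list] len2 by simp
      moreover have "sum z K = z \<kappa> + sum z (K - {\<kappa>})" using fin \<kappa> by (simp add: sum.remove)
      ultimately show ?thesis using tot by simp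
    qed
    obtain k where k: "Suc k < length ts" "ts ! k \<le> z \<kappa>" "z \<kappa> \<le> ts ! Suc k"
      using list_neighbours[OF len2 lo hi] by blast
    define A B p q where "A = take k ts" and "B = drop (Suc (Suc k)) ts" and "p = ts ! k" and "q = ts ! Suc k"
    define as bs u w where "as = take k vs" and "bs = drop (Suc (Suc k)) vs" and "u = vs ! k" and "w = vs ! Suc k"
    have ts: "ts = A @ [p, q] @ B" unfolding A_def B_def p_def q_def by (rule split_consecutive[OF k(1)])
    have vs: "vs = as @ [u, w] @ bs" unfolding as_def bs_def u_def w_def
      by (rule split_consecutive) (use k(1) len in simp)
    have lenA: "length as = length A" by (simp add: as_def A_def len)
    have z: "p \<le> z \<kappa>" "z \<kappa> \<le> q" using k by (auto simp: p_def q_def)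
    obtain x y where x: "cinner (E x) x = complex_of_real (z \<kappa>)" "cinner x x = 1"
      and es': "eigen_system E (as @ [y] @ bs) (A @ [p + q - z \<kappa>] @ B)"
      and orth: "\<And>v. v \<in> set (as @ [y] @ bs) \<Longrightarrow> cinner x v = 0"
      and sp: "{x, y} \<subseteq> complex_vector.span {u, w}" "{u, w} \<subseteq> complex_vector.span {x, y}"
      using rotate_eigen_system[OF sa es[unfolded ts vs] lenA z] by blast
    let ?ts = "A @ [p + q - z \<kappa>] @ B" and ?vs = "as @ [y] @ bs" and ?K = "K - {\<kappa>}"
    have "\<exists>v. orthonormal_on ?K v \<and> complex_vector.span (v ` ?K) = complex_vector.span (set ?vs) \<and>
        (\<forall>i\<in>?K. cinner (E (v i)) (v i) = complex_of_real (z i))"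
    proof (rule Suc.hyps(1))
      show "n = length ?ts" using Suc.hyps(2) ts by simp
      show "finite ?K" "card ?K = length ?ts" using fin card \<kappa> ts by auto
      show "sorted ?ts" using sorted z unfolding ts by (fastforce simp: sorted_append)
      show "eigen_system E ?vs ?ts" by (rule es')
      show "sum z ?K = sum_list ?ts"
        using tot fin \<kappa> unfolding ts by (simp add: sum.remove)
      fix S assume S: "S \<subseteq> ?K"
      then have finS: "finite S" using fin finite_subset by blast
      show "sum_list (take (card S) ?ts) \<le> sum z S"
      proof (cases "card S \<le> length A")
        case True
        then show ?thesis using maj[of S] S by (auto simp: ts)
      next
        \<comment> \<open>Now the initial segment reaches the new entry
          \<open>p + q - z \<kappa>\<close>. Adding \<kappa> to \<open>S\<close> adds
          \<open>z \<kappa>\<close> on the right and replaces this entry by \<open>p\<close> and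
          \<open>q\<close> on the left, so the two inequalities are equivalent. In the other case
          the segment ends before the modified place.\<close>
        case False
        then obtain m where m: "card S = Suc (length A + m)"
          by (metis add_Suc_right less_iff_Suc_add not_le)
        have "card (insert \<kappa> S) = Suc (Suc (length A + m))" using S finS m by (subst card_insert_disjoint) auto
        moreover have "sum z (insert \<kappa> S) = z \<kappa> + sum z S" using S finS by (intro sum.insert) auto
        ultimately have "sum_list (take (Suc (Suc (length A + m))) ts) \<le> z \<kappa> + sum z S"
          using maj[of "insert \<kappa> S"] S \<kappa> by auto
        then show ?thesis by (simp add: m ts)
      qed
    qed
    then obtain v where v: "orthonormal_on ?K v" "complex_vector.span (v ` ?K) = complex_vector.span (set ?vs)"
      "\<And>i. i \<in> ?K \<Longrightarrow> cinner (E (v i)) (v i) = complex_of_real (z i)" by blast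
    define v' where "v' = v(\<kappa> := x)"
    have xv: "cinner x (v i) = 0" if "i \<in> ?K" for i
    proof (rule cinner_span_eq_0[of "set ?vs"])
      show "v i \<in> complex_vector.span (set ?vs)"
        using v(2) that by (metis complex_vector.span_base imageI)
    qed (rule orth)
    then have vx: "cinner (v i) x = 0" if "i \<in> ?K" for i
      using that by (metis cinner_commute complex_cnj_zero)
    have on: "orthonormal_on K v'"
      using v(1) x(2) xv vx unfolding orthonormal_on_def v'_def by auto
    have im: "v' ` K = insert x (v ` ?K)" using \<kappa> by (auto simp: v'_def)
    have "complex_vector.span (v' ` K) = complex_vector.span (set vs)"
    proof (rule iffD2[OF complex_vector.span_eq], intro conjI)
      have "complex_vector.span {u, w} \<subseteq> complex_vector.span (set vs)"
        by (rule complex_vector.span_mono) (auto simp: vs)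
      then have xy: "x \<in> complex_vector.span (set vs)" "y \<in> complex_vector.span (set vs)" using sp(1) by auto
      then have "set ?vs \<subseteq> complex_vector.span (set vs)"
        by (auto simp: vs intro: complex_vector.span_base)
      then have "complex_vector.span (set ?vs) \<subseteq> complex_vector.span (set vs)"
        by (rule complex_vector.span_minimal) (rule complex_vector.subspace_span)
      then show "v' ` K \<subseteq> complex_vector.span (set vs)"
        unfolding im using xy(1) v(2) by (metis complex_vector.span_superset insert_subset subset_trans)
      have vsub: "complex_vector.span (set ?vs) \<subseteq> complex_vector.span (v' ` K)"
        unfolding v(2)[symmetric] by (rule complex_vector.span_mono) (auto simp: im)
      have ys: "{x, y} \<subseteq> complex_vector.span (v' ` K)"
        using vsub by (auto simp: im intro: complex_vector.span_base subsetD)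
      then have "complex_vector.span {x, y} \<subseteq> complex_vector.span (v' ` K)"
        by (rule complex_vector.span_minimal) (rule complex_vector.subspace_span)
      moreover have "set as \<union> set bs \<subseteq> complex_vector.span (set ?vs)"
        by (auto intro: complex_vector.span_base)
      ultimately show "set vs \<subseteq> complex_vector.span (v' ` K)"
        using vsub sp(2) by (auto simp: vs)
    qed
    moreover have "\<forall>i\<in>K. cinner (E (v' i)) (v' i) = complex_of_real (z i)"
      using v(3) x(1) by (auto simp: v'_def)
    ultimately show ?thesis using on by blast
  qed
qed

section \<open>Splittings of the diagonal sequence\<close>

definition split_set :: "'i set \<Rightarrow> ('i \<Rightarrow> real) \<Rightarrow> 'i set \<Rightarrow> bool" where
  "split_set I d J \<longleftrightarrow> J \<subseteq> I \<and> d summable_on J \<and> (\<lambda>i. 1 - d i) summable_on (I - J)"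

definition excess :: "'i set \<Rightarrow> ('i \<Rightarrow> real) \<Rightarrow> 'i set \<Rightarrow> real" where
  "excess I d J = infsum d J - infsum (\<lambda>i. 1 - d i) (I - J)"

text \<open>When the excess is \<open>sum_list l - real n\<close>, the left-hand side
  \<open>sum_list l - infsum d J\<close> also equals \<open>n\<close> minus the sum of
  \<open>1 - d\<close> off \<open>J\<close>. For \<open>d\<close> in [0,1] it is therefore at most
  \<open>n\<close> and at most the sum of \<open>l\<close>.\<close>

definition feasible :: "'i set \<Rightarrow> ('i \<Rightarrow> real) \<Rightarrow> real list \<Rightarrow> bool" where
  "feasible I d l \<longleftrightarrow> (\<forall>J n. split_set I d J \<longrightarrow> n \<le> length l \<longrightarrow> excess I d J = sum_list l - real n \<longrightarrow>
     sum_list l - infsum d J \<le> sum_list (take n (decreasing l)))"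

lemma split_set_insert:
  assumes "split_set I d J" "i \<in> I - J"
  shows "split_set I d (insert i J)" "excess I d (insert i J) = excess I d J + 1"
proof -
  have I: "I - J = insert i (I - insert i J)" using assms(2) by auto
  have sm: "d summable_on J" "(\<lambda>i. 1 - d i) summable_on (I - J)" using assms(1) by (auto simp: split_set_def)
  then have sm': "(\<lambda>i. 1 - d i) summable_on (I - insert i J)"
    by (metis I summable_on_insert_iff)
  then show "split_set I d (insert i J)"
    using assms sm by (auto simp: split_set_def summable_on_insert_iff)
  have "infsum d (insert i J) = d i + infsum d J"
    using infsum_insert[OF sm(1)] assms(2) by auto
  moreover have "infsum (\<lambda>i. 1 - d i) (I - J) = 1 - d i + infsum (\<lambda>i. 1 - d i) (I - insert i J)"
    by (subst I) (rule infsum_insert[OF sm'], simp)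
  ultimately show "excess I d (insert i J) = excess I d J + 1" by (simp add: excess_def)
qed

lemma split_set_Un:
  assumes "split_set I d J" "finite G" "G \<subseteq> I - J"
  shows "split_set I d (J \<union> G) \<and> excess I d (J \<union> G) = excess I d J + real (card G)"
  using assms(2,3)
proof (induction G)
  case (insert i G)
  then show ?case using split_set_insert[of I d "J \<union> G" i] by auto
qed (use assms in auto)

lemma split_set_Diff:
  assumes "split_set I d J" "finite G" "G \<subseteq> J"
  shows "split_set I d (J - G) \<and> excess I d (J - G) = excess I d J - real (card G)"
proof -
  have "split_set I d (J - G)"
  proof -
    have "I - (J - G) = (I - J) \<union> G" using assms by (auto simp: split_set_def)
    then show ?thesis
      using assms by (auto simp: split_set_def intro: summable_on_subset summable_on_cofin_subset summable_on_union)
  qed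
  moreover from split_set_Un[OF this assms(2)] have "excess I d (J - G \<union> G) = excess I d (J - G) + real (card G)"
    using assms by (auto simp: split_set_def)
  moreover have "J - G \<union> G = J" using assms by auto
  ultimately show ?thesis by simp
qed

lemma split_set_complement: "split_set I d J \<Longrightarrow> split_set I (\<lambda>i. 1 - d i) (I - J)"
  by (auto simp: split_set_def double_diff)

lemma excess_complement: "J \<subseteq> I \<Longrightarrow> excess I (\<lambda>i. 1 - d i) (I - J) = - excess I d J"
  by (simp add: excess_def double_diff)

text \<open>\<open>J - G\<close> is the tail to be collapsed and \<open>card G + a0\<close> will be
  the number of eigenvalues 0 (or 1, for the upper tail) in the finite problem. The last conclusion
  limits the core entries below the collapsed value to that number. If \<open>a0\<close> is
  negative, \<open>G1\<close> reserves \<open>- a0\<close> positive entries for the core; \<epsilon>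
  is below each of them, so a tail of sum at most \<epsilon> does not exceed any of them. The bound
  1/2 keeps the collapsed entry in its half of [0,1].\<close>

lemma tail_choice:
  fixes f :: "'i \<Rightarrow> real" and a0 :: int
  assumes sm: "f summable_on J" and nn: "\<And>i. i \<in> J \<Longrightarrow> 0 \<le> f i" and inf: "infinite {i \<in> J. 0 < f i}"
  obtains G where "finite G" "G \<subseteq> J" "0 < infsum f (J - G)" "infsum f (J - G) \<le> 1/2"
    "int (card {i \<in> G. f i < infsum f (J - G)}) \<le> int (card G) + a0"
proof -
  obtain G1 where G1: "finite G1" "card G1 = nat (- a0)" "G1 \<subseteq> {i \<in> J. 0 < f i}"
    using infinite_arbitrarily_large[OF inf] by blast
  define \<epsilon> where "\<epsilon> = Min (insert (1/2) (f ` G1))"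
  have "\<epsilon> > 0" using G1 by (auto simp: \<epsilon>_def)
  have "\<epsilon> \<le> v" if "v \<in> insert (1/2) (f ` G1)" for v
    unfolding \<epsilon>_def using G1(1) that by (intro Min_le) auto
  from this[of "1/2"] this \<open>\<epsilon> > 0\<close>
  have \<epsilon>: "\<epsilon> > 0" "\<epsilon> \<le> 1/2" "\<And>i. i \<in> G1 \<Longrightarrow> \<epsilon> \<le> f i"
    by blast+
  obtain F where F: "finite F" "F \<subseteq> J" "dist (sum f F) (infsum f J) \<le> \<epsilon>"
    using infsum_finite_approximation[OF sm \<epsilon>(1)] by blast
  define G where "G = F \<union> G1"
  have G: "finite G" "G \<subseteq> J" using F G1 by (auto simp: G_def)
  have smG: "f summable_on (J - G)" using sm by (rule summable_on_subset) auto
  have "sum f F \<le> sum f G"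
    using G F nn by (intro sum_mono2) (auto simp: G_def)
  moreover have eq: "infsum f (J - G) = infsum f J - sum f G"
    using infsum_Diff[OF sm _ G(2)] G by simp
  ultimately have le: "infsum f (J - G) \<le> \<epsilon>" using F(3) by (simp add: dist_real_def)
  obtain i where i: "i \<in> J" "i \<notin> G" "0 < f i"
    using inf G(1) by (metis (mono_tags, lifting) finite_subset mem_Collect_eq subsetI)
  have "sum f {i} \<le> infsum f (J - G)"
    by (rule finite_sum_le_infsum[OF smG]) (use i nn in auto)
  then have pos: "0 < infsum f (J - G)" using i by simp
  have "{i \<in> G. f i < infsum f (J - G)} \<subseteq> G - G1" using le \<epsilon>(3) by force
  then have "card {i \<in> G. f i < infsum f (J - G)} \<le> card (G - G1)" using G by (intro card_mono) auto
  also have "card (G - G1) = card G - card G1" using G1 by (intro card_Diff_subset) (auto simp: G_def)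
  finally have "card {i \<in> G. f i < infsum f (J - G)} + card G1 \<le> card G"
    using card_mono[of G G1] G by (auto simp: G_def)
  then show thesis using that[OF G pos] le \<epsilon>(2) G1(2) by linarith
qed

lemma onb_replace:
  assumes onb: "is_onb I e" and K: "K \<subseteq> I" and v: "orthonormal_on K v"
    and sp: "complex_vector.span (v ` K) = complex_vector.span (e ` K)"
  shows "is_onb I (\<lambda>i. if i \<in> K then v i else e i)" (is "is_onb I ?g")
proof -
  have on: "orthonormal_on I e" using onb by (simp add: is_onb_iff)
  have ev: "cinner (e i) (v k) = 0" if "i \<in> I - K" "k \<in> K" for i k
  proof (rule cinner_span_eq_0[of "e ` K"])
    show "v k \<in> complex_vector.span (e ` K)"
      unfolding sp[symmetric] using that by (intro complex_vector.span_base) auto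
  qed (use that K in \<open>auto simp: orthonormal_onD[OF on]\<close>)
  then have ve: "cinner (v k) (e i) = 0" if "i \<in> I - K" "k \<in> K" for i k
    using that by (metis cinner_commute complex_cnj_zero)
  have g: "orthonormal_on I ?g"
    using K ev ve orthonormal_onD[OF on] orthonormal_onD[OF v] unfolding orthonormal_on_def by auto
  have "e ` I \<subseteq> complex_vector.span (?g ` I)"
  proof
    fix a assume "a \<in> e ` I"
    then obtain i where i: "i \<in> I" "a = e i" by auto
    show "a \<in> complex_vector.span (?g ` I)"
    proof (cases "i \<in> K")
      case True
      then have "a \<in> complex_vector.span (v ` K)"
        unfolding sp i(2) by (intro complex_vector.span_base) auto
      moreover have "v ` K \<subseteq> ?g ` I" using K by force
      ultimately show ?thesis using complex_vector.span_mono by blast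
    next
      case False
      then have "a \<in> ?g ` I" using i by force
      then show ?thesis by (rule complex_vector.span_base)
    qed
  qed
  then have "complex_vector.span (e ` I) \<subseteq> complex_vector.span (?g ` I)"
    by (rule complex_vector.span_minimal) (rule complex_vector.subspace_span)
  then have "closure (complex_vector.span (?g ` I)) = UNIV"
    using onb closure_mono unfolding is_onb_iff by blast
  then show ?thesis using g by (simp add: is_onb_iff)
qed

section \<open>The finite majorization problem and the realization of a prescribed diagonal\<close>

lemma take_decreasing: "take n (decreasing l) = rev (drop (length l - n) (sort l))"
  by (simp add: decreasing_def take_rev)

lemma sum_list_sort: "sum_list (sort (l::real list)) = sum_list l"
  by (metis mset_sort sum_mset_sum_list)

lemma sum_list_decreasing: "sum_list (decreasing (l::real list)) = sum_list l"
  by (simp add: decreasing_def sum_list_sort)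

lemma sum_list_take_sort:
  assumes "m \<le> length l"
  shows "sum_list (take m (sort l)) = sum_list l - sum_list (take (length l - m) (decreasing (l::real list)))"
proof -
  have "sum_list (sort l) = sum_list (take m (sort l)) + sum_list (drop m (sort l))"
    by (metis append_take_drop_id sum_list_append)
  then show ?thesis using assms by (simp add: take_decreasing sum_list_sort)
qed

text \<open>
  The subset sums of the finite diagonal formed by a core and the two collapsed tails dominate the
  sums of the smallest eigenvalues.  A subset that contains the lower tail \<open>p\<close> but not the upper
  tail \<open>q\<close> corresponds to a splitting of \<open>I\<close>; other subsets of relevant size are reduced to this case
  by an exchange that does not increase the sum.
\<close>

lemma collapsed_majorization:
  fixes z :: "'i \<Rightarrow> real"
  defines "ts \<equiv> \<lambda>a b l. replicate a 0 @ sort l @ replicate b (1::real)"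
  assumes fin: "finite G" "finite H" "G \<inter> H = {}" "p \<notin> G \<union> H" "q \<notin> G \<union> H" "p \<noteq> q"
    and card: "card G + card H + 2 = a + length l + b"
    and z01: "\<And>i. i \<in> insert p (insert q (G \<union> H)) \<Longrightarrow> 0 \<le> z i \<and> z i \<le> 1"
    and zp: "z p \<le> 1/2" and zq: "1/2 \<le> z q"
    and zG: "\<And>i. i \<in> G \<Longrightarrow> z i < 1/2" and zH: "\<And>i. i \<in> H \<Longrightarrow> 1/2 \<le> z i"
    and cG: "card {i \<in> G. z i < z p} \<le> a" and cH: "card {i \<in> H. z q < z i} \<le> b"
    and tot: "sum z (insert p (insert q (G \<union> H))) = sum_list l + real b"
    and feas: "\<And>S m. S \<subseteq> G \<union> H \<Longrightarrow> m \<le> length l \<Longrightarrow> card S + 1 = a + m \<Longrightarrow>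
       sum_list (take m (sort l)) \<le> z p + sum z S"
    and S: "S \<subseteq> insert p (insert q (G \<union> H))"
  shows "sum_list (take (card S) (ts a b l)) \<le> sum z S"
proof -
  let ?K = "insert p (insert q (G \<union> H))"
  have finK: "finite ?K" using fin by simp
  have cardK: "card ?K = a + length l + b"
    using fin card by (simp add: card_Un_disjoint)
  have finS: "finite S" using finK S finite_subset by blast
  consider "card S \<le> a" | "a + length l \<le> card S" | "a < card S" "card S < a + length l" by linarith
  then show ?thesis
  proof cases
    case 1
    then have "sum_list (take (card S) (ts a b l)) = 0" by (simp add: ts_def sum_list_replicate)
    moreover have "0 \<le> sum z S" using z01 S by (intro sum_nonneg) auto
    ultimately show ?thesis by simp
  next
    \<comment> \<open>Beyond the first \<open>a + length l\<close> places the eigenvalues are all 1,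
      so it is enough that each of the entries missing from \<open>S\<close> contributes at most 1
      to the total.\<close>
    case 2
    have le: "card S \<le> a + length l + b" using card_mono[OF finK S] cardK by simp
    have le': "card S - (a + length l) \<le> b" using le by linarith
    have "sum_list (take (card S) (ts a b l)) = sum_list l + real (card S - (a + length l))"
      using 2 le' by (simp add: ts_def sum_list_replicate sum_list_sort)
    moreover have "sum z ?K = sum z S + sum z (?K - S)"
      using S finK by (metis sum.subset_diff add.commute)
    moreover have "sum z (?K - S) \<le> real (card (?K - S))"
      using z01 sum_bounded_above[of "?K - S" z 1] by auto
    moreover have "card (?K - S) = a + length l + b - card S"
      using S finS cardK by (simp add: card_Diff_subset)
    ultimately show ?thesis using tot 2 le by simp
  next
    case 3
    obtain S1 where S1: "S1 \<subseteq> ?K" "card S1 = card S" "p \<in> S1" "sum z S1 \<le> sum z S"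
    proof (cases "p \<in> S")
      case False
      \<comment> \<open>A suitable partner for the exchange exists: otherwise every member of
        \<open>S\<close> would be a core entry below \<open>z p\<close>, and \<open>cG\<close>
        allows at most \<open>a\<close> of these, fewer than \<open>S\<close> has.\<close>
      have "\<exists>e\<in>S. z p \<le> z e"
      proof (rule ccontr)
        assume "\<not> (\<exists>e\<in>S. z p \<le> z e)"
        then have lt: "z i < z p" if "i \<in> S" for i using that by force
        have "S \<subseteq> {i \<in> G. z i < z p}"
        proof
          fix i assume i: "i \<in> S"
          have "i \<noteq> p" "i \<noteq> q" "i \<notin> H" using i lt[OF i] zp zq zH[of i] False by force+
          then show "i \<in> {i \<in> G. z i < z p}" using i S lt[OF i] by blast
        qed
        then have "card S \<le> card {i \<in> G. z i < z p}" using fin by (intro card_mono) auto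
        then show False using cG 3 by simp
      qed
      then obtain e where e: "e \<in> S" "z p \<le> z e" by blast
      show thesis
      proof (rule that[of "insert p (S - {e})"])
        show "card (insert p (S - {e})) = card S"
          using e False finS card_gt_0_iff[of S] by (auto simp: card_insert_if)
        show "sum z (insert p (S - {e})) \<le> sum z S"
          using e False finS by (simp add: sum.remove[of S e])
      qed (use S e in auto)
    qed (use S in auto)
    have finS1: "finite S1" using finK S1 finite_subset by blast
    obtain S2 where S2: "S2 \<subseteq> ?K" "card S2 = card S" "p \<in> S2" "q \<notin> S2" "sum z S2 \<le> sum z S"
    proof (cases "q \<in> S1")
      case True
      \<comment> \<open>The mirror image: if every missing entry exceeded \<open>z q\<close>, there
        would be at most \<open>b\<close> of them by \<open>cH\<close>, but more than
        \<open>b\<close> are missing.\<close>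
      have "\<exists>e\<in>?K - S1. z e \<le> z q"
      proof (rule ccontr)
        assume "\<not> (\<exists>e\<in>?K - S1. z e \<le> z q)"
        then have lt: "z q < z i" if "i \<in> ?K - S1" for i using that not_le by blast
        have "?K - S1 \<subseteq> {i \<in> H. z q < z i}"
        proof
          fix i assume i: "i \<in> ?K - S1"
          have "i \<noteq> p" "i \<noteq> q" "i \<notin> G" using i lt[OF i] zq zG[of i] True S1(3) by force+
          then show "i \<in> {i \<in> H. z q < z i}" using i lt[OF i] by blast
        qed
        then have "card (?K - S1) \<le> card {i \<in> H. z q < z i}" using fin by (intro card_mono) auto
        moreover have "card (?K - S1) = card ?K - card S1" using S1(1) finS1 by (intro card_Diff_subset) auto
        ultimately show False using cH 3 S1(2) cardK by simp
      qed
      then obtain e where e: "e \<in> ?K - S1" "z e \<le> z q" by blast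
      show thesis
      proof (rule that[of "insert e (S1 - {q})"])
        show "card (insert e (S1 - {q})) = card S"
          using e True finS1 S1(2) card_gt_0_iff[of S1] by (auto simp: card_insert_if)
        have "sum z (insert e (S1 - {q})) \<le> sum z S1"
          using e True finS1 by (simp add: sum.remove[of S1 q])
        then show "sum z (insert e (S1 - {q})) \<le> sum z S" using S1(4) by simp
      qed (use S1 e True fin in auto)
    next
      case False
      then show thesis using that[of S1] S1 by auto
    qed
    have finS2: "finite S2" using finK S2 finite_subset by blast
    have c: "card (S2 - {p}) + 1 = a + (card S - a)"
      using S2 finS2 3 by auto
    have "sum_list (take (card S - a) (sort l)) \<le> z p + sum z (S2 - {p})"
      by (rule feas) (use S2 3 c in auto)
    also have "\<dots> = sum z S2" using S2(3) finS2 by (simp add: sum.remove[of S2 p])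
    finally have "sum_list (take (card S - a) (sort l)) \<le> sum z S" using S2(5) by simp
    moreover have "sum_list (take (card S) (ts a b l)) = sum_list (take (card S - a) (sort l))"
      using 3 by (simp add: ts_def sum_list_replicate)
    ultimately show ?thesis by simp
  qed
qed

text \<open>Feasibility speaks of the \<open>n\<close> largest entries, the finite problem of the
  \<open>m\<close> smallest ones. The two are complementary, with
  \<open>n = length l - m\<close>.\<close>

lemma feasible_take_sort:
  assumes "feasible I d l" "split_set I d J" "m \<le> length l"
    "excess I d J = sum_list l - real (length l) + real m"
  shows "sum_list (take m (sort l)) \<le> infsum d J"
proof -
  have "sum_list l - infsum d J \<le> sum_list (take (length l - m) (decreasing l))"
    using assms unfolding feasible_def by (simp add: of_nat_diff)
  then show ?thesis using sum_list_take_sort[OF assms(3)] by simp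
qed

lemma self_adjoint_complement:
  assumes "self_adjoint E"
  shows "self_adjoint (\<lambda>x. x - E x)"
  using assms unfolding self_adjoint_def bounded_clinear_def
  by (auto simp: bounded_linear_sub complex_vector.scale_right_diff_distrib cinner_simps)

theorem diagonal_realization:
  fixes I :: "'i set" and d :: "'i \<Rightarrow> real" and l :: "real list" and e :: "'i \<Rightarrow> 'h::chilbert_space"
  defines "J0 \<equiv> {i \<in> I. d i < 1/2}"
  assumes onb: "is_onb I e" and d01: "\<And>i. i \<in> I \<Longrightarrow> 0 \<le> d i \<and> d i \<le> 1"
    and J0: "split_set I d J0"
    and infL: "infinite {i \<in> I. 0 < d i \<and> d i < 1/2}" and infU: "infinite {i \<in> I. 1/2 \<le> d i \<and> d i < 1}"
    and l: "set l \<subseteq> {0<..<1}" and int: "sum_list l - excess I d J0 \<in> \<int>" and feas: "feasible I d l"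
  obtains \<kappa> where "\<And>i. i \<in> I \<Longrightarrow> 0 \<le> \<kappa> i \<and> \<kappa> i \<le> 1" "finite {i \<in> I. 0 < \<kappa> i \<and> \<kappa> i < 1}"
    "image_mset \<kappa> (mset_set {i \<in> I. 0 < \<kappa> i \<and> \<kappa> i < 1}) = mset l"
    "has_diagonal (diag_op I e (\<lambda>i. complex_of_real (\<kappa> i))) I d"
proof -
  have on: "orthonormal_on I e" using onb by (simp add: is_onb_iff)
  define K0 where "K0 = I - J0"
  have J0I: "J0 \<subseteq> I" by (auto simp: J0_def)
  obtain w where w: "sum_list l - excess I d J0 = of_int w" using int by (auto elim: Ints_cases)
  \<comment> \<open>The constants are forced. The collapsed core has trace
    \<open>excess I d J0 + card H + 1\<close>, which must equal \<open>sum_list l + b\<close>; this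
    gives \<open>b = card H + 1 - w\<close>. Counting entries,
    \<open>card G + card H + 2 = a + length l + b\<close>, then gives \<open>a\<close>.\<close>
  define a0 b0 where "a0 = w - int (length l) + 1" and "b0 = 1 - w"
  have smJ: "d summable_on J0" and smK: "(\<lambda>i. 1 - d i) summable_on K0"
    using J0 by (auto simp: split_set_def K0_def)
  obtain G where G: "finite G" "G \<subseteq> J0" "0 < infsum d (J0 - G)" "infsum d (J0 - G) \<le> 1/2"
    "int (card {i \<in> G. d i < infsum d (J0 - G)}) \<le> int (card G) + a0"
  proof (rule tail_choice[OF smJ, of a0])
    show "infinite {i \<in> J0. 0 < d i}" using infL by (simp add: J0_def conj_ac)
  qed (use d01 in \<open>auto simp: J0_def\<close>)
  obtain H where H: "finite H" "H \<subseteq> K0" "0 < infsum (\<lambda>i. 1 - d i) (K0 - H)" "infsum (\<lambda>i. 1 - d i) (K0 - H) \<le> 1/2"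
    "int (card {i \<in> H. 1 - d i < infsum (\<lambda>i. 1 - d i) (K0 - H)}) \<le> int (card H) + b0"
  proof (rule tail_choice[OF smK, of b0])
    have "{i \<in> K0. 0 < 1 - d i} = {i \<in> I. 1/2 \<le> d i \<and> d i < 1}" by (auto simp: K0_def J0_def)
    then show "infinite {i \<in> K0. 0 < 1 - d i}" using infU by simp
  qed (use d01 in \<open>auto simp: K0_def\<close>)
  define L U x y where "L = J0 - G" and "U = K0 - H" and "x = infsum d L" and "y = infsum (\<lambda>i. 1 - d i) U"
  have x: "0 < x" "x \<le> 1/2" and y: "0 < y" "y \<le> 1/2"
    using G H by (auto simp: x_def y_def L_def U_def)
  obtain p where p: "p \<in> L" using x(1) by (cases "L = {}") (auto simp: x_def)
  obtain q where q: "q \<in> U" using y(1) by (cases "U = {}") (auto simp: y_def)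
  define a b where "a = nat (int (card G) + a0)" and "b = nat (int (card H) + b0)"
  have a: "int a = int (card G) + a0" and b: "int b = int (card H) + b0"
    using G(5) H(5) by (auto simp: a_def b_def)
  have disj: "G \<inter> H = {}" "L \<inter> U = {}" "G \<inter> L = {}" "G \<inter> U = {}" "H \<inter> L = {}" "H \<inter> U = {}"
    using G H by (auto simp: L_def U_def K0_def)
  have I_eq: "I = G \<union> H \<union> L \<union> U" using G H J0I by (auto simp: L_def U_def K0_def)
  define K where "K = insert p (insert q (G \<union> H))"
  have K: "finite K" "K \<subseteq> I" "p \<notin> G \<union> H" "q \<notin> G \<union> H" "p \<noteq> q"
    using G(1) H(1) p q disj I_eq by (auto simp: K_def)
  have card_ab: "card G + card H + 2 = a + length l + b"
    using a b by (simp add: a0_def b0_def)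
  have cardK: "card K = a + length l + b"
    using G(1) H(1) K disj(1) card_ab by (simp add: K_def card_Un_disjoint)
  define ts where "ts = replicate a 0 @ sort l @ replicate b (1::real)"
  have len_ts: "length ts = card K" by (simp add: ts_def cardK)
  have sorted: "sorted ts" using l by (fastforce simp: ts_def sorted_append)
  obtain ks where ks: "set ks = K" "distinct ks" using finite_distinct_list[OF K(1)] by blast
  have len_ks: "length ks = length ts" using ks len_ts distinct_card by fastforce
  \<comment> \<open>On \<open>K\<close> the eigenvalues are the entries of \<open>ts\<close> in some
    order. Outside \<open>K\<close> they are 0 on the lower and 1 on the upper tail, so that
    \<open>E\<close> vanishes on the remaining basis vectors of \<open>L\<close> and
    \<open>1 - E\<close> on those of \<open>U\<close>, as spreading requires.\<close>
  define \<kappa> where "\<kappa> i = (if i \<in> K then the (map_of (zip ks ts) i) else if i \<in> U then 1 else 0)" for i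
  have \<kappa>_nth: "\<kappa> (ks ! n) = ts ! n" if "n < length ts" for n
    using map_of_zip_nth[OF len_ks ks(2) that] that ks len_ks by (auto simp: \<kappa>_def)
  have map_\<kappa>: "map \<kappa> ks = ts" using \<kappa>_nth len_ks by (auto intro: nth_equalityI)
  have \<kappa>L: "\<kappa> i = 0" if "i \<in> L - {p}" for i
    using that p q disj by (auto simp: \<kappa>_def K_def)
  have \<kappa>U: "\<kappa> i = 1" if "i \<in> U - {q}" for i
    using that p q disj by (auto simp: \<kappa>_def K_def)
  have ts01: "t \<in> set ts \<Longrightarrow> 0 \<le> t \<and> t \<le> 1" for t
    using l by (fastforce simp: ts_def)
  have \<kappa>K: "\<kappa> i \<in> set ts" if "i \<in> K" for i using that map_\<kappa> ks(1) by (metis imageI set_map)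
  have \<kappa>01: "0 \<le> \<kappa> i \<and> \<kappa> i \<le> 1" for i
    using ts01[OF \<kappa>K] by (cases "i \<in> K") (auto simp: \<kappa>_def)
  have C: "{i \<in> I. 0 < \<kappa> i \<and> \<kappa> i < 1} = {i \<in> K. 0 < \<kappa> i \<and> \<kappa> i < 1}"
    using K(2) by (auto simp: \<kappa>_def)
  have "mset ts = image_mset \<kappa> (mset_set K)"
    by (simp only: map_\<kappa>[symmetric] mset_map mset_set_set[OF ks(2), symmetric] ks(1))
  then have "image_mset \<kappa> (mset_set {i \<in> K. 0 < \<kappa> i \<and> \<kappa> i < 1}) = filter_mset (\<lambda>t. 0 < t \<and> t < 1) (mset ts)"
    using K(1) by (simp add: filter_mset_image_mset)
  also have "\<dots> = mset l"
  proof -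
    have "filter (\<lambda>t. 0 < t \<and> t < 1) (sort l) = sort l"
      using l by (intro filter_True) auto
    then have "filter (\<lambda>t. 0 < t \<and> t < 1) ts = sort l" by (simp add: ts_def)
    then show ?thesis by (metis mset_filter mset_sort)
  qed
  finally have ms: "image_mset \<kappa> (mset_set {i \<in> I. 0 < \<kappa> i \<and> \<kappa> i < 1}) = mset l" by (simp only: C)
  define E where "E = diag_op I e (\<lambda>i. complex_of_real (\<kappa> i))"
  have bd: "\<forall>i\<in>I. cmod (complex_of_real (\<kappa> i)) \<le> 1" using \<kappa>01 by simp
  note E_basis = diag_op_basis[OF onb bd, folded E_def]
  have sa: "self_adjoint E" unfolding E_def by (rule self_adjoint_diag_op[OF onb bd]) auto
  have es: "eigen_system E (map e ks) ts"
    unfolding eigen_system_def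
  proof (intro conjI)
    show "\<forall>v\<in>set (map e ks). cinner v v = 1" using ks K(2) by (auto simp: orthonormal_onD[OF on])
    show "sorted_wrt (\<lambda>u v. cinner u v = 0 \<and> cinner (E u) v = 0) (map e ks)"
      unfolding sorted_wrt_iff_nth_less
    proof (intro allI impI)
      fix m n assume mn: "m < n" "n < length (map e ks)"
      then have "ks ! m \<in> I" "ks ! n \<in> I" "ks ! m \<noteq> ks ! n"
        using ks K(2) by (auto simp: nth_eq_iff_index_eq)
      then show "cinner (map e ks ! m) (map e ks ! n) = 0 \<and> cinner (E (map e ks ! m)) (map e ks ! n) = 0"
        using mn by (simp add: E_basis cinner_simps orthonormal_onD[OF on])
    qed
    show "list_all2 (\<lambda>v t. cinner (E v) v = complex_of_real t) (map e ks) ts"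
      unfolding list_all2_conv_all_nth
    proof (intro conjI allI impI)
      fix n assume n: "n < length (map e ks)"
      then have "ks ! n \<in> I" using ks K(2) by auto
      then show "cinner (E (map e ks ! n)) (map e ks ! n) = complex_of_real (ts ! n)"
        using n len_ks by (simp add: E_basis cinner_simps orthonormal_onD[OF on] \<kappa>_nth)
    qed (simp add: len_ks)
  qed
  define z where "z i = (if i = p then x else if i = q then 1 - y else d i)" for i
  have zsum: "sum z S = sum d S" if "S \<subseteq> G \<union> H" for S
    using that K(3,4) by (intro sum.cong) (auto simp: z_def)
  have splitL: "split_set I d L" "excess I d L = excess I d J0 - real (card G)"
    using split_set_Diff[OF J0 G(1,2)] by (auto simp: L_def)
  have tot: "sum z K = sum_list l + real b"
  proof -
    have "sum z K = x + (1 - y) + sum d (G \<union> H)"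
      using G(1) H(1) K(3-5) zsum by (simp add: K_def) (simp add: z_def)
    also have "sum d (G \<union> H) = sum d G + sum d H" using G(1) H(1) disj by (simp add: sum.union_disjoint)
    finally have 1: "sum z K = x + (1 - y) + sum d G + sum d H" by simp
    have "infsum d J0 = x + sum d G"
      using infsum_Diff[OF smJ _ G(2)] G(1) by (simp add: x_def L_def)
    moreover have "infsum (\<lambda>i. 1 - d i) K0 = y + (real (card H) - sum d H)"
      using infsum_Diff[OF smK _ H(2)] H(1) by (simp add: y_def U_def sum_subtractf)
    ultimately have "excess I d J0 = x + sum d G - y - real (card H) + sum d H"
      by (simp add: excess_def K0_def)
    moreover have "real b = real (card H) + 1 - real_of_int w"
      using arg_cong[OF b, of real_of_int] by (simp add: b0_def)
    ultimately show ?thesis using w 1 by simp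
  qed
  have maj: "sum_list (take (card S) ts) \<le> sum z S" if S: "S \<subseteq> K" for S
    unfolding ts_def
  proof (rule collapsed_majorization[where G=G and H=H and p=p and q=q])
    show "0 \<le> z i \<and> z i \<le> 1" if "i \<in> insert p (insert q (G \<union> H))" for i
      using that x y d01[of i] I_eq by (auto simp: z_def)
    show "z i < 1/2" if "i \<in> G" for i using that K(3,4) G(2) by (auto simp: z_def J0_def)
    show "1/2 \<le> z i" if "i \<in> H" for i using that K(3,4) H(2) by (auto simp: z_def K0_def J0_def)
    have "{i \<in> G. z i < z p} = {i \<in> G. d i < x}" using K(3-5) by (auto simp: z_def)
    then show "card {i \<in> G. z i < z p} \<le> a" using G(5) by (simp add: a_def x_def L_def)
    have "{i \<in> H. z q < z i} = {i \<in> H. 1 - d i < y}" using K(3-5) by (auto simp: z_def)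
    then show "card {i \<in> H. z q < z i} \<le> b" using H(5) by (simp add: b_def y_def U_def)
    show "sum_list (take m (sort l)) \<le> z p + sum z S'"
      if S': "S' \<subseteq> G \<union> H" and m: "m \<le> length l" and c: "card S' + 1 = a + m" for S' m
    proof -
      have finS: "finite S'" using S' G(1) H(1) finite_subset by blast
      have SL: "S' \<subseteq> I - L" using S' I_eq disj by auto
      have sp: "split_set I d (L \<union> S')" "excess I d (L \<union> S') = excess I d L + real (card S')"
        using split_set_Un[OF splitL(1) finS SL] by auto
      have "real (card S') + 1 = real a + real m" using c by (metis of_nat_1 of_nat_add)
      moreover have "real a = real (card G) + real_of_int w - real (length l) + 1"
        using arg_cong[OF a, of real_of_int] by (simp add: a0_def)
      ultimately have "excess I d (L \<union> S') = sum_list l - real (length l) + real m"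
        using sp(2) splitL(2) w by simp
      then have "sum_list (take m (sort l)) \<le> infsum d (L \<union> S')"
        by (rule feasible_take_sort[OF feas sp(1) m])
      also have "infsum d (L \<union> S') = x + sum d S'"
        using infsum_Un_disjoint[of d L S'] splitL(1) finS SL by (auto simp: split_set_def x_def)
      also have "\<dots> = z p + sum z S'" using zsum[OF S'] by (simp add: z_def)
      finally show ?thesis .
    qed
  qed (use G(1) H(1) disj K x y card_ab tot S in \<open>auto simp: z_def K_def\<close>)
  obtain v where v: "orthonormal_on K v" "complex_vector.span (v ` K) = complex_vector.span (set (map e ks))"
    "\<And>i. i \<in> K \<Longrightarrow> cinner (E (v i)) (v i) = complex_of_real (z i)"
    using schur_horn_existence[OF sa K(1) len_ts[symmetric] sorted es maj] tot
    by (auto simp: ts_def sum_list_sort sum_list_replicate)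
  define g where "g i = (if i \<in> K then v i else e i)" for i
  have g: "is_onb I g"
    unfolding g_def using onb_replace[OF onb K(2) v(1)] v(2) by (simp add: ks(1))
  obtain g1 where g1: "is_onb I g1" "\<And>i. i \<in> I - L \<Longrightarrow> g1 i = g i"
    "\<And>i. i \<in> L \<Longrightarrow> cinner (E (g1 i)) (g1 i) = complex_of_real (d i)"
  proof (rule spread_diagonal_entry[OF g sa _ p, of x d])
    show "E (g i) = 0" if "i \<in> L - {p}" for i
    proof -
      have "i \<in> I" "i \<notin> K" using that I_eq q disj by (auto simp: K_def)
      then show ?thesis using \<kappa>L[OF that] by (simp add: g_def E_basis)
    qed
    show "cinner (E (g p)) (g p) = complex_of_real x"
      using v(3)[of p] by (simp add: g_def K_def z_def)
    show "(d has_sum x) L" using splitL(1) by (simp add: x_def split_set_def)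
  qed (use I_eq x d01 in auto)
  \<comment> \<open>For \<open>1 - E\<close> the upper tail is a lower tail, with collapsed entry
    \<open>y\<close> and target \<open>1 - d\<close>. Since \<open>U\<close> is disjoint from
    \<open>L\<close>, the entries spread before are left as they are.\<close>
  obtain g2 where g2: "is_onb I g2" "\<And>i. i \<in> I - U \<Longrightarrow> g2 i = g1 i"
    "\<And>i. i \<in> U \<Longrightarrow> cinner (g2 i - E (g2 i)) (g2 i) = complex_of_real (1 - d i)"
  proof (rule spread_diagonal_entry[OF g1(1) self_adjoint_complement[OF sa] _ q, of y "\<lambda>i. 1 - d i"])
    have g1U: "g1 i = g i" if "i \<in> U" for i using that disj I_eq by (intro g1(2)) auto
    show "g1 i - E (g1 i) = 0" if "i \<in> U - {q}" for i
    proof -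
      have "i \<in> I" "i \<notin> K" using that I_eq p disj by (auto simp: K_def)
      then show ?thesis using \<kappa>U[OF that] that g1U[of i] by (simp add: g_def E_basis)
    qed
    have "cinner (v q) (v q) = 1" using orthonormal_onD[OF v(1), of q q] by (simp add: K_def)
    then show "cinner (g1 q - E (g1 q)) (g1 q) = complex_of_real y"
      using v(3)[of q] g1U[OF q] K(5) by (simp add: g_def K_def z_def cinner_simps)
    show "((\<lambda>i. 1 - d i) has_sum y) U"
      using summable_on_subset[OF smK, of U] by (simp add: y_def U_def)
  qed (use I_eq y d01 in auto)
  have "cinner (E (g2 i)) (g2 i) = complex_of_real (d i)" if i: "i \<in> I" for i
  proof -
    consider "i \<in> U" | "i \<in> L" "i \<notin> U" | "i \<in> G \<union> H" "i \<notin> L" "i \<notin> U" using i I_eq disj by blast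
    then show ?thesis
    proof cases
      case 1
      have "is_onb I g2" by (rule g2(1))
      then have "cinner (g2 i) (g2 i) = 1" using i by (simp add: is_onb_def)
      then show ?thesis using g2(3)[OF 1] by (simp add: cinner_simps)
    next
      case 2
      then show ?thesis using g1(3)[of i] g2(2)[of i] i by simp
    next
      case 3
      then have "g2 i = v i" using g2(2)[of i] g1(2)[of i] i by (simp add: g_def K_def)
      moreover have "z i = d i" using 3 K(3,4) by (auto simp: z_def)
      ultimately show ?thesis using v(3)[of i] 3 by (simp add: K_def)
    qed
  qed
  then have "has_diagonal E I d" using g2(1) by (auto simp: has_diagonal_def)
  then show thesis
    using that[of \<kappa>] \<kappa>01 ms K(1) C by (auto simp: E_def)
qed

section \<open>Diagonals of projections\<close>

lemma has_sum_sum: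
  fixes f :: "'a \<Rightarrow> 'i \<Rightarrow> 'c::topological_comm_monoid_add"
  assumes "\<And>a. a \<in> A \<Longrightarrow> ((\<lambda>i. f a i) has_sum S a) I"
  shows "((\<lambda>i. \<Sum>a\<in>A. f a i) has_sum (\<Sum>a\<in>A. S a)) I"
  using assms by (induction A rule: infinite_finite_induct) (auto intro!: has_sum_add)

lemma projection_facts:
  assumes "orthogonal_projection P"
  shows "cinner (P x) y = cinner x (P y)" "P (P x) = P x" "cinner (P x) x = complex_of_real ((norm (P x))\<^sup>2)"
    "norm (P x) \<le> norm x"
proof -
  show 1: "cinner (P x) y = cinner x (P y)" for x y
    using assms by (simp add: orthogonal_projection_def self_adjoint_def)
  show 2: "P (P x) = P x" for x
    using assms by (metis orthogonal_projection_def comp_apply)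
  show 3: "cinner (P x) x = complex_of_real ((norm (P x))\<^sup>2)"
    using 1[of "P x" x] by (simp only: 2 cinner_self)
  have "norm (P x) * norm (P x) \<le> norm (P x) * norm x"
    using norm_cinner_le[of "P x" x] unfolding 3 by (simp add: power2_eq_square norm_mult)
  then show "norm (P x) \<le> norm x"
    by (cases "P x = 0") auto
qed

lemma cmod_cinner_commute: "cmod (cinner x y) = cmod (cinner y (x::'h::chilbert_space))"
  by (metis cinner_commute complex_mod_cnj)

text \<open>
  The trace of \<open>A - A\<^sup>2\<close>, for the compression \<open>A\<close> of a projection to the coordinates in \<open>F\<close>, is the
  squared Hilbert-Schmidt norm of the corner from \<open>F\<close> to its complement.
\<close>

lemma projection_finite_diagonal_sum:
  fixes e :: "'i \<Rightarrow> 'h::chilbert_space"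
  assumes onb: "is_onb I e" and P: "orthogonal_projection P" and F: "finite F" "F \<subseteq> I"
    and w: "w summable_on I" "\<And>i. i \<in> I \<Longrightarrow> (norm (P (e i)))\<^sup>2 - ((norm (P (e i)))\<^sup>2)\<^sup>2 \<le> w i"
  shows "\<exists>k::int. \<bar>(\<Sum>i\<in>F. (norm (P (e i)))\<^sup>2) - of_int k\<bar> \<le> 2 * infsum w (I - F)"
proof -
  have on: "orthonormal_on I e" using onb by (simp add: is_onb_iff)
  note Pf = projection_facts[OF P]
  define q where "q i = (norm (P (e i)))\<^sup>2" for i
  obtain r where r: "bij_betw r {..<card F} F" using ex_bij_betw_nat_finite[OF F(1)] by (auto simp: lessThan_atLeast0)
  define c where "c i j = cinner (P (e (r j))) (e (r i))" for i j
  let ?n = "card F"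
  have rI: "r i \<in> I" if "i < ?n" for i using bij_betwE[OF r] F(2) that by auto
  have onr: "orthonormal_on {..<?n} (\<lambda>i. e (r i))"
    unfolding orthonormal_on_def using rI orthonormal_onD[OF on] r
    by (auto simp: bij_betw_def inj_on_eq_iff)
  have quad: "(\<Sum>i<?n. \<Sum>j<?n. cnj (x i) * c i j * x j)
      = complex_of_real ((norm (P (\<Sum>i<?n. x i *\<^sub>C e (r i))))\<^sup>2)" for x
  proof -
    let ?v = "\<Sum>i<?n. x i *\<^sub>C e (r i)"
    have "P ?v = (\<Sum>i<?n. x i *\<^sub>C P (e (r i)))"
      using P by (simp add: orthogonal_projection_def self_adjoint_def bounded_clinear_def linear_simps
          bounded_linear.linear linear_sum)
    then have "cinner (P ?v) ?v = (\<Sum>i<?n. \<Sum>j<?n. cnj (x i) * c i j * x j)"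
      by (simp add: c_def cinner_sum_left cinner_sum_right cinner_simps sum_distrib_left ac_simps)
    then show ?thesis by (simp add: Pf(3))
  qed
  have "\<exists>k::int. \<bar>Re (\<Sum>i<?n. c i i) - of_int k\<bar> \<le> 2 * (Re (\<Sum>i<?n. c i i) - (\<Sum>i<?n. \<Sum>j<?n. (cmod (c i j))\<^sup>2))"
  proof (rule trace_near_integer)
    show "c j i = cnj (c i j)" for i j
      unfolding c_def by (metis Pf(1) cinner_commute)
    fix x :: "nat \<Rightarrow> complex"
    let ?v = "\<Sum>i<?n. x i *\<^sub>C e (r i)"
    show "0 \<le> Re (\<Sum>i<?n. \<Sum>j<?n. cnj (x i) * c i j * x j)" unfolding quad by simp
    have "(norm (P ?v))\<^sup>2 \<le> (norm ?v)\<^sup>2" by (intro power_mono Pf) auto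
    also have "\<dots> = (\<Sum>i<?n. (cmod (x i))\<^sup>2)" by (rule norm_sq_sum_orthonormal[OF onr]) simp
    finally show "Re (\<Sum>i<?n. \<Sum>j<?n. cnj (x i) * c i j * x j) \<le> (\<Sum>i<?n. (cmod (x i))\<^sup>2)"
      unfolding quad by simp
  qed
  moreover have "Re (\<Sum>i<?n. c i i) = sum q F"
  proof -
    have "Re (\<Sum>i<?n. c i i) = (\<Sum>i<?n. q (r i))" by (simp add: c_def Pf(3) q_def)
    then show ?thesis using sum.reindex_bij_betw[OF r, of q] by simp
  qed
  moreover have "(\<Sum>i<?n. \<Sum>j<?n. (cmod (c i j))\<^sup>2) = (\<Sum>i\<in>F. \<Sum>j\<in>F. (cmod (cinner (P (e j)) (e i)))\<^sup>2)"
  proof -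
    have "(\<Sum>i<?n. \<Sum>j<?n. (cmod (c i j))\<^sup>2) = (\<Sum>i<?n. \<Sum>j\<in>F. (cmod (cinner (P (e j)) (e (r i))))\<^sup>2)"
      unfolding c_def
      by (intro sum.cong refl sum.reindex_bij_betw[OF r, of "\<lambda>j. (cmod (cinner (P (e j)) (e (r i))))\<^sup>2" for i])
    also have "\<dots> = (\<Sum>i\<in>F. \<Sum>j\<in>F. (cmod (cinner (P (e j)) (e i)))\<^sup>2)"
      by (rule sum.reindex_bij_betw[OF r])
    finally show ?thesis .
  qed
  ultimately have near: "\<exists>k::int. \<bar>sum q F - of_int k\<bar> \<le> 2 * (sum q F - (\<Sum>i\<in>F. \<Sum>j\<in>F. (cmod (cinner (P (e j)) (e i)))\<^sup>2))"
    by simp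
  let ?h = "\<lambda>i. \<Sum>j\<in>F. (cmod (cinner (P (e j)) (e i)))\<^sup>2"
  have "((\<lambda>i. \<Sum>j\<in>F. (cmod (cinner (P (e j)) (e i)))\<^sup>2) has_sum (\<Sum>j\<in>F. (norm (P (e j)))\<^sup>2)) I"
    by (intro has_sum_sum parseval[OF onb])
  then have "(?h has_sum sum q F) I" by (simp add: q_def)
  then have hs: "(?h has_sum (sum q F - sum ?h F)) (I - F)"
    by (rule has_sum_Diff) (use F in \<open>auto intro: has_sum_finite\<close>)
  have "sum q F - sum ?h F \<le> infsum w (I - F)"
  proof (rule has_sum_mono[OF hs has_sum_infsum])
    show "w summable_on (I - F)" using w(1) by (rule summable_on_subset) auto
    fix i assume i: "i \<in> I - F"
    \<comment> \<open>Bessel's inequality with \<open>i\<close> itself included among the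
      coordinates: the term for \<open>i\<close> contributes the square of the diagonal entry, so
      the part of \<open>P (e i)\<close> with coordinates in \<open>F\<close> has squared norm at
      most \<open>q i - (q i)\<^sup>2\<close>, hence at most \<open>w i\<close>.\<close>
    have "(\<Sum>j\<in>insert i F. (cmod (cinner (P (e i)) (e j)))\<^sup>2) \<le> (norm (P (e i)))\<^sup>2"
      by (rule bessel[OF orthonormal_on_subset[OF on]]) (use i F in auto)
    then have "(cmod (cinner (P (e i)) (e i)))\<^sup>2 + (\<Sum>j\<in>F. (cmod (cinner (P (e i)) (e j)))\<^sup>2) \<le> q i"
      using i F(1) by (simp add: q_def)
    moreover have "cmod (cinner (P (e i)) (e i)) = q i" unfolding Pf(3) q_def norm_of_real by simp
    moreover have "cmod (cinner (P (e i)) (e j)) = cmod (cinner (P (e j)) (e i))" for j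
      unfolding Pf(1)[of "e i" "e j"] by (rule cmod_cinner_commute)
    then have "(\<Sum>j\<in>F. (cmod (cinner (P (e i)) (e j)))\<^sup>2) = ?h i"
      by (intro sum.cong refl) (rule arg_cong)
    ultimately have "(q i)\<^sup>2 + ?h i \<le> q i" by simp
    then show "?h i \<le> w i" using w(2)[of i] i by (simp add: q_def)
  qed
  then have "2 * (sum q F - sum ?h F) \<le> 2 * infsum w (I - F)" by simp
  with near show ?thesis unfolding q_def[symmetric] by (meson order_trans)
qed

text \<open>The function \<open>r\<close> is \<open>q\<close> on \<open>J\<close> and
  \<open>q - 1\<close> off \<open>J\<close>, so its sum is the excess. Over a finite
  \<open>F\<close> its sum differs by an integer from the sum of \<open>q\<close>, which is within
  twice a tail sum of an integer; the estimate \<open>q - q\<^sup>2 \<le> \<bar>r\<bar>\<close> lets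
  \<open>\<bar>r\<bar>\<close> serve as the weight there. The excess is thus a limit of
  integers.\<close>

theorem projection_excess_integer:
  fixes e :: "'i \<Rightarrow> 'h::chilbert_space"
  assumes onb: "is_onb I e" and P: "orthogonal_projection P"
    and q: "\<And>i. i \<in> I \<Longrightarrow> cinner (P (e i)) (e i) = complex_of_real (q i)" and J: "split_set I q J"
  shows "excess I q J \<in> \<int>"
proof -
  have on: "orthonormal_on I e" using onb by (simp add: is_onb_iff)
  note Pf = projection_facts[OF P]
  have qP: "q i = (norm (P (e i)))\<^sup>2" if "i \<in> I" for i using q[OF that] Pf(3) by (metis of_real_eq_iff)
  have q01: "0 \<le> q i" "q i \<le> 1" if "i \<in> I" for i
  proof -
    show "0 \<le> q i" using qP[OF that] by simp
    have "norm (P (e i)) \<le> 1" using Pf(4)[of "e i"] orthonormal_on_norm[OF on that] by simp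
    then show "q i \<le> 1" using qP[OF that] by (simp add: power_le_one)
  qed
  define r where "r i = (if i \<in> J then q i else q i - 1)" for i
  have JI: "J \<subseteq> I" and sm: "q summable_on J" "(\<lambda>i. 1 - q i) summable_on (I - J)"
    using J by (auto simp: split_set_def)
  have hsJ: "(r has_sum infsum q J) J" 
    using has_sum_infsum[OF sm(1)] by (rule has_sum_cong[THEN iffD1, rotated]) (simp add: r_def)
  have "((\<lambda>i. - (1 - q i)) has_sum - infsum (\<lambda>i. 1 - q i) (I - J)) (I - J)"
    using has_sum_infsum[OF sm(2)] by (simp only: has_sum_uminus minus_minus)
  then have hsK: "(r has_sum - infsum (\<lambda>i. 1 - q i) (I - J)) (I - J)"
    by (rule has_sum_cong[THEN iffD1, rotated]) (simp add: r_def)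
  have "(r has_sum (infsum q J + - infsum (\<lambda>i. 1 - q i) (I - J))) (J \<union> (I - J))"
    by (rule has_sum_Un_disjoint[OF hsJ hsK]) auto
  moreover have "J \<union> (I - J) = I" using JI by auto
  ultimately have hs: "(r has_sum excess I q J) I" by (simp add: excess_def)
  have abs: "(\<lambda>i. \<bar>r i\<bar>) summable_on I"
    using has_sum_imp_summable[OF hs] summable_on_iff_abs_summable_on_real by auto
  have "\<exists>k\<in>\<int>. dist k (excess I q J) < \<epsilon>" if "\<epsilon> > 0" for \<epsilon>
  proof -
    have "\<epsilon> / 4 > 0" using that by simp
    then obtain F where F: "finite F" "F \<subseteq> I" "dist (sum (\<lambda>i. \<bar>r i\<bar>) F) (infsum (\<lambda>i. \<bar>r i\<bar>) I) \<le> \<epsilon> / 4"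
      using infsum_finite_approximation[OF abs] by blast
    have absF: "(\<lambda>i. \<bar>r i\<bar>) summable_on (I - F)" using abs by (rule summable_on_subset) auto
    have tail: "infsum (\<lambda>i. \<bar>r i\<bar>) (I - F) \<le> \<epsilon> / 4"
    proof -
      have "infsum (\<lambda>i. \<bar>r i\<bar>) (I - F) = infsum (\<lambda>i. \<bar>r i\<bar>) I - sum (\<lambda>i. \<bar>r i\<bar>) F"
        using infsum_Diff[OF abs _ F(2)] F(1) by simp
      then show ?thesis using F(3) unfolding dist_real_def abs_le_iff by linarith
    qed
    have "(r has_sum (excess I q J - sum r F)) (I - F)"
      by (rule has_sum_Diff[OF hs]) (use F in \<open>auto intro: has_sum_finite\<close>)
    then have "\<bar>excess I q J - sum r F\<bar> \<le> infsum (\<lambda>i. \<bar>r i\<bar>) (I - F)"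
      using norm_infsum_bound[of r "I - F"] absF by (simp add: infsumI)
    then have 1: "\<bar>excess I q J - sum r F\<bar> \<le> \<epsilon> / 4" using tail by simp
    have "\<exists>k::int. \<bar>(\<Sum>i\<in>F. (norm (P (e i)))\<^sup>2) - of_int k\<bar> \<le> 2 * infsum (\<lambda>i. \<bar>r i\<bar>) (I - F)"
    proof (rule projection_finite_diagonal_sum[OF onb P F(1,2) abs])
      fix i assume i: "i \<in> I"
      have "q i - (q i)\<^sup>2 \<le> \<bar>r i\<bar>"
        using q01[OF i] zero_le_power2[of "1 - q i"] by (auto simp: r_def power2_eq_square algebra_simps)
      then show "(norm (P (e i)))\<^sup>2 - ((norm (P (e i)))\<^sup>2)\<^sup>2 \<le> \<bar>r i\<bar>" by (simp only: qP[OF i])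
    qed
    moreover have "(\<Sum>i\<in>F. (norm (P (e i)))\<^sup>2) = sum q F"
      using qP F(2) by (intro sum.cong) auto
    moreover have "2 * infsum (\<lambda>i. \<bar>r i\<bar>) (I - F) \<le> \<epsilon> / 2" using tail by simp
    ultimately obtain k where k: "\<bar>sum q F - of_int k\<bar> \<le> \<epsilon> / 2"
      by (metis order_trans)
    have "sum r F = (\<Sum>i\<in>F. q i - (if i \<in> J then 0 else 1))" by (intro sum.cong) (auto simp: r_def)
    also have "\<dots> = sum q F - real (card (F - J))"
    proof -
      have "(\<Sum>i\<in>F. if i \<in> J then 0 else 1) = (\<Sum>i\<in>F - J. 1::real)"
        using F(1) by (intro sum.mono_neutral_cong_right) auto
      then show ?thesis by (simp add: sum_subtractf)
    qed
    finally have "dist (of_int (k - int (card (F - J)))) (excess I q J) < \<epsilon>"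
      using 1 k \<open>\<epsilon> > 0\<close> unfolding dist_real_def of_int_diff of_int_of_nat_eq by linarith
    then show ?thesis by (metis Ints_of_int)
  qed
  then show ?thesis using closed_approachable[OF closed_Ints] by blast
qed

section \<open>Eigenvalue decomposition\<close>

lemma gram_schmidt_complex:
  fixes B :: "'h::chilbert_space set"
  assumes "finite B" "complex_vector.independent B"
  shows "\<exists>u. orthonormal_on {..<card B} u \<and> complex_vector.span (u ` {..<card B}) = complex_vector.span B"
  using assms
proof (induction B)
  case empty
  then show ?case by (simp add: orthonormal_on_def)
next
  case (insert b B)
  let ?n = "card B"
  have b: "b \<notin> complex_vector.span B" and ind: "complex_vector.independent B"
    using insert.prems insert.hyps by (simp_all add: complex_vector.independent_insert)
  obtain u where u: "orthonormal_on {..<?n} u" "complex_vector.span (u ` {..<?n}) = complex_vector.span B"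
    using insert.IH[OF ind] by blast
  define p where "p = (\<Sum>i<?n. cinner b (u i) *\<^sub>C u i)"
  have p: "p \<in> complex_vector.span (u ` {..<?n})"
    unfolding p_def by (intro complex_vector.span_sum complex_vector.span_scale complex_vector.span_base) auto
  have nz: "b - p \<noteq> 0" using b p u(2) by auto
  let ?c = "complex_of_real (1 / norm (b - p))"
  define w where "w = ?c *\<^sub>C (b - p)"
  have ww: "cinner w w = 1"
    using nz by (simp add: w_def cinner_self norm_scaleC norm_mult norm_divide)
  have orth: "cinner w (u i) = 0" if "i < ?n" for i
    unfolding w_def p_def using cinner_sum_orthonormal[OF u(1) finite_lessThan subset_refl, of i] that
    by (simp add: cinner_simps)
  then have orth': "cinner (u i) w = 0" if "i < ?n" for i
    using orth[OF that] cinner_commute[of "u i" w] by simp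
  define u' where "u' = u(?n := w)"
  have on: "orthonormal_on {..<Suc ?n} u'"
    unfolding orthonormal_on_def u'_def using orthonormal_onD[OF u(1)] ww orth orth'
    by (auto simp: less_Suc_eq)
  have im: "u' ` {..<Suc ?n} = insert w (u ` {..<?n})"
    by (auto simp: u'_def lessThan_Suc)
  have "complex_vector.span (insert w (u ` {..<?n})) = complex_vector.span (insert b B)"
  proof (rule iffD2[OF complex_vector.span_eq], intro conjI)
    have sub: "complex_vector.span B \<subseteq> complex_vector.span (insert b B)"
      by (rule complex_vector.span_mono) auto
    have "b \<in> complex_vector.span (insert b B)" by (rule complex_vector.span_base) auto
    then have "w \<in> complex_vector.span (insert b B)"
      unfolding w_def using p u(2) sub by (intro complex_vector.span_scale complex_vector.span_diff) auto
    moreover have "u ` {..<?n} \<subseteq> complex_vector.span (insert b B)"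
      using complex_vector.span_superset[of "u ` {..<?n}"] sub unfolding u(2) by (rule subset_trans)
    ultimately show "insert w (u ` {..<?n}) \<subseteq> complex_vector.span (insert b B)" by simp
    have sub': "complex_vector.span (u ` {..<?n}) \<subseteq> complex_vector.span (insert w (u ` {..<?n}))"
      by (rule complex_vector.span_mono) auto
    have "b = complex_of_real (norm (b - p)) *\<^sub>C w + p"
      using nz by (simp add: w_def scaleC_scaleC)
    moreover have "complex_of_real (norm (b - p)) *\<^sub>C w + p \<in> complex_vector.span (insert w (u ` {..<?n}))"
      using sub' p by (intro complex_vector.span_add complex_vector.span_scale) (auto intro: complex_vector.span_base)
    ultimately have "b \<in> complex_vector.span (insert w (u ` {..<?n}))" by simp
    moreover have "B \<subseteq> complex_vector.span (insert w (u ` {..<?n}))"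
      using complex_vector.span_superset[of B] sub' unfolding u(2) by (rule subset_trans)
    ultimately show "insert b B \<subseteq> complex_vector.span (insert w (u ` {..<?n}))" by simp
  qed
  then show ?case using on im insert.hyps by (intro exI[of _ u']) simp
qed

lemma has_cdim_orthonormal_basis:
  assumes "has_cdim V n"
  obtains u where "orthonormal_on {..<n} u" "complex_vector.span (u ` {..<n}) = V"
  using assms gram_schmidt_complex unfolding has_cdim_def by metis

lemma orthonormal_spans:
  assumes V: "has_cdim V n" and on: "orthonormal_on A u" and A: "finite A" "card A = n" "u ` A \<subseteq> V"
  shows "complex_vector.span (u ` A) = V"
proof
  obtain B where B: "finite B" "card B = n" "complex_vector.span B = V" using V by (auto simp: has_cdim_def)
  then show "complex_vector.span (u ` A) \<subseteq> V"
    using A(3) by (metis complex_vector.span_minimal complex_vector.subspace_span)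
  show "V \<subseteq> complex_vector.span (u ` A)"
  proof
    fix x assume x: "x \<in> V"
    show "x \<in> complex_vector.span (u ` A)"
    proof (rule ccontr)
      assume "x \<notin> complex_vector.span (u ` A)"
      moreover from this have "x \<notin> u ` A" using complex_vector.span_base by metis
      ultimately have "complex_vector.independent (insert x (u ` A))" "x \<notin> u ` A"
        using orthonormal_on_independent[OF on A(1)]
        by (simp_all add: complex_vector.independent_insert)
      moreover have "insert x (u ` A) \<subseteq> complex_vector.span B" using x A(3) B(3) by auto
      ultimately have "card (insert x (u ` A)) \<le> card B"
        using complex_vector.independent_span_bound[OF B(1)] by blast
      then show False
        using A(1,2) B(2) \<open>x \<notin> u ` A\<close> card_image[OF orthonormal_on_inj[OF on]] by simp
    qed
  qed
qed

lemma count_list_map_of_real: "count_list (map complex_of_real l) (complex_of_real t) = count_list l t"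
  by (induction l) auto

text \<open>Indices are pairs of an eigenvalue and a copy number, which separates repeated entries
  of \<open>l\<close>. Eigenvectors for different eigenvalues are orthogonal, and the multiplicities
  add up to the dimension of \<open>H_part E\<close>, so the bases of the eigenspaces together fill
  it.\<close>

lemma eigenbasis_exists:
  fixes E :: "'h::chilbert_space \<Rightarrow> 'h" and l :: "real list"
  defines "A \<equiv> Sigma (set l) (\<lambda>t. {..<count_list l t})"
  assumes sa: "self_adjoint E" and dim: "has_cdim (H_part E) (length l)" and ev: "has_eigenvalue_list E l"
  obtains U where "orthonormal_on A U" "complex_vector.span (U ` A) = H_part E"
    "\<And>a. a \<in> A \<Longrightarrow> E (U a) = complex_of_real (fst a) *\<^sub>C U a"
proof -
  have "\<exists>u. orthonormal_on {..<count_list l t} u \<and>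
      complex_vector.span (u ` {..<count_list l t}) = {v \<in> H_part E. E v = complex_of_real t *\<^sub>C v}" for t
  proof -
    have "has_cdim {v \<in> H_part E. E v = complex_of_real t *\<^sub>C v} (count_list l t)"
      using ev unfolding has_eigenvalue_list_def by (metis count_list_map_of_real)
    then show ?thesis by (rule has_cdim_orthonormal_basis) blast
  qed
  then obtain u where u: "\<And>t. orthonormal_on {..<count_list l t} (u t)"
    "\<And>t. complex_vector.span (u t ` {..<count_list l t}) = {v \<in> H_part E. E v = complex_of_real t *\<^sub>C v}"
    by metis
  define U where "U a = u (fst a) (snd a)" for a
  have mem: "U a \<in> H_part E" "E (U a) = complex_of_real (fst a) *\<^sub>C U a" if "a \<in> A" for a
  proof -
    have "U a \<in> u (fst a) ` {..<count_list l (fst a)}" using that by (auto simp: A_def U_def)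
    then have "U a \<in> {v \<in> H_part E. E v = complex_of_real (fst a) *\<^sub>C v}"
      unfolding u(2)[symmetric] by (rule complex_vector.span_base)
    then show "U a \<in> H_part E" "E (U a) = complex_of_real (fst a) *\<^sub>C U a" by auto
  qed
  have on: "orthonormal_on A U"
    unfolding orthonormal_on_def
  proof (intro ballI)
    fix a b assume ab: "a \<in> A" "b \<in> A"
    show "cinner (U a) (U b) = (if a = b then 1 else 0)"
    proof (cases "fst a = fst b")
      case True
      then show ?thesis using ab orthonormal_onD[OF u(1)[of "fst a"], of "snd a" "snd b"]
        by (auto simp: A_def U_def prod_eq_iff)
    next
      case False
      have "cinner (E (U a)) (U b) = cinner (U a) (E (U b))" by (rule self_adjoint_cinner[OF sa])
      then have "complex_of_real (fst a) * cinner (U a) (U b) = complex_of_real (fst b) * cinner (U a) (U b)"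
        by (simp add: mem ab cinner_simps)
      then show ?thesis using False by auto
    qed
  qed
  have fin: "finite A" by (simp add: A_def)
  have "card A = (\<Sum>t\<in>set l. count_list l t)" by (simp add: A_def card_SigmaI)
  also have "\<dots> = length l" by (rule sum_count_set) auto
  finally have "complex_vector.span (U ` A) = H_part E"
    using mem by (intro orthonormal_spans[OF dim on fin]) auto
  then show thesis using that on mem by blast
qed

text \<open>For every \<open>z\<close> the vector \<open>E z - E (E z)\<close> is orthogonal to both
  kernels, hence lies in \<open>H_part E\<close>. If \<open>y\<close> is orthogonal to
  \<open>H_part E\<close>, moving \<open>E - E\<^sup>2\<close> to the other side of the inner
  product shows \<open>E (E y) = E y\<close>. So \<open>E\<close> preceded by the projection off
  \<open>H_part E\<close> is a projection \<open>Q\<close>, and \<beta> holds the squared moduli of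
  the coordinates of \<open>e i\<close> along the eigenvectors.\<close>

lemma Lambda_decomposition:
  fixes l :: "real list" and I :: "'i set"
  defines "A \<equiv> Sigma (set l) (\<lambda>t. {..<count_list l t})"
  assumes "l \<in> Lambda TYPE('h::chilbert_space) I d N"
  obtains e :: "'i \<Rightarrow> 'h::chilbert_space" and Q :: "'h \<Rightarrow> 'h" and \<beta> :: "'i \<Rightarrow> real \<times> nat \<Rightarrow> real" and q :: "'i \<Rightarrow> real"
  where "is_onb I e" "orthogonal_projection Q"
    "\<And>i. i \<in> I \<Longrightarrow> cinner (Q (e i)) (e i) = complex_of_real (q i)"
    "\<And>i. i \<in> I \<Longrightarrow> d i = q i + (\<Sum>a\<in>A. fst a * \<beta> i a)"
    "\<And>i a. 0 \<le> \<beta> i a" "\<And>a. a \<in> A \<Longrightarrow> ((\<lambda>i. \<beta> i a) has_sum 1) I"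
    "\<And>i. 0 \<le> q i" "\<And>i. i \<in> I \<Longrightarrow> q i + (\<Sum>a\<in>A. \<beta> i a) \<le> 1"
proof -
  obtain E :: "'h \<Rightarrow> 'h" where pos: "positive_operator E" and diag: "has_diagonal E I d"
    and dim: "has_cdim (H_part E) (length l)" and ev: "has_eigenvalue_list E l"
    using assms by (auto simp: Lambda_def open_cube_def)
  have sa: "self_adjoint E" using pos by (simp add: positive_operator_def)
  obtain e :: "'i \<Rightarrow> 'h" where onb: "is_onb I e" and de: "\<And>i. i \<in> I \<Longrightarrow> cinner (E (e i)) (e i) = complex_of_real (d i)"
    using diag by (auto simp: has_diagonal_def)
  obtain U where U: "orthonormal_on A U" "complex_vector.span (U ` A) = H_part E"
    "\<And>a. a \<in> A \<Longrightarrow> E (U a) = complex_of_real (fst a) *\<^sub>C U a"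
    using eigenbasis_exists[OF sa dim ev] unfolding A_def by blast
  have finA: "finite A" by (simp add: A_def)
  note add = self_adjoint_add[OF sa] and scale = self_adjoint_scaleC[OF sa] and adj = self_adjoint_cinner[OF sa]
  have E0: "E 0 = 0" using scale[of 0 0] by simp
  have diff: "E (x - y) = E x - E y" for x y
    using self_adjoint_bounded_linear[OF sa] by (simp add: linear_simps)
  have range: "E z - E (E z) \<in> H_part E" for z
  proof -
    have "cinner (E z - E (E z)) (u + v) = 0" if "E u = 0" "v - E v = 0" for u v
    proof -
      have v: "E v = v" using that by simp
      have "cinner (E z - E (E z)) (u + v) = cinner z (E (u + v) - E (E (u + v)))"
        by (simp only: cinner_diff_left cinner_diff_right adj)
      also have "E (u + v) - E (E (u + v)) = 0" by (simp add: add that(1) v E0)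
      finally show ?thesis by simp
    qed
    then show ?thesis by (auto simp: H_part_def orth_complement_def)
  qed
  define \<pi> where "\<pi> x = (\<Sum>a\<in>A. cinner x (U a) *\<^sub>C U a)" for x
  have cpi: "cinner (\<pi> x) (U a) = cinner x (U a)" if "a \<in> A" for x a
    using cinner_sum_orthonormal[OF U(1) finA subset_refl that] that by (simp add: \<pi>_def)
  have perp: "cinner (x - \<pi> x) h = 0" if "h \<in> H_part E" for x h
    by (rule cinner_span_eq_0[of "U ` A"]) (use that U(2) cpi in \<open>auto simp: cinner_simps\<close>)
  have EE: "E (E (x - \<pi> x)) = E (x - \<pi> x)" for x
  proof -
    let ?y = "x - \<pi> x"
    have "cinner (E ?y - E (E ?y)) w = cinner ?y (E w - E (E w))" for w
      by (simp only: cinner_diff_left cinner_diff_right adj)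
    then have "cinner (E ?y - E (E ?y)) w = 0" for w using perp[OF range] by simp
    from this[of "E ?y - E (E ?y)"] show ?thesis by simp
  qed
  define Q where "Q x = E (x - \<pi> x)" for x
  have Epi: "E (\<pi> x) = (\<Sum>a\<in>A. (complex_of_real (fst a) * cinner x (U a)) *\<^sub>C U a)" for x
  proof -
    have "E (\<pi> x) = (\<Sum>a\<in>A. E (cinner x (U a) *\<^sub>C U a))"
      unfolding \<pi>_def using self_adjoint_bounded_linear[OF sa] by (simp add: bounded_linear.linear linear_sum)
    also have "\<dots> = (\<Sum>a\<in>A. (complex_of_real (fst a) * cinner x (U a)) *\<^sub>C U a)"
      by (intro sum.cong) (auto simp: scale U(3) scaleC_scaleC mult.commute)
    finally show ?thesis .
  qed
  have Qx: "Q x = E x - (\<Sum>a\<in>A. (complex_of_real (fst a) * cinner x (U a)) *\<^sub>C U a)" for x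
    by (simp add: Q_def diff Epi)
  have adjU: "cinner (\<Sum>a\<in>A. (complex_of_real (fst a) * cinner x (U a)) *\<^sub>C U a) y
      = cinner x (\<Sum>a\<in>A. (complex_of_real (fst a) * cinner y (U a)) *\<^sub>C U a)" for x y
    unfolding cinner_sum_left cinner_sum_right
    by (intro sum.cong refl) (simp add: cinner_simps cinner_commute[of "U _" y])
  have Qadj: "cinner (Q x) y = cinner x (Q y)" for x y
    by (simp only: Qx cinner_diff_left cinner_diff_right adj adjU)
  have pi_add: "\<pi> (x + y) = \<pi> x + \<pi> y" and pi_scale: "\<pi> (c *\<^sub>C x) = c *\<^sub>C \<pi> x" for x y c
    by (simp_all add: \<pi>_def cinner_simps complex_vector.scale_left_distrib sum.distrib
        complex_vector.scale_sum_right scaleC_scaleC)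
  have Q_add: "Q (x + y) = Q x + Q y" and Q_scale: "Q (c *\<^sub>C x) = c *\<^sub>C Q x" for x y c
  proof -
    show "Q (x + y) = Q x + Q y" by (simp add: Q_def pi_add diff add)
    show "Q (c *\<^sub>C x) = c *\<^sub>C Q x"
      by (simp add: Q_def pi_scale diff scale complex_vector.scale_right_diff_distrib)
  qed
  have QQ: "Q (Q x) = Q x" for x
  proof -
    have "cinner (Q x) (U a) = 0" if "a \<in> A" for a
      using cpi[OF that, of x] by (simp add: Q_def adj U(3) that cinner_simps)
    then have "\<pi> (Q x) = 0" by (simp add: \<pi>_def)
    then show ?thesis using EE[of x] by (simp add: Q_def)
  qed
  have normpi: "(norm (x - \<pi> x))\<^sup>2 = (norm x)\<^sup>2 - (\<Sum>a\<in>A. (cmod (cinner x (U a)))\<^sup>2)" for x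
    unfolding \<pi>_def by (rule norm_sq_proj_orthonormal[OF U(1) finA])
  have Qle: "norm (Q x) \<le> norm (x - \<pi> x)" for x
  proof -
    let ?y = "x - \<pi> x"
    have "complex_of_real ((norm (E ?y))\<^sup>2) = cinner ?y (E ?y)"
      using adj[of ?y "E ?y"] EE[of x] by (simp only: cinner_self)
    from this[symmetric] have "cmod (cinner ?y (E ?y)) = norm (E ?y) * norm (E ?y)"
      by (simp only: norm_of_real power2_eq_square abs_mult abs_norm_cancel)
    then have "norm (E ?y) * norm (E ?y) \<le> norm (E ?y) * norm ?y"
      using norm_cinner_le[of ?y "E ?y"] by (simp add: mult.commute)
    then show ?thesis unfolding Q_def by (cases "E ?y = 0") auto
  qed
  have "bounded_linear Q"
  proof (rule bounded_linear_intro[where K=1])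
    show "Q (r *\<^sub>R x) = r *\<^sub>R Q x" for r x
      using Q_scale[of "complex_of_real r" x] by (simp add: scaleC_of_real)
    fix x
    have "(norm (x - \<pi> x))\<^sup>2 \<le> (norm x)\<^sup>2" unfolding normpi by (simp add: sum_nonneg)
    then have "norm (x - \<pi> x) \<le> norm x" by (rule power2_le_imp_le) simp
    then show "norm (Q x) \<le> norm x * 1" using Qle[of x] by simp
  qed (rule Q_add)
  then have proj: "orthogonal_projection Q"
    using QQ Qadj Q_scale by (auto simp: orthogonal_projection_def self_adjoint_def bounded_clinear_def fun_eq_iff)
  define \<beta> where "\<beta> i a = (cmod (cinner (e i) (U a)))\<^sup>2" for i a
  define q where "q i = (norm (Q (e i)))\<^sup>2" for i
  have on: "orthonormal_on I e" using onb by (simp add: is_onb_iff)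
  show thesis
  proof (rule that[OF onb proj, of q \<beta>])
    show qi: "cinner (Q (e i)) (e i) = complex_of_real (q i)" for i
      by (simp add: projection_facts(3)[OF proj] q_def)
    show "d i = q i + (\<Sum>a\<in>A. fst a * \<beta> i a)" if "i \<in> I" for i
    proof -
      have "complex_of_real (q i) = complex_of_real (d i)
          - (\<Sum>a\<in>A. complex_of_real (fst a) * (cinner (e i) (U a) * cinner (U a) (e i)))"
        unfolding qi[symmetric] de[OF that, symmetric] Qx
        by (simp add: cinner_diff_left cinner_sum_left cinner_scaleC_left mult.assoc)
      also have "(\<Sum>a\<in>A. complex_of_real (fst a) * (cinner (e i) (U a) * cinner (U a) (e i)))
          = complex_of_real (\<Sum>a\<in>A. fst a * \<beta> i a)"
        unfolding \<beta>_def of_real_sum of_real_mult complex_norm_square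
        by (intro sum.cong refl) (simp add: cinner_commute[of "U _" "e i"])
      finally have "complex_of_real (q i) = complex_of_real (d i - (\<Sum>a\<in>A. fst a * \<beta> i a))" by simp
      then show ?thesis by (simp only: of_real_eq_iff)
    qed
    show "((\<lambda>i. \<beta> i a) has_sum 1) I" if "a \<in> A" for a
      using parseval[OF onb, of "U a"] orthonormal_on_norm[OF U(1) that]
      unfolding \<beta>_def cmod_cinner_commute[of "e _" "U a"] by simp
    show "q i + (\<Sum>a\<in>A. \<beta> i a) \<le> 1" if "i \<in> I" for i
    proof -
      have "q i \<le> (norm (e i - \<pi> (e i)))\<^sup>2" unfolding q_def by (intro power_mono Qle) simp
      then show ?thesis unfolding normpi \<beta>_def orthonormal_on_norm[OF on that] by simp
    qed
  qed (auto simp: \<beta>_def q_def)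
qed

section \<open>Sums over eigenvalues with multiplicity, and the necessary conditions\<close>

lemma sum_list_map_count_list:
  fixes f :: "'a \<Rightarrow> real"
  assumes "finite X" "set l \<subseteq> X"
  shows "sum_list (map f l) = (\<Sum>x\<in>X. real (count_list l x) * f x)"
  using assms(2)
proof (induction l)
  case (Cons y l)
  have "(\<Sum>x\<in>X. real (count_list (y # l) x) * f x)
      = (\<Sum>x\<in>X. (if x = y then f x else 0) + real (count_list l x) * f x)"
    by (intro sum.cong) (auto simp: algebra_simps)
  then show ?case using Cons assms(1) by (simp add: sum.distrib)
qed simp

lemma sum_eigenvalue_pairs:
  fixes f :: "real \<Rightarrow> real"
  shows "(\<Sum>a\<in>Sigma (set l) (\<lambda>t. {..<count_list l t}). f (fst a)) = sum_list (map f l)"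
proof -
  have "(\<Sum>a\<in>Sigma (set l) (\<lambda>t. {..<count_list l t}). f (fst a))
      = (\<Sum>(t, k)\<in>Sigma (set l) (\<lambda>t. {..<count_list l t}). f t)"
    by (simp add: case_prod_unfold)
  also have "\<dots> = (\<Sum>t\<in>set l. \<Sum>k<count_list l t. f t)"
    by (rule sum.Sigma[symmetric]) auto
  finally show ?thesis by (simp add: sum_list_map_count_list[OF _ subset_refl])
qed

lemma mset_decreasing: "mset (decreasing l) = mset l"
  by (simp add: decreasing_def)

lemma length_decreasing [simp]: "length (decreasing l) = length l"
  by (simp add: decreasing_def)

lemma set_decreasing [simp]: "set (decreasing l) = set l"
  by (simp add: decreasing_def)

lemma sorted_decreasing: "sorted_wrt (\<ge>) (decreasing l)"
  by (simp add: decreasing_def sorted_wrt_rev)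

text \<open>The tent has its kink at \<open>t\<close>: the minimum is \<open>t * (1 - x)\<close> for
  \<open>x \<ge> t\<close> and \<open>(1 - t) * x\<close> for \<open>x \<le> t\<close>. With
  \<open>t\<close> the \<open>n\<close>-th largest entry, found at index \<open>n - 1\<close>, the
  first \<open>n\<close> entries take one branch and the others the second.\<close>

lemma tent_sum_decreasing:
  fixes l :: "real list"
  assumes n: "1 \<le> n" "n \<le> length l"
  defines "t \<equiv> decreasing l ! (n - 1)"
  shows "sum_list (map (\<lambda>x. min ((1 - t) * x) (t * (1 - x))) l)
    = t * real n + (1 - t) * sum_list l - sum_list (take n (decreasing l))"
proof -
  let ?g = "\<lambda>x. min ((1 - t) * x) (t * (1 - x))" and ?D = "decreasing l"
  have low: "sum_list (map ?g xs) = t * real (length xs) - t * sum_list xs" if "\<forall>x\<in>set xs. t \<le> x" for xs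
    using that by (induction xs) (auto simp: algebra_simps min_def)
  have high: "sum_list (map ?g xs) = (1 - t) * sum_list xs" if "\<forall>x\<in>set xs. x \<le> t" for xs
    using that by (induction xs) (auto simp: algebra_simps min_def)
  have mono: "?D ! j \<le> ?D ! i" if "i \<le> j" "j < length l" for i j
    using sorted_wrt_nth_less[OF sorted_decreasing, of i j l] that by (cases "i = j") auto
  have "\<forall>x\<in>set (take n ?D). t \<le> x"
    using mono n by (fastforce simp: t_def in_set_conv_nth)
  then have 1: "sum_list (map ?g (take n ?D)) = t * real n - t * sum_list (take n ?D)"
    using low[of "take n ?D"] n by simp
  have "\<forall>x\<in>set (drop n ?D). x \<le> t"
  proof
    fix x assume "x \<in> set (drop n ?D)"
    then obtain j where "j < length l - n" "x = ?D ! (n + j)" by (auto simp: in_set_conv_nth)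
    then show "x \<le> t" unfolding t_def using mono[of "n - 1" "n + j"] by simp
  qed
  then have 2: "sum_list (map ?g (drop n ?D)) = (1 - t) * sum_list (drop n ?D)" by (rule high)
  have "sum_list (map ?g l) = sum_list (map ?g ?D)"
  proof -
    have "sum_mset (mset (map ?g l)) = sum_mset (mset (map ?g ?D))"
      unfolding mset_map mset_decreasing ..
    then show ?thesis by (simp only: sum_mset_sum_list)
  qed
  also have "\<dots> = sum_list (map ?g (take n ?D)) + sum_list (map ?g (drop n ?D))"
    unfolding sum_list_append[symmetric] map_append[symmetric] by simp
  finally have "sum_list (map ?g l) = t * real n - t * sum_list (take n ?D) + (1 - t) * sum_list (drop n ?D)"
    by (simp only: 1 2)
  moreover have "sum_list l = sum_list (take n ?D) + sum_list (drop n ?D)"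
    unfolding sum_list_append[symmetric] by (simp add: sum_list_decreasing)
  ultimately show ?thesis by (simp add: algebra_simps)
qed

text \<open>For integrality, the excess of the projection diagonal \<open>q\<close> is that of
  \<open>d\<close> minus the sum of \<open>l\<close>, because each eigenvector distributes total
  weight 1 over \<open>J0\<close> and its complement. For the inequalities, the tent is estimated by
  its rising branch on \<open>J\<close> and by its falling branch off \<open>J\<close>; the
  projection part is dropped by means of \<open>q0\<close> and \<open>q1\<close>.\<close>

theorem Lambda_necessary:
  fixes l :: "real list" and I :: "'i set"
  assumes lam: "l \<in> Lambda TYPE('h::chilbert_space) I d N" and J0: "split_set I d J0"
  shows "sum_list l - excess I d J0 \<in> \<int>" "feasible I d l"
proof -
  define A where "A = Sigma (set l) (\<lambda>t. {..<count_list l t})"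
  obtain e :: "'i \<Rightarrow> 'h" and Q :: "'h \<Rightarrow> 'h" and \<beta> :: "'i \<Rightarrow> real \<times> nat \<Rightarrow> real" and q :: "'i \<Rightarrow> real"
    where onb: "is_onb I e" and proj: "orthogonal_projection Q"
      and q: "\<And>i. i \<in> I \<Longrightarrow> cinner (Q (e i)) (e i) = complex_of_real (q i)"
      and d: "\<And>i. i \<in> I \<Longrightarrow> d i = q i + (\<Sum>a\<in>A. fst a * \<beta> i a)"
      and \<beta>: "\<And>i a. 0 \<le> \<beta> i a" "\<And>a. a \<in> A \<Longrightarrow> ((\<lambda>i. \<beta> i a) has_sum 1) I"
      and q0: "\<And>i. 0 \<le> q i" and q1: "\<And>i. i \<in> I \<Longrightarrow> q i + (\<Sum>a\<in>A. \<beta> i a) \<le> 1"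
    by (rule Lambda_decomposition[OF lam, folded A_def]) blast
  have l01: "0 < fst a" "fst a < 1" if "a \<in> A" for a
  proof -
    have "set l \<subseteq> {0<..<1}" using lam by (simp add: Lambda_def open_cube_def)
    moreover have "fst a \<in> set l" using that by (auto simp: A_def)
    ultimately show "0 < fst a" "fst a < 1" by auto
  qed
  have sumA: "(\<Sum>a\<in>A. f (fst a)) = sum_list (map f l)" for f :: "real \<Rightarrow> real"
    unfolding A_def by (rule sum_eigenvalue_pairs)
  have split: "\<exists>S T. (\<forall>a\<in>A. ((\<lambda>i. \<beta> i a) has_sum S a) J \<and> ((\<lambda>i. \<beta> i a) has_sum T a) (I - J) \<and> S a + T a = 1)"
    if "J \<subseteq> I" for J
  proof (intro exI ballI conjI)
    fix a assume a: "a \<in> A"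
    have s: "(\<lambda>i. \<beta> i a) summable_on I" using \<beta>(2)[OF a] by (rule has_sum_imp_summable)
    show 1: "((\<lambda>i. \<beta> i a) has_sum infsum (\<lambda>i. \<beta> i a) J) J"
      by (rule has_sum_infsum) (rule summable_on_subset[OF s that])
    show 2: "((\<lambda>i. \<beta> i a) has_sum infsum (\<lambda>i. \<beta> i a) (I - J)) (I - J)"
      by (rule has_sum_infsum) (rule summable_on_subset[OF s], auto)
    have "J \<union> (I - J) = I" using that by auto
    then show "infsum (\<lambda>i. \<beta> i a) J + infsum (\<lambda>i. \<beta> i a) (I - J) = 1"
      using has_sum_unique[OF has_sum_Un_disjoint[OF 1 2] ] \<beta>(2)[OF a] by auto
  qed
  show "sum_list l - excess I d J0 \<in> \<int>"
  proof -
    have JI: "J0 \<subseteq> I" using J0 by (simp add: split_set_def)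
    obtain S T where ST: "\<And>a. a \<in> A \<Longrightarrow> ((\<lambda>i. \<beta> i a) has_sum S a) J0"
      "\<And>a. a \<in> A \<Longrightarrow> ((\<lambda>i. \<beta> i a) has_sum T a) (I - J0)" "\<And>a. a \<in> A \<Longrightarrow> S a + T a = 1"
      using split[OF JI] by blast
    have "((\<lambda>i. d i + - (\<Sum>a\<in>A. fst a * \<beta> i a)) has_sum (infsum d J0 + - (\<Sum>a\<in>A. fst a * S a))) J0"
      using J0 by (intro has_sum_add has_sum_uminusI has_sum_sum has_sum_cmult_right ST has_sum_infsum)
        (auto simp: split_set_def)
    then have "((\<lambda>i. d i - (\<Sum>a\<in>A. fst a * \<beta> i a)) has_sum (infsum d J0 - (\<Sum>a\<in>A. fst a * S a))) J0"
      by simp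
    then have qJ: "(q has_sum (infsum d J0 - (\<Sum>a\<in>A. fst a * S a))) J0"
      by (rule has_sum_cong[THEN iffD1, rotated]) (use d JI in auto)
    have "((\<lambda>i. (1 - d i) + (\<Sum>a\<in>A. fst a * \<beta> i a)) has_sum
        (infsum (\<lambda>i. 1 - d i) (I - J0) + (\<Sum>a\<in>A. fst a * T a))) (I - J0)"
      using J0 by (intro has_sum_add has_sum_sum has_sum_cmult_right ST has_sum_infsum)
        (auto simp: split_set_def)
    then have qK: "((\<lambda>i. 1 - q i) has_sum (infsum (\<lambda>i. 1 - d i) (I - J0) + (\<Sum>a\<in>A. fst a * T a))) (I - J0)"
      by (rule has_sum_cong[THEN iffD1, rotated]) (use d in auto)
    have "split_set I q J0"
      using JI has_sum_imp_summable[OF qJ] has_sum_imp_summable[OF qK] by (simp add: split_set_def)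
    then have "excess I q J0 \<in> \<int>" using projection_excess_integer[OF onb proj] q by blast
    moreover have "excess I q J0 = excess I d J0 - sum_list l"
    proof -
      have "(\<Sum>a\<in>A. fst a * S a) + (\<Sum>a\<in>A. fst a * T a) = (\<Sum>a\<in>A. fst a * (S a + T a))"
        by (simp add: sum.distrib ring_distribs)
      also have "\<dots> = (\<Sum>a\<in>A. fst a)" using ST(3) by (intro sum.cong) auto
      also have "\<dots> = sum_list l" using sumA[of "\<lambda>x. x"] by simp
      finally show ?thesis by (simp add: excess_def infsumI[OF qJ] infsumI[OF qK])
    qed
    ultimately show ?thesis by (metis Ints_minus minus_diff_eq)
  qed
  show "feasible I d l"
    unfolding feasible_def
  proof (intro allI impI)
    fix J n assume J: "split_set I d J" and n: "n \<le> length l" and ex: "excess I d J = sum_list l - real n"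
    have JI: "J \<subseteq> I" using J by (simp add: split_set_def)
    obtain S T where ST: "\<And>a. a \<in> A \<Longrightarrow> ((\<lambda>i. \<beta> i a) has_sum S a) J"
      "\<And>a. a \<in> A \<Longrightarrow> ((\<lambda>i. \<beta> i a) has_sum T a) (I - J)" "\<And>a. a \<in> A \<Longrightarrow> S a + T a = 1"
      using split[OF JI] by blast
    define X Y where "X = infsum d J" and "Y = infsum (\<lambda>i. 1 - d i) (I - J)"
    have hX: "(d has_sum X) J" and hY: "((\<lambda>i. 1 - d i) has_sum Y) (I - J)"
      using J by (auto simp: split_set_def X_def Y_def)
    have XY: "X - Y = sum_list l - real n" using ex by (simp add: excess_def X_def Y_def)
    have d1: "(\<Sum>a\<in>A. \<beta> i a * (1 - fst a)) \<le> 1 - d i" if "i \<in> I" for i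
      using q1[OF that] d[OF that] by (simp add: sum_subtractf algebra_simps)
    have d0: "(\<Sum>a\<in>A. \<beta> i a * fst a) \<le> d i" if "i \<in> I" for i
      using q0[of i] d[OF that] by (simp add: mult.commute)
    have dpos: "0 \<le> 1 - d i" if "i \<in> I" for i
    proof -
      have "0 \<le> (\<Sum>a\<in>A. \<beta> i a * (1 - fst a))"
        using \<beta>(1) l01 by (intro sum_nonneg mult_nonneg_nonneg) (auto simp: less_imp_le)
      then show ?thesis using d1[OF that] by simp
    qed
    show "sum_list l - infsum d J \<le> sum_list (take n (decreasing l))"
    proof (cases "n = 0")
      \<comment> \<open>Without an \<open>n\<close>-th largest entry there is no threshold
        \<open>t\<close>; the claim is then just that \<open>1 - d\<close> has a nonnegative sum off
        \<open>J\<close>.\<close>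
      case True
      have "0 \<le> Y" using hY dpos by (rule has_sum_nonneg) auto
      then show ?thesis using True XY by (simp add: X_def)
    next
      case False
      define t where "t = decreasing l ! (n - 1)"
      have "t \<in> set (decreasing l)" unfolding t_def using False n by (intro nth_mem) simp
      moreover have "set l \<subseteq> {0<..<1}" using lam by (simp add: Lambda_def open_cube_def)
      ultimately have t: "0 < t" "t < 1" by auto
      define g where "g x = min ((1 - t) * x) (t * (1 - x))" for x
      have "(\<Sum>a\<in>A. g (fst a) * S a) \<le> (1 - t) * X"
      proof (rule has_sum_mono)
        show "((\<lambda>i. \<Sum>a\<in>A. g (fst a) * \<beta> i a) has_sum (\<Sum>a\<in>A. g (fst a) * S a)) J"
          by (intro has_sum_sum has_sum_cmult_right ST)
        show "((\<lambda>i. (1 - t) * d i) has_sum (1 - t) * X) J" by (intro has_sum_cmult_right hX)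
        fix i assume i: "i \<in> J"
        have "(\<Sum>a\<in>A. g (fst a) * \<beta> i a) \<le> (\<Sum>a\<in>A. ((1 - t) * fst a) * \<beta> i a)"
          using \<beta>(1) by (intro sum_mono mult_right_mono) (auto simp: g_def)
        also have "\<dots> = (1 - t) * (\<Sum>a\<in>A. \<beta> i a * fst a)" by (simp add: sum_distrib_left ac_simps)
        also have "\<dots> \<le> (1 - t) * d i" using d0[of i] i JI t by (intro mult_left_mono) auto
        finally show "(\<Sum>a\<in>A. g (fst a) * \<beta> i a) \<le> (1 - t) * d i" .
      qed
      moreover have "(\<Sum>a\<in>A. g (fst a) * T a) \<le> t * Y"
      proof (rule has_sum_mono)
        show "((\<lambda>i. \<Sum>a\<in>A. g (fst a) * \<beta> i a) has_sum (\<Sum>a\<in>A. g (fst a) * T a)) (I - J)"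
          by (intro has_sum_sum has_sum_cmult_right ST)
        show "((\<lambda>i. t * (1 - d i)) has_sum t * Y) (I - J)" by (intro has_sum_cmult_right hY)
        fix i assume i: "i \<in> I - J"
        have "(\<Sum>a\<in>A. g (fst a) * \<beta> i a) \<le> (\<Sum>a\<in>A. (t * (1 - fst a)) * \<beta> i a)"
          using \<beta>(1) by (intro sum_mono mult_right_mono) (auto simp: g_def)
        also have "\<dots> = t * (\<Sum>a\<in>A. \<beta> i a * (1 - fst a))" by (simp add: sum_distrib_left ac_simps)
        also have "\<dots> \<le> t * (1 - d i)" using d1[of i] i t by (intro mult_left_mono) auto
        finally show "(\<Sum>a\<in>A. g (fst a) * \<beta> i a) \<le> t * (1 - d i)" .
      qed
      moreover have "(\<Sum>a\<in>A. g (fst a) * S a) + (\<Sum>a\<in>A. g (fst a) * T a) = (\<Sum>a\<in>A. g (fst a))"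
      proof -
        have "(\<Sum>a\<in>A. g (fst a) * S a) + (\<Sum>a\<in>A. g (fst a) * T a) = (\<Sum>a\<in>A. g (fst a) * (S a + T a))"
          by (simp add: sum.distrib ring_distribs)
        also have "\<dots> = (\<Sum>a\<in>A. g (fst a))" using ST(3) by (intro sum.cong) auto
        finally show ?thesis .
      qed
      moreover have "(\<Sum>a\<in>A. g (fst a)) = t * real n + (1 - t) * sum_list l - sum_list (take n (decreasing l))"
        unfolding sumA[of g] unfolding g_def t_def using False n by (intro tent_sum_decreasing) auto
      ultimately have "t * real n + (1 - t) * sum_list l - sum_list (take n (decreasing l)) \<le> (1 - t) * X + t * Y"
        by simp
      \<comment> \<open>Eliminating \<open>Y\<close> cancels every term containing \<open>t\<close>,
        so the bound no longer depends on the threshold.\<close>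
      moreover have "Y = X - sum_list l + real n" using XY by simp
      ultimately show ?thesis by (simp add: X_def algebra_simps)
    qed
  qed
qed

section \<open>Majorization\<close>

abbreviation top_sum :: "nat \<Rightarrow> real list \<Rightarrow> real" where
  "top_sum n l \<equiv> sum_list (take n (decreasing l))"

lemma top_sum_Suc: "n < length l \<Longrightarrow> top_sum (Suc n) l = top_sum n l + decreasing l ! n"
  by (simp add: take_Suc_conv_app_nth)

lemma top_sum_length: "top_sum (length l) l = sum_list l"
  by (simp add: sum_list_decreasing)

lemma majorized_iff_top_sum:
  "l \<preceq>\<^sub>m m \<longleftrightarrow> length l = length m \<and> sum_list l = sum_list m \<and> (\<forall>n\<le>length l. top_sum n l \<le> top_sum n m)"
proof -
  have "(\<forall>n\<in>{1..length l}. top_sum n l \<le> top_sum n m) \<longleftrightarrow> (\<forall>n\<le>length l. top_sum n l \<le> top_sum n m)"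
  proof (intro iffI allI impI ballI)
    fix n assume *: "\<forall>n\<in>{1..length l}. top_sum n l \<le> top_sum n m" and n: "n \<le> length l"
    show "top_sum n l \<le> top_sum n m" using * n by (cases "n = 0") auto
  qed auto
  then show ?thesis by (simp add: majorized_def sum_list_decreasing)
qed

lemma majorized_refl: "l \<preceq>\<^sub>m l"
  by (simp add: majorized_def)

lemma majorized_antisym:
  assumes "l \<preceq>\<^sub>m m" "m \<preceq>\<^sub>m l"
  shows "decreasing l = decreasing m"
proof (rule nth_equalityI)
  have len: "length l = length m" using assms by (simp add: majorized_def)
  have eq: "top_sum n l = top_sum n m" if "n \<le> length l" for n
    using assms that by (auto simp: majorized_iff_top_sum intro: antisym)
  show "length (decreasing l) = length (decreasing m)" using len by simp
  fix n assume "n < length (decreasing l)"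
  then show "decreasing l ! n = decreasing m ! n"
    using eq[of n] eq[of "Suc n"] top_sum_Suc[of n l] top_sum_Suc[of n m] len by simp
qed

lemma decreasing_eq: "sorted_wrt (\<ge>) l \<Longrightarrow> decreasing l = (l :: real list)"
proof -
  assume "sorted_wrt (\<ge>) l"
  then have "sort l = rev l" by (intro properties_for_sort) (auto simp: sorted_wrt_rev)
  then show ?thesis by (simp add: decreasing_def)
qed

lemma decreasing_nth_mono: "i \<le> j \<Longrightarrow> j < length l \<Longrightarrow> decreasing l ! j \<le> decreasing l ! i"
  using sorted_wrt_nth_less[OF sorted_decreasing, of i j l] by (cases "i = j") auto

definition increments :: "(nat \<Rightarrow> real) \<Rightarrow> nat \<Rightarrow> real list" where
  "increments S N = map (\<lambda>n. S (Suc n) - S n) [0..<N]"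

lemma increments_concave:
  assumes S0: "S 0 = 0" and conc: "\<And>n. Suc (Suc n) \<le> N \<Longrightarrow> S (Suc (Suc n)) + S n \<le> 2 * S (Suc n)"
  shows "length (increments S N) = N" "n \<le> N \<Longrightarrow> top_sum n (increments S N) = S n"
    "sum_list (increments S N) = S N"
    "1 \<le> N \<Longrightarrow> S 1 < 1 \<Longrightarrow> S (N - 1) < S N \<Longrightarrow> increments S N \<in> open_cube N"
proof -
  let ?l = "increments S N"
  show len: "length ?l = N" by (simp add: increments_def)
  have step: "?l ! Suc n \<le> ?l ! n" if "Suc n < N" for n
    using conc[of n] that by (simp add: increments_def)
  have mono: "?l ! j \<le> ?l ! i" if "i \<le> j" "j < N" for i j
    using that
  proof (induction rule: dec_induct)
    case (step n)
    then show ?case using \<open>\<And>n. Suc n < N \<Longrightarrow> ?l ! Suc n \<le> ?l ! n\<close>[of n] by simp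
  qed simp
  have "sorted_wrt (\<ge>) ?l" unfolding sorted_wrt_iff_nth_less using mono len by simp
  then have dec: "decreasing ?l = ?l" by (rule decreasing_eq)
  show top: "top_sum n ?l = S n" if "n \<le> N" for n
    using that
  proof (induction n)
    case (Suc n)
    then show ?case using top_sum_Suc[of n ?l] len by (simp add: dec) (simp add: increments_def)
  qed (simp add: S0)
  show "sum_list ?l = S N" using top_sum_length[of ?l] top[of N] len by simp
  show "?l \<in> open_cube N" if "1 \<le> N" "S 1 < 1" "S (N - 1) < S N"
  proof -
    have "?l ! 0 < 1" "0 < ?l ! (N - 1)" using that S0 by (simp_all add: increments_def)
    have "?l ! n \<in> {0<..<1}" if "n < N" for n
    proof -
      have "n \<le> N - 1" using that by simp
      then show ?thesis
        using \<open>?l ! 0 < 1\<close> \<open>0 < ?l ! (N - 1)\<close> mono[of 0 n] mono[of n "N - 1"] that by simp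
    qed
    then show ?thesis using len by (auto simp: open_cube_def in_set_conv_nth)
  qed
qed

text \<open>
  The witness is close to the vector with entries \<open>1, \<dots>, 1, s - \<lfloor>s\<rfloor>, 0, \<dots>, 0\<close>, whose partial sums
  are \<open>min n s\<close>.
\<close>

lemma bounded_partial_sums_witness:
  fixes M :: "nat \<Rightarrow> real" and s :: real
  assumes N: "1 \<le> N" and s: "0 < s" "s < real N" and M: "\<And>n. 0 < n \<Longrightarrow> n < N \<Longrightarrow> M n < min (real n) s"
  obtains l where "l \<in> open_cube N" "sum_list l = s" "\<And>n. 0 < n \<Longrightarrow> n < N \<Longrightarrow> M n \<le> top_sum n l"
proof -
  \<comment> \<open>Each member of \<open>W\<close> bounds \<epsilon> for one purpose: 1/2 orders
    the slopes \<epsilon> and \<open>1 - \<epsilon>\<close>, the next two give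
    \<open>S 0 = 0\<close> and \<open>S N = s\<close>, and the remaining ones give
    \<open>M n \<le> S n\<close>.\<close>
  define W where "W = {1/2, s / real N, (real N - s) / real N} \<union> (\<lambda>n. (min (real n) s - M n) / real N) ` {1..<N}"
  define \<epsilon> where "\<epsilon> = Min W"
  have W: "finite W" "W \<noteq> {}" by (auto simp: W_def)
  have pos: "0 < \<epsilon>"
    unfolding \<epsilon>_def using W N s M by (subst Min_gr_iff) (auto simp: W_def)
  have le: "\<epsilon> \<le> w" if "w \<in> W" for w unfolding \<epsilon>_def using W that by simp
  have e: "\<epsilon> \<le> 1/2" "\<epsilon> * real N \<le> s" "\<epsilon> * real N \<le> real N - s"
    using le[of "1/2"] le[of "s / real N"] le[of "(real N - s) / real N"] N by (auto simp: W_def field_simps)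
  have eM: "\<epsilon> * real N \<le> min (real n) s - M n" if "0 < n" "n < N" for n
  proof -
    have "(min (real n) s - M n) / real N \<in> W" using that by (auto simp: W_def)
    from le[OF this] show ?thesis using N by (simp add: pos_le_divide_eq)
  qed
  \<comment> \<open>A minimum of two affine functions, hence concave, with increments between
    \<epsilon> and \<open>1 - \<epsilon>\<close>; it is within \<open>N * \<epsilon>\<close> of
    \<open>min n s\<close>.\<close>
  define S where "S n = min (real n * (1 - \<epsilon>)) (s - (real N - real n) * \<epsilon>)" for n
  have S0: "S 0 = 0" using e by (simp add: S_def mult.commute)
  have SN: "S N = s" using e by (simp add: S_def algebra_simps)
  have inc: "S (Suc n) \<le> S n + (1 - \<epsilon>)" "S n + \<epsilon> \<le> S (Suc n)" for n
    using e(1) by (auto simp: S_def min_def algebra_simps)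
  have conc: "S (Suc (Suc n)) + S n \<le> 2 * S (Suc n)" for n
    by (auto simp: S_def min_def algebra_simps)
  note inc_l = increments_concave[of S N, OF S0 conc]
  show thesis
  proof (rule that[of "increments S N"])
    have "S (N - 1) < S N" using inc(2)[of "N - 1"] N pos by simp
    then show "increments S N \<in> open_cube N" using inc_l(4) inc(1)[of 0] S0 N pos by simp
    show "sum_list (increments S N) = s" using inc_l(3) SN by simp
    show "M n \<le> top_sum n (increments S N)" if n: "0 < n" "n < N" for n
    proof -
      have "real n * \<epsilon> \<le> real N * \<epsilon>" "(real N - real n) * \<epsilon> \<le> real N * \<epsilon>"
        using n pos by (auto intro!: mult_right_mono)
      then have "M n \<le> S n" using eM[OF n] by (auto simp: S_def algebra_simps)
      then show ?thesis using inc_l(2)[of n] n by simp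
    qed
  qed
qed

text \<open>
  The partial sums of \<open>\<mu>\<close> are the infima of the partial sums over all admissible lists: an infimum of
  concave sequences is concave.
\<close>

theorem least_list_above_bounds:
  fixes Y :: "nat \<Rightarrow> real set" and s :: real
  assumes N: "1 \<le> N" and s: "0 < s" "s < real N"
    and Y0: "\<And>y. y \<in> Y 0 \<Longrightarrow> y \<le> 0" and YN: "\<And>y. y \<in> Y N \<Longrightarrow> y \<le> s"
    and Y: "\<And>n. 0 < n \<Longrightarrow> n < N \<Longrightarrow> \<exists>M < min (real n) s. \<forall>y\<in>Y n. y \<le> M"
  obtains \<mu> where "\<mu> \<in> open_cube N" "sum_list \<mu> = s"
    "\<forall>l\<in>open_cube N. sum_list l = s \<longrightarrow> ((\<forall>n\<le>N. \<forall>y\<in>Y n. y \<le> top_sum n l) \<longleftrightarrow> \<mu> \<preceq>\<^sub>m l)"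
proof -
  define A where "A = {l \<in> open_cube N. sum_list l = s \<and> (\<forall>n\<le>N. \<forall>y\<in>Y n. y \<le> top_sum n l)}"
  obtain M where M: "\<And>n. 0 < n \<Longrightarrow> n < N \<Longrightarrow> M n < min (real n) s \<and> (\<forall>y\<in>Y n. y \<le> M n)"
    using Y by metis
  obtain l0 where l0: "l0 \<in> open_cube N" "sum_list l0 = s" "\<And>n. 0 < n \<Longrightarrow> n < N \<Longrightarrow> M n \<le> top_sum n l0"
    using bounded_partial_sums_witness[OF N s, of M] M by blast
  have lenA: "length l = N" if "l \<in> open_cube N" for l using that by (simp add: open_cube_def)
  have topN: "top_sum N l = s" if "l \<in> open_cube N" "sum_list l = s" for l
    using top_sum_length[of l] lenA[OF that(1)] that(2) by simp
  have "y \<le> top_sum n l0" if "n \<le> N" "y \<in> Y n" for n y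
  proof -
    consider "n = 0" | "n = N" | "0 < n" "n < N" using \<open>n \<le> N\<close> by linarith
    then show ?thesis
    proof cases
      case 2 then show ?thesis using YN that topN[OF l0(1,2)] by simp
    next
      case 3 then show ?thesis using M[of n] l0(3)[of n] that by fastforce
    qed (use Y0 that in simp)
  qed
  then have l0A: "l0 \<in> A" using l0 by (simp add: A_def)
  have ent: "0 < decreasing l ! n" "decreasing l ! n < 1" if "l \<in> open_cube N" "n < N" for l n
  proof -
    have "decreasing l ! n \<in> set (decreasing l)" using that lenA by (intro nth_mem) simp
    then show "0 < decreasing l ! n" "decreasing l ! n < 1" using that by (auto simp: open_cube_def)
  qed
  define S where "S n = Inf ((\<lambda>l. top_sum n l) ` A)" for n
  have bdd: "bdd_below ((\<lambda>l. top_sum n l) ` A)" for n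
  proof (rule bdd_belowI2[where m=0])
    fix l assume "l \<in> A"
    then show "0 \<le> top_sum n l"
      by (intro sum_list_nonneg) (auto simp: A_def open_cube_def dest!: in_set_takeD)
  qed
  have S_le: "S n \<le> top_sum n l" if "l \<in> A" for n l
    unfolding S_def using bdd that by (intro cInf_lower) auto
  have S_ge: "c \<le> S n" if "\<And>l. l \<in> A \<Longrightarrow> c \<le> top_sum n l" for c n
    unfolding S_def using that l0A by (intro cInf_greatest) auto
  have S0: "S 0 = 0" using S_le[OF l0A, of 0] S_ge[of 0 0] by simp
  have SN: "S N = s"
    using S_le[OF l0A, of N] S_ge[of s N] topN l0 by (fastforce simp: A_def)
  have conc: "S (Suc (Suc n)) + S n \<le> 2 * S (Suc n)" if n: "Suc (Suc n) \<le> N" for n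
  proof -
    have "(S (Suc (Suc n)) + S n) / 2 \<le> top_sum (Suc n) l" if l: "l \<in> A" for l
    proof -
      have len: "length l = N" using l lenA by (simp add: A_def)
      have "top_sum (Suc (Suc n)) l + top_sum n l \<le> 2 * top_sum (Suc n) l"
        using top_sum_Suc[of n l] top_sum_Suc[of "Suc n" l] decreasing_nth_mono[of n "Suc n" l] n len by simp
      then show ?thesis using S_le[OF l, of n] S_le[OF l, of "Suc (Suc n)"] by simp
    qed
    from S_ge[OF this] show ?thesis by simp
  qed
  note inc = increments_concave[of S N, OF S0 conc]
  \<comment> \<open>An infimum could lose strictness, but only upper bounds on \<open>S 1\<close>
    and \<open>S (N - 1)\<close> are needed, and the single list \<open>l0\<close> provides
    both.\<close>
  have "S 1 < 1"
    using S_le[OF l0A, of 1] top_sum_Suc[of 0 l0] ent(2)[OF l0(1), of 0] lenA[OF l0(1)] N by simp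
  moreover have "S (N - 1) < S N"
  proof -
    have "top_sum N l0 = top_sum (N - 1) l0 + decreasing l0 ! (N - 1)"
      using top_sum_Suc[of "N - 1" l0] lenA[OF l0(1)] N by simp
    then show ?thesis
      using S_le[OF l0A, of "N - 1"] SN topN[OF l0(1,2)] ent(1)[OF l0(1), of "N - 1"] N by simp
  qed
  ultimately have cube: "increments S N \<in> open_cube N" using inc(4) N by simp
  show thesis
  proof (rule that[OF cube], goal_cases)
    case 1
    show ?case using inc(3) SN by simp
  next
    case 2
    show ?case
    proof (intro ballI impI)
      fix l assume l: "l \<in> open_cube N" "sum_list l = s"
      have maj: "increments S N \<preceq>\<^sub>m l \<longleftrightarrow> (\<forall>n\<le>N. S n \<le> top_sum n l)"
        unfolding majorized_iff_top_sum using inc(1-3) SN l lenA by auto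
      show "(\<forall>n\<le>N. \<forall>y\<in>Y n. y \<le> top_sum n l) \<longleftrightarrow> increments S N \<preceq>\<^sub>m l"
        unfolding maj
      proof
        assume "\<forall>n\<le>N. \<forall>y\<in>Y n. y \<le> top_sum n l"
        then have "l \<in> A" using l by (simp add: A_def)
        then show "\<forall>n\<le>N. S n \<le> top_sum n l" using S_le by blast
      next
        assume *: "\<forall>n\<le>N. S n \<le> top_sum n l"
        show "\<forall>n\<le>N. \<forall>y\<in>Y n. y \<le> top_sum n l"
        proof (intro allI impI ballI)
          fix n y assume n: "n \<le> N" "y \<in> Y n"
          have "y \<le> S n" by (rule S_ge) (use n in \<open>auto simp: A_def\<close>)
          then show "y \<le> top_sum n l" using * n by (meson order_trans)
        qed
      qed
    qed
  qed
qed

section \<open>Structure of the set of eigenvalue lists\<close>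

lemma finite_large_values:
  fixes f :: "'i \<Rightarrow> real"
  assumes sm: "f summable_on X" and nn: "\<And>i. i \<in> X \<Longrightarrow> 0 \<le> f i" and c: "0 < c"
  shows "finite {i \<in> X. c \<le> f i}"
proof (rule ccontr)
  assume "infinite {i \<in> X. c \<le> f i}"
  then obtain F where F: "finite F" "card F = nat \<lceil>infsum f X / c\<rceil> + 1" "F \<subseteq> {i \<in> X. c \<le> f i}"
    using infinite_arbitrarily_large by blast
  have "real (card F) * c \<le> sum f F"
    using F(3) by (intro sum_bounded_below) auto
  also have "\<dots> \<le> infsum f X"
    by (rule finite_sum_le_infsum[OF sm F(1)]) (use F(3) nn in auto)
  finally have "real (card F) \<le> infsum f X / c" using c by (simp add: pos_le_divide_eq)
  also have "\<dots> < real (card F)" unfolding F(2) by linarith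
  finally show False by simp
qed

text \<open>Moving the threshold changes the splitting at finitely many indices only, because a
  summable nonnegative family has finitely many terms above a positive constant. The given threshold
  can thus be replaced by 1/2.\<close>

lemma split_set_change_threshold:
  fixes d :: "'i \<Rightarrow> real"
  assumes d01: "\<And>i. i \<in> I \<Longrightarrow> 0 \<le> d i \<and> d i \<le> 1" and ab: "0 < \<alpha>" "\<alpha> < 1" "0 < \<beta>" "\<beta> < 1"
    and sp: "split_set I d {i \<in> I. d i < \<alpha>}"
  shows "split_set I d {i \<in> I. d i < \<beta>}"
proof -
  let ?J = "{i \<in> I. d i < \<alpha>}"
  define G H where "G = {i \<in> ?J. \<beta> \<le> d i}" and "H = {i \<in> I - ?J. 1 - \<beta> < 1 - d i}"
  have sm: "d summable_on ?J" "(\<lambda>i. 1 - d i) summable_on (I - ?J)" using sp by (auto simp: split_set_def)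
  have G: "finite G" "G \<subseteq> ?J"
    unfolding G_def using finite_large_values[OF sm(1), of \<beta>] d01 ab by auto
  have "finite {i \<in> I - ?J. 1 - \<beta> \<le> 1 - d i}"
    using finite_large_values[OF sm(2), of "1 - \<beta>"] d01 ab by auto
  then have H: "finite H" unfolding H_def by (rule rev_finite_subset) auto
  have "split_set I d (?J - G)" using split_set_Diff[OF sp G] by simp
  then have "split_set I d ((?J - G) \<union> H)"
    using split_set_Un[of I d "?J - G" H] H by (auto simp: H_def)
  moreover have "(?J - G) \<union> H = {i \<in> I. d i < \<beta>}" by (auto simp: G_def H_def)
  ultimately show ?thesis by simp
qed

text \<open>If the sum over \<open>J\<close> were below \<epsilon>, then \<open>J\<close> would miss
  all of \<open>F\<close>, and each index of \<open>F\<close> would add at least 1/2 to the sum of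
  \<open>1 - d\<close> off \<open>J\<close>. The size of \<open>F\<close> is chosen so that this
  pushes the excess below \<open>c\<close>. The bound is uniform in \<open>J\<close>, which is what
  keeps an infimum over all splittings strictly positive.\<close>

lemma split_sum_lower_bound:
  fixes d :: "'i \<Rightarrow> real"
  assumes d01: "\<And>i. i \<in> I \<Longrightarrow> 0 \<le> d i \<and> d i \<le> 1" and inf: "infinite {i \<in> I. 0 < d i \<and> d i \<le> 1/2}"
  obtains \<epsilon> where "0 < \<epsilon>" "\<And>J. split_set I d J \<Longrightarrow> excess I d J = c \<Longrightarrow> \<epsilon> \<le> infsum d J"
proof -
  obtain F where F: "finite F" "card F = nat \<lceil>2 * (1 + \<bar>c\<bar>)\<rceil>" "F \<subseteq> {i \<in> I. 0 < d i \<and> d i \<le> 1/2}"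
    using infinite_arbitrarily_large[OF inf] by blast
  define \<epsilon> where "\<epsilon> = Min (insert 1 (d ` F))"
  have pos: "0 < \<epsilon>" unfolding \<epsilon>_def using F by (subst Min_gr_iff) auto
  have le: "\<epsilon> \<le> v" if "v \<in> insert 1 (d ` F)" for v unfolding \<epsilon>_def using F(1) that by (intro Min_le) auto
  have "\<epsilon> \<le> infsum d J" if J: "split_set I d J" and ex: "excess I d J = c" for J
  proof (rule ccontr)
    assume "\<not> \<epsilon> \<le> infsum d J"
    then have lt: "infsum d J < \<epsilon>" by simp
    have JI: "J \<subseteq> I" and sm: "d summable_on J" "(\<lambda>i. 1 - d i) summable_on (I - J)"
      using J by (auto simp: split_set_def)
    have "i \<notin> J" if "i \<in> F" for i
    proof
      assume "i \<in> J"
      have "sum d {i} \<le> infsum d J"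
        by (rule finite_sum_le_infsum[OF sm(1)]) (use \<open>i \<in> J\<close> JI d01 in auto)
      then show False using le[of "d i"] that lt by simp
    qed
    then have FI: "F \<subseteq> I - J" using F(3) by auto
    have "real (card F) * (1/2) \<le> (\<Sum>i\<in>F. 1 - d i)"
      using F(3) by (intro sum_bounded_below) auto
    also have "\<dots> \<le> infsum (\<lambda>i. 1 - d i) (I - J)"
      by (rule finite_sum_le_infsum[OF sm(2) F(1) FI]) (use d01 in auto)
    also have "\<dots> = infsum d J - c" using ex by (simp add: excess_def)
    also have "\<dots> < 1 - c" using lt le[of 1] by simp
    finally have "real (card F) < 2 * (1 + \<bar>c\<bar>)" by simp
    moreover have "2 * (1 + \<bar>c\<bar>) \<le> real (card F)" unfolding F(2) by linarith
    ultimately show False by simp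
  qed
  then show thesis using that pos by blast
qed

text \<open>For \<open>0 < n < N\<close> the constraints must stay uniformly below both
  \<open>s\<close> and \<open>n\<close>. Each has the two forms \<open>s - infsum d J\<close> and
  \<open>n\<close> minus the complementary sum, so the uniform lower bound is applied once to
  \<open>d\<close> and once to \<open>1 - d\<close>.\<close>

lemma least_feasible_list:
  fixes d :: "'i \<Rightarrow> real"
  assumes d01_all: "\<forall>i\<in>I. 0 \<le> d i \<and> d i \<le> 1"
    and infL: "infinite {i \<in> I. 0 < d i \<and> d i < 1/2}" and infU: "infinite {i \<in> I. 1/2 \<le> d i \<and> d i < 1}"
    and N: "1 \<le> N" and s: "0 < s" "s < real N"
  obtains \<mu> where "\<mu> \<in> open_cube N" "sum_list \<mu> = s"
    "\<forall>l\<in>open_cube N. sum_list l = s \<longrightarrow> (feasible I d l \<longleftrightarrow> \<mu> \<preceq>\<^sub>m l)"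
proof -
  have d01: "0 \<le> d i \<and> d i \<le> 1" if "i \<in> I" for i using d01_all that by blast
  define Y where "Y n = {s - infsum d J |J. split_set I d J \<and> excess I d J = s - real n}" for n
  have inf1: "infinite {i \<in> I. 0 < d i \<and> d i \<le> 1/2}"
    by (rule infinite_super[OF _ infL]) auto
  have inf2: "infinite {i \<in> I. 0 < 1 - d i \<and> 1 - d i \<le> 1/2}"
    by (rule infinite_super[OF _ infU]) auto
  have d01': "0 \<le> 1 - d i \<and> 1 - d i \<le> 1" if "i \<in> I" for i using d01[OF that] by simp
  have nn: "0 \<le> infsum d J" "0 \<le> infsum (\<lambda>i. 1 - d i) (I - J)" if "split_set I d J" for J
    using that d01 by (auto simp: split_set_def intro!: infsum_nonneg)
  obtain \<mu> where \<mu>: "\<mu> \<in> open_cube N" "sum_list \<mu> = s"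
    "\<forall>l\<in>open_cube N. sum_list l = s \<longrightarrow> ((\<forall>n\<le>N. \<forall>y\<in>Y n. y \<le> top_sum n l) \<longleftrightarrow> \<mu> \<preceq>\<^sub>m l)"
  proof (rule least_list_above_bounds[OF N s, of Y])
    show "y \<le> 0" if "y \<in> Y 0" for y
      using that nn(2) by (auto simp: Y_def excess_def)
    show "y \<le> s" if "y \<in> Y N" for y
      using that nn(1) by (auto simp: Y_def)
    fix n assume n: "0 < n" "n < N"
    obtain \<epsilon>1 where \<epsilon>1: "0 < \<epsilon>1" "\<And>J. split_set I d J \<Longrightarrow> excess I d J = s - real n \<Longrightarrow> \<epsilon>1 \<le> infsum d J"
      using split_sum_lower_bound[where I=I and d=d and c="s - real n", OF d01 inf1] by blast
    obtain \<epsilon>2 where \<epsilon>2: "0 < \<epsilon>2" "\<And>J. split_set I (\<lambda>i. 1 - d i) J \<Longrightarrow>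
        excess I (\<lambda>i. 1 - d i) J = real n - s \<Longrightarrow> \<epsilon>2 \<le> infsum (\<lambda>i. 1 - d i) J"
      using split_sum_lower_bound[where I=I and d="\<lambda>i. 1 - d i" and c="real n - s", OF d01' inf2] by blast
    show "\<exists>M < min (real n) s. \<forall>y\<in>Y n. y \<le> M"
    proof (intro exI[of _ "min (real n - \<epsilon>2) (s - \<epsilon>1)"] conjI ballI)
      show "min (real n - \<epsilon>2) (s - \<epsilon>1) < min (real n) s" using \<epsilon>1(1) \<epsilon>2(1) by (auto simp: min_def)
      fix y assume "y \<in> Y n"
      then obtain J where J: "split_set I d J" "excess I d J = s - real n" "y = s - infsum d J"
        by (auto simp: Y_def)
      have "J \<subseteq> I" using J by (simp add: split_set_def)
      then have "\<epsilon>2 \<le> infsum (\<lambda>i. 1 - d i) (I - J)"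
        using \<epsilon>2(2)[OF split_set_complement[OF J(1)]] excess_complement[of J I d] J(2) by simp
      then show "y \<le> min (real n - \<epsilon>2) (s - \<epsilon>1)"
        using \<epsilon>1(2)[OF J(1,2)] J(2,3) by (simp add: excess_def)
    qed
  qed
  have "feasible I d l \<longleftrightarrow> (\<forall>n\<le>N. \<forall>y\<in>Y n. y \<le> top_sum n l)" if "l \<in> open_cube N" "sum_list l = s" for l
    using that by (auto simp: feasible_def Y_def open_cube_def)
  then show thesis using that[OF \<mu>(1,2)] \<mu>(3) by simp
qed

text \<open>Comparable lists have equal sums, and the generators have pairwise different sums, so
  cones over different generators contain no comparable lists. Each cone contributes its generator
  as its only minimal class.\<close>

lemma minimal_classes_Union:
  assumes fin: "finite K" and \<mu>: "\<And>k. k \<in> K \<Longrightarrow> \<mu> k \<in> open_cube N" and inj: "inj_on (\<lambda>k. sum_list (\<mu> k)) K"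
    and A: "A = (\<Union>k\<in>K. {l \<in> open_cube N. \<mu> k \<preceq>\<^sub>m l})"
  shows "finite (minimal_classes A) \<and> card (minimal_classes A) = card K"
proof -
  have \<mu>A: "\<mu> k \<in> A" if "k \<in> K" for k using that \<mu> majorized_refl A by blast
  have sums: "sum_list l = sum_list m" if "l \<preceq>\<^sub>m m" for l m using that by (simp add: majorized_iff_top_sum)
  have eq: "minimal_classes A = (\<lambda>k. decreasing (\<mu> k)) ` K"
  proof
    show "minimal_classes A \<subseteq> (\<lambda>k. decreasing (\<mu> k)) ` K"
    proof
      fix x assume "x \<in> minimal_classes A"
      then obtain l where l: "x = decreasing l" "l \<in> A" "\<And>m. m \<in> A \<Longrightarrow> m \<preceq>\<^sub>m l \<Longrightarrow> decreasing m = decreasing l"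
        by (auto simp: minimal_classes_def)
      then obtain k where "k \<in> K" "\<mu> k \<preceq>\<^sub>m l" using A by blast
      then show "x \<in> (\<lambda>k. decreasing (\<mu> k)) ` K" using l \<mu>A by (metis image_eqI)
    qed
    show "(\<lambda>k. decreasing (\<mu> k)) ` K \<subseteq> minimal_classes A"
    proof
      fix x assume "x \<in> (\<lambda>k. decreasing (\<mu> k)) ` K"
      then obtain k where k: "k \<in> K" "x = decreasing (\<mu> k)" by blast
      have "decreasing m = decreasing (\<mu> k)" if m: "m \<in> A" "m \<preceq>\<^sub>m \<mu> k" for m
      proof -
        obtain j where j: "j \<in> K" "\<mu> j \<preceq>\<^sub>m m" using m(1) A by blast
        then have "j = k" using sums[OF j(2)] sums[OF m(2)] k(1) inj by (auto dest: inj_onD)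
        then show ?thesis using j(2) m(2) majorized_antisym by blast
      qed
      then show "x \<in> minimal_classes A"
        unfolding minimal_classes_def k(2) using \<mu>A[OF k(1)] by blast
    qed
  qed
  have "inj_on (\<lambda>k. decreasing (\<mu> k)) K"
    using inj by (intro inj_onI) (metis inj_onD sum_list_decreasing)
  then show ?thesis using fin by (simp add: eq card_image)
qed

lemma sum_list_open_cube:
  assumes "l \<in> open_cube N" "1 \<le> N"
  shows "0 < sum_list l" "sum_list l < real N"
proof -
  have l: "length l = N" "set l \<subseteq> {0<..<1}" using assms by (auto simp: open_cube_def)
  have "l \<noteq> [] \<Longrightarrow> set l \<subseteq> {0<..<1} \<Longrightarrow> 0 < sum_list l \<and> sum_list l < real (length l)" for l :: "real list"
    by (induction l rule: list_nonempty_induct) auto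
  moreover have "l \<noteq> []" using l(1) assms(2) by auto
  ultimately show "0 < sum_list l" "sum_list l < real N" using l by auto
qed

text \<open>
  The case distinction of the theorem only affects the set \<open>K\<close> of integer parts that sums of points
  of \<open>(0,1)\<^sup>N\<close> congruent to \<open>c\<close> can have.
\<close>

lemma Lambda_structure:
  fixes d :: "'i \<Rightarrow> real"
  assumes d01: "\<And>i. i \<in> I \<Longrightarrow> 0 \<le> d i \<and> d i \<le> 1"
    and infL: "infinite {i \<in> I. 0 < d i \<and> d i < 1/2}" and infU: "infinite {i \<in> I. 1/2 \<le> d i \<and> d i < 1}"
    and N: "1 \<le> N"
    and L: "\<And>l. l \<in> L \<longleftrightarrow> l \<in> open_cube N \<and> sum_list l - c \<in> \<int> \<and> feasible I d l"
    and K: "finite K" "\<And>s. 0 < s \<and> s < real N \<and> s - c \<in> \<int> \<longleftrightarrow> (\<exists>k\<in>K. s = real k + \<eta>)"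
  shows "finite (minimal_classes L) \<and> card (minimal_classes L) = card K \<and>
    (\<exists>\<mu>. (\<forall>k\<in>K. \<mu> k \<in> open_cube N \<and> sum_list (\<mu> k) = real k + \<eta>) \<and>
       L = (\<Union>k\<in>K. {l \<in> open_cube N. \<mu> k \<preceq>\<^sub>m l}))"
proof -
  have all01: "\<forall>i\<in>I. 0 \<le> d i \<and> d i \<le> 1" using d01 by blast
  have "\<exists>\<mu>. \<mu> \<in> open_cube N \<and> sum_list \<mu> = real k + \<eta> \<and>
      (\<forall>l\<in>open_cube N. sum_list l = real k + \<eta> \<longrightarrow> (feasible I d l \<longleftrightarrow> \<mu> \<preceq>\<^sub>m l))" if "k \<in> K" for k
  proof -
    have "0 < real k + \<eta>" "real k + \<eta> < real N" using K(2)[of "real k + \<eta>"] that by auto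
    then show ?thesis using least_feasible_list[OF all01 infL infU N] by metis
  qed
  then obtain \<mu> where \<mu>: "\<And>k. k \<in> K \<Longrightarrow> \<mu> k \<in> open_cube N" "\<And>k. k \<in> K \<Longrightarrow> sum_list (\<mu> k) = real k + \<eta>"
    "\<And>k l. k \<in> K \<Longrightarrow> l \<in> open_cube N \<Longrightarrow> sum_list l = real k + \<eta> \<Longrightarrow> feasible I d l \<longleftrightarrow> \<mu> k \<preceq>\<^sub>m l"
    by metis
  have eq: "L = (\<Union>k\<in>K. {l \<in> open_cube N. \<mu> k \<preceq>\<^sub>m l})"
  proof (intro equalityI subsetI)
    fix l assume "l \<in> L"
    then have l: "l \<in> open_cube N" "sum_list l - c \<in> \<int>" "feasible I d l" by (auto simp: L)
    then obtain k where "k \<in> K" "sum_list l = real k + \<eta>"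
      using K(2)[of "sum_list l"] sum_list_open_cube[OF l(1) N] by blast
    then show "l \<in> (\<Union>k\<in>K. {l \<in> open_cube N. \<mu> k \<preceq>\<^sub>m l})" using \<mu>(3) l by blast
  next
    fix l assume "l \<in> (\<Union>k\<in>K. {l \<in> open_cube N. \<mu> k \<preceq>\<^sub>m l})"
    then obtain k where k: "k \<in> K" "l \<in> open_cube N" "\<mu> k \<preceq>\<^sub>m l" by blast
    then have s: "sum_list l = real k + \<eta>" using \<mu>(2) by (simp add: majorized_iff_top_sum)
    then show "l \<in> L" using L[of l] K(2)[of "sum_list l"] \<mu>(3)[OF k(1,2) s] k by blast
  qed
  have "inj_on (\<lambda>k. sum_list (\<mu> k)) K" using \<mu>(2) by (intro inj_onI) simp
  then show ?thesis using minimal_classes_Union[OF K(1) \<mu>(1) _ eq] \<mu>(1,2) eq by blast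
qed

section \<open>Characterization of \<open>Lambda\<close> and of projection diagonals, and the final
  count\<close>

lemma Lambda_iff:
  fixes d :: "'i \<Rightarrow> real"
  assumes onb: "\<exists>e :: 'i \<Rightarrow> 'h::chilbert_space. is_onb I e" and d01: "\<And>i. i \<in> I \<Longrightarrow> 0 \<le> d i \<and> d i \<le> 1"
    and J0: "split_set I d ({i \<in> I. d i < 1/2})"
    and infL: "infinite {i \<in> I. 0 < d i \<and> d i < 1/2}" and infU: "infinite {i \<in> I. 1/2 \<le> d i \<and> d i < 1}"
  shows "l \<in> Lambda TYPE('h) I d N \<longleftrightarrow> l \<in> open_cube N \<and> sum_list l - excess I d ({i \<in> I. d i < 1/2}) \<in> \<int> \<and> feasible I d l"
proof
  assume l: "l \<in> Lambda TYPE('h) I d N"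
  then have "l \<in> open_cube N" by (simp add: Lambda_def)
  then show "l \<in> open_cube N \<and> sum_list l - excess I d ({i \<in> I. d i < 1/2}) \<in> \<int> \<and> feasible I d l"
    using Lambda_necessary[OF l J0] by blast
next
  assume l: "l \<in> open_cube N \<and> sum_list l - excess I d ({i \<in> I. d i < 1/2}) \<in> \<int> \<and> feasible I d l"
  obtain e :: "'i \<Rightarrow> 'h" where e: "is_onb I e" using onb by blast
  have "set l \<subseteq> {0<..<1}" using l by (simp add: open_cube_def)
  then obtain \<kappa> where \<kappa>: "\<And>i. i \<in> I \<Longrightarrow> 0 \<le> \<kappa> i \<and> \<kappa> i \<le> 1" "finite {i \<in> I. 0 < \<kappa> i \<and> \<kappa> i < 1}"
    "image_mset \<kappa> (mset_set {i \<in> I. 0 < \<kappa> i \<and> \<kappa> i < 1}) = mset l"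
    "has_diagonal (diag_op I e (\<lambda>i. complex_of_real (\<kappa> i))) I d"
    using diagonal_realization[OF e d01 J0 infL infU, of l] l by auto
  then show "l \<in> Lambda TYPE('h) I d N"
    using diag_op_Lambda[OF e \<kappa>(1,2,3) _ \<kappa>(4)] l by blast
qed

text \<open>The realization theorem for the empty list yields a diagonal operator with no eigenvalue
  strictly between 0 and 1, that is, a projection; the converse is Kadison's integrality.\<close>

lemma projection_diagonal_iff:
  fixes d :: "'i \<Rightarrow> real"
  assumes onb: "\<exists>e :: 'i \<Rightarrow> 'h::chilbert_space. is_onb I e" and d01: "\<And>i. i \<in> I \<Longrightarrow> 0 \<le> d i \<and> d i \<le> 1"
    and J0: "split_set I d ({i \<in> I. d i < 1/2})"
    and infL: "infinite {i \<in> I. 0 < d i \<and> d i < 1/2}" and infU: "infinite {i \<in> I. 1/2 \<le> d i \<and> d i < 1}"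
  shows "(\<exists>P :: 'h \<Rightarrow> 'h. orthogonal_projection P \<and> has_diagonal P I d) \<longleftrightarrow> excess I d ({i \<in> I. d i < 1/2}) \<in> \<int>"
proof
  assume "\<exists>P :: 'h \<Rightarrow> 'h. orthogonal_projection P \<and> has_diagonal P I d"
  then obtain P :: "'h \<Rightarrow> 'h" and e :: "'i \<Rightarrow> 'h" where P: "orthogonal_projection P" "is_onb I e"
    "\<And>i. i \<in> I \<Longrightarrow> cinner (P (e i)) (e i) = complex_of_real (d i)"
    by (auto simp: has_diagonal_def)
  then show "excess I d ({i \<in> I. d i < 1/2}) \<in> \<int>" using projection_excess_integer J0 by blast
next
  assume int: "excess I d ({i \<in> I. d i < 1/2}) \<in> \<int>"
  obtain e :: "'i \<Rightarrow> 'h" where e: "is_onb I e" using onb by blast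
  \<comment> \<open>Only \<open>n = 0\<close> occurs for the empty list, and the inequality says
    that the sum of \<open>d\<close> over \<open>J\<close> is nonnegative.\<close>
  have "feasible I d []"
    using d01 by (auto simp: feasible_def split_set_def intro!: infsum_nonneg)
  then obtain \<kappa> where \<kappa>: "\<And>i. i \<in> I \<Longrightarrow> 0 \<le> \<kappa> i \<and> \<kappa> i \<le> 1" "finite {i \<in> I. 0 < \<kappa> i \<and> \<kappa> i < 1}"
    "image_mset \<kappa> (mset_set {i \<in> I. 0 < \<kappa> i \<and> \<kappa> i < 1}) = mset []"
    "has_diagonal (diag_op I e (\<lambda>i. complex_of_real (\<kappa> i))) I d"
    using diagonal_realization[OF e d01 J0 infL infU, of "[]"] int by auto
  have "{i \<in> I. 0 < \<kappa> i \<and> \<kappa> i < 1} = {}" using \<kappa>(2,3) by (simp add: mset_set_empty_iff)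
  then have "\<kappa> i = 0 \<or> \<kappa> i = 1" if "i \<in> I" for i using \<kappa>(1)[OF that] that by fastforce
  then show "\<exists>P :: 'h \<Rightarrow> 'h. orthogonal_projection P \<and> has_diagonal P I d"
    using diag_op_projection[OF e] \<kappa>(4) by blast
qed

theorem theorem8p2:
  fixes I :: "'i set" and d :: "'i \<Rightarrow> real" and \<alpha> :: real and N :: nat
  assumes "countable I"
    and "\<And>i. i \<in> I \<Longrightarrow> d i \<in> {0..1}"
    and "0 < \<alpha>" and "\<alpha> < 1"
    and "d summable_on {i \<in> I. d i < \<alpha>}"
    and "(\<lambda>i. 1 - d i) summable_on {i \<in> I. \<alpha> \<le> d i}"
    and "infinite {i \<in> I. 0 < d i \<and> d i < 1/2}"
    and "infinite {i \<in> I. 1/2 \<le> d i \<and> d i < 1}"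
    and "1 \<le> N"
    and "\<exists>e :: 'i \<Rightarrow> 'h::chilbert_space. is_onb I e"
  shows
    "((\<nexists>P :: 'h \<Rightarrow> 'h. orthogonal_projection P \<and> has_diagonal P I d) \<longrightarrow>
        finite (minimal_classes (Lambda TYPE('h) I d N)) \<and>
        card (minimal_classes (Lambda TYPE('h) I d N)) = N \<and>
        (\<exists>\<eta> \<mu>. 0 \<le> \<eta> \<and> \<eta> < 1 \<and>
           (\<forall>k\<in>{0..<N}. \<mu> k \<in> open_cube N \<and> sum_list (\<mu> k) = real k + \<eta>) \<and>
           Lambda TYPE('h) I d N = (\<Union>k\<in>{0..<N}. {l \<in> open_cube N. \<mu> k \<preceq>\<^sub>m l}))) \<and>
     ((\<exists>P :: 'h \<Rightarrow> 'h. orthogonal_projection P \<and> has_diagonal P I d) \<longrightarrow>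
        finite (minimal_classes (Lambda TYPE('h) I d N)) \<and>
        card (minimal_classes (Lambda TYPE('h) I d N)) = N - 1 \<and>
        (\<exists>\<mu>. (\<forall>k\<in>{1..<N}. \<mu> k \<in> open_cube N \<and> sum_list (\<mu> k) = real k) \<and>
           Lambda TYPE('h) I d N = (\<Union>k\<in>{1..<N}. {l \<in> open_cube N. \<mu> k \<preceq>\<^sub>m l})))"
proof -
  have d01: "0 \<le> d i \<and> d i \<le> 1" if "i \<in> I" for i using assms(2)[OF that] by simp
  have "I - {i \<in> I. d i < \<alpha>} = {i \<in> I. \<alpha> \<le> d i}" by auto
  then have "split_set I d {i \<in> I. d i < \<alpha>}" using assms(5,6) by (simp add: split_set_def)
  then have J0: "split_set I d {i \<in> I. d i < 1/2}"
    using split_set_change_threshold[where I=I and d=d and \<alpha>=\<alpha> and \<beta>="1/2"] d01 assms(3,4) by simp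
  define c where "c = excess I d {i \<in> I. d i < 1/2}"
  have proj: "(\<exists>P :: 'h \<Rightarrow> 'h. orthogonal_projection P \<and> has_diagonal P I d) \<longleftrightarrow> c \<in> \<int>"
    unfolding c_def by (rule projection_diagonal_iff[OF assms(10) d01 J0 assms(7,8)])
  have L: "l \<in> Lambda TYPE('h) I d N \<longleftrightarrow> l \<in> open_cube N \<and> sum_list l - c \<in> \<int> \<and> feasible I d l" for l
    unfolding c_def by (rule Lambda_iff[OF assms(10) d01 J0 assms(7,8)])
  note structure_thm = Lambda_structure[OF d01 assms(7,8,9) L finite_atLeastLessThan]
  show ?thesis
  proof ((rule conjI; rule impI), goal_cases)
    case 1
    then have c: "c \<notin> \<int>" using proj by simp
    \<comment> \<open>The sums congruent to \<open>c\<close> are the numbers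
      \<open>k + \<eta>\<close>. As \<eta> is strictly between 0 and 1, exactly
      \<open>k = 0, ..., N - 1\<close> give values strictly between 0 and \<open>N\<close>.\<close>
    define \<eta> where "\<eta> = frac c"
    have \<eta>: "0 < \<eta>" "\<eta> < 1" using c by (auto simp: \<eta>_def frac_gt_0_iff frac_lt_1)
    have "0 < s \<and> s < real N \<and> s - c \<in> \<int> \<longleftrightarrow> (\<exists>k\<in>{0..<N}. s = real k + \<eta>)" for s
    proof
      assume s: "0 < s \<and> s < real N \<and> s - c \<in> \<int>"
      then obtain z where "s - c = of_int z" by (auto elim: Ints_cases)
      then have z: "s = of_int (z + \<lfloor>c\<rfloor>) + \<eta>" by (simp add: \<eta>_def frac_def)
      then have "0 \<le> z + \<lfloor>c\<rfloor>" "z + \<lfloor>c\<rfloor> < int N" using s \<eta> by linarith+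
      then show "\<exists>k\<in>{0..<N}. s = real k + \<eta>" using z by (intro bexI[of _ "nat (z + \<lfloor>c\<rfloor>)"]) auto
    next
      assume "\<exists>k\<in>{0..<N}. s = real k + \<eta>"
      then obtain k where k: "k < N" "s = real k + \<eta>" by auto
      have "s - c = of_int (int k - \<lfloor>c\<rfloor>)" using k by (simp add: \<eta>_def frac_def)
      then have "s - c \<in> \<int>" by (metis Ints_of_int)
      moreover have "real k + 1 \<le> real N" using k(1) by linarith
      ultimately show "0 < s \<and> s < real N \<and> s - c \<in> \<int>" using k \<eta> by auto
    qed
    from structure_thm[OF _ this] have "finite (minimal_classes (Lambda TYPE('h) I d N)) \<and>
        card (minimal_classes (Lambda TYPE('h) I d N)) = N \<and>
        (\<exists>\<mu>. (\<forall>k\<in>{0..<N}. \<mu> k \<in> open_cube N \<and> sum_list (\<mu> k) = real k + \<eta>) \<and>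
           Lambda TYPE('h) I d N = (\<Union>k\<in>{0..<N}. {l \<in> open_cube N. \<mu> k \<preceq>\<^sub>m l}))"
      by simp
    moreover have "0 \<le> \<eta>" "\<eta> < 1" using \<eta> by auto
    ultimately show ?case by blast
  next
    case 2
    then have c: "c \<in> \<int>" using proj by simp
    \<comment> \<open>With \<eta> equal to 0 the sum is an integer, and strict positivity excludes
      \<open>k = 0\<close>. The summand 0 is kept to match the form of the structure lemma.\<close>
    have "0 < s \<and> s < real N \<and> s - c \<in> \<int> \<longleftrightarrow> (\<exists>k\<in>{1..<N}. s = real k + 0)" for s
    proof
      assume s: "0 < s \<and> s < real N \<and> s - c \<in> \<int>"
      then have "s \<in> \<int>" using c Ints_add by fastforce
      then obtain z where "s = of_int z" by (auto elim: Ints_cases)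
      then show "\<exists>k\<in>{1..<N}. s = real k + 0" using s by (intro bexI[of _ "nat z"]) auto
    qed (use c in \<open>auto intro: Ints_diff\<close>)
    from structure_thm[OF _ this] show ?case by simp
  qed
qed

end
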